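(* Let $W$ be one of $W_H$, $W_L$, $W_J$, and let $\rho(x)=1$, $x$, or $1-x^2$ respectively. If $\mathcal A\in\mathcal D(W)$ is a differential operator of order $2m$, then its leading coefficient is of the form $c\,\rho(x)^mI$ for some $c\in\mathbb C$.
   Context: For a weight matrix $W$ with monic orthogonal polynomials $P_n$ (w.r.t. $\langle P,Q\rangle=\int PWQ^*dx$), $\mathcal D(W)$ is the algebra of differential operators $D=\sum_j\partial^jF_j$ with matrix polynomial coefficients, acting on the right by $P\cdot D=\sum_j\partial^j(P)F_j$, such that $P_n\cdot D=\Lambda_n(D)P_n$ for all $n\ge0$ with constant matrices $\Lambda_n(D)$; the leading coefficient of an operator of order $k$ is $F_k$. Classical scalar weights: Hermite $w_b(x)=e^{-x^2+2bx}$ on $\mathbb R$; Laguerre $w_\alpha(x)=e^{-x}x^\alpha$ on $(0,\infty)$, $\alpha>-1$; Jacobi $w_{\alpha,\beta}(x)=(1-x)^\alpha(1+x)^\beta$ on $(-1,1)$, $\alpha,\beta>-1$. Let $N\ge2$, $A=\sum_{j=1}^{\lfloor N/2\rfloor}a_{2j-1}E_{2j-1,2j}+\sum_{j=1}^{\lfloor (N-1)/2\rfloor}a_{2j}E_{2j+1,2j}$ ($E_{s,t}$ matrix units, all $a_j\in\mathbb R\setminus\{0\}$), $T(x)=I+Ax$. $W_H=T\,\mathrm{diag}(w_{b_1},\dots,w_{b_N})\,T^*$ with $b_i$ pairwise distinct reals; $W_L=T\,\mathrm{diag}(w_{\alpha_1},\dots,w_{\alpha_N})\,T^*$ with $\alpha_i-\alpha_j\notin\mathbb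 Z$ for $i\ne j$; $W_J=T\,\mathrm{diag}(w_{\alpha_1,\beta_1},\dots,w_{\alpha_N,\beta_N})\,T^*$ with, for $i\ne j$, $\alpha_i-\alpha_j\notin\mathbb Z$ or $\beta_i-\beta_j\notin\mathbb Z$, and $\alpha_1+\beta_1=\alpha_j+\beta_j+1+(-1)^j$ for all $j$. *)

theory Defs
  imports "HOL-Analysis.Analysis" "HOL-Computational_Algebra.Polynomial" "Jordan_Normal_Form.Matrix"
begin

text \<open>Matrix polynomials of size N x N with complex coefficients are represented as
  elements of type complex poly mat (in carrier_mat N N). Indices are 0-based in the
  Isabelle encoding; the paper's 1-based indices i correspond to i-1 here, while the
  parameter sequences a, b, alpha, beta are indexed 1-based as in the paper.\<close>

definition cmat_star :: "complex mat \<Rightarrow> complex mat" where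
  "cmat_star M = mat (dim_col M) (dim_row M) (\<lambda>(i,j). cnj (M $$ (j,i)))"

definition peval :: "complex poly mat \<Rightarrow> real \<Rightarrow> complex mat" where
  "peval P x = map_mat (\<lambda>p. poly p (complex_of_real x)) P"

definition ip_integrand :: "real set \<Rightarrow> (real \<Rightarrow> complex mat) \<Rightarrow> complex poly mat \<Rightarrow> complex poly mat
     \<Rightarrow> nat \<Rightarrow> nat \<Rightarrow> real \<Rightarrow> complex" where
  "ip_integrand S W P Q i j x = (peval P x * W x * cmat_star (peval Q x)) $$ (i,j)"

definition monic_of_degree :: "nat \<Rightarrow> complex poly mat \<Rightarrow> nat \<Rightarrow> bool" where
  "monic_of_degree N P n \<longleftrightarrow> P \<in> carrier_mat N N \<and>
     (\<forall>i<N. \<forall>j<N. degree (P $$ (i,j)) \<le> n) \<and>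
     map_mat (\<lambda>p. coeff p n) P = 1\<^sub>m N"

definition monic_orth_seq :: "nat \<Rightarrow> real set \<Rightarrow> (real \<Rightarrow> complex mat) \<Rightarrow> (nat \<Rightarrow> complex poly mat) \<Rightarrow> bool" where
  "monic_orth_seq N S W P \<longleftrightarrow> (\<forall>n. monic_of_degree N (P n) n \<and>
     (\<forall>k<n. \<forall>i<N. \<forall>j<N.
        (ip_integrand S W (P n) (monom 1 k \<cdot>\<^sub>m 1\<^sub>m N) i j) integrable_on S \<and>
        integral S (ip_integrand S W (P n) (monom 1 k \<cdot>\<^sub>m 1\<^sub>m N) i j) = 0))"

definition diff_act :: "nat \<Rightarrow> (nat \<Rightarrow> complex poly mat) \<Rightarrow> nat \<Rightarrow> complex poly mat \<Rightarrow> complex poly mat" where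
  "diff_act N F k P = mat N N (\<lambda>(r,s). \<Sum>j\<le>k. \<Sum>l<N. (pderiv ^^ j) (P $$ (r,l)) * (F j $$ (l,s)))"

definition op_order :: "nat \<Rightarrow> (nat \<Rightarrow> complex poly mat) \<Rightarrow> nat \<Rightarrow> bool" where
  "op_order N F k \<longleftrightarrow> (\<forall>j. F j \<in> carrier_mat N N) \<and> F k \<noteq> 0\<^sub>m N N \<and> (\<forall>j>k. F j = 0\<^sub>m N N)"

definition in_DW :: "nat \<Rightarrow> real set \<Rightarrow> (real \<Rightarrow> complex mat) \<Rightarrow> (nat \<Rightarrow> complex poly mat) \<Rightarrow> nat \<Rightarrow> bool" where
  "in_DW N S W F k \<longleftrightarrow> (\<forall>P. monic_orth_seq N S W P \<longrightarrow>
     (\<forall>n. \<exists>\<Lambda> \<in> carrier_mat N N. diff_act N F k (P n) = map_mat (\<lambda>c. [:c:]) \<Lambda> * P n))"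

text \<open>The matrix A (0-based): paper entry (i,i+1) = a_i for i odd, (i+1,i) = a_i for i even.\<close>
definition matA :: "nat \<Rightarrow> (nat \<Rightarrow> real) \<Rightarrow> complex mat" where
  "matA N a = mat N N (\<lambda>(r,s).
     if s = r + 1 \<and> odd (r + 1) then complex_of_real (a (r + 1))
     else if r = s + 1 \<and> even (s + 1) then complex_of_real (a (s + 1)) else 0)"

definition matT :: "nat \<Rightarrow> (nat \<Rightarrow> real) \<Rightarrow> real \<Rightarrow> complex mat" where
  "matT N a x = 1\<^sub>m N + complex_of_real x \<cdot>\<^sub>m matA N a"

definition diag_weight :: "nat \<Rightarrow> (nat \<Rightarrow> real \<Rightarrow> real) \<Rightarrow> real \<Rightarrow> complex mat" where
  "diag_weight N w x = mat N N (\<lambda>(r,s). if r = s then complex_of_real (w (r + 1) x) else 0)"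

definition weightW :: "nat \<Rightarrow> (nat \<Rightarrow> real) \<Rightarrow> (nat \<Rightarrow> real \<Rightarrow> real) \<Rightarrow> real \<Rightarrow> complex mat" where
  "weightW N a w x = matT N a x * diag_weight N w x * cmat_star (matT N a x)"

definition hermite_w :: "real \<Rightarrow> real \<Rightarrow> real" where
  "hermite_w b x = exp (- x\<^sup>2 + 2 * b * x)"

definition laguerre_w :: "real \<Rightarrow> real \<Rightarrow> real" where
  "laguerre_w \<alpha> x = exp (- x) * x powr \<alpha>"

definition jacobi_w :: "real \<Rightarrow> real \<Rightarrow> real \<Rightarrow> real" where
  "jacobi_w \<alpha> \<beta> x = (1 - x) powr \<alpha> * (1 + x) powr \<beta>"

definition leading_coeff_property :: "nat \<Rightarrow> real set \<Rightarrow> (real \<Rightarrow> complex mat) \<Rightarrow> complex poly \<Rightarrow> bool" where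
  "leading_coeff_property N S W \<rho> \<longleftrightarrow> (\<forall>F m. op_order N F (2*m) \<and> in_DW N S W F (2*m) \<longrightarrow>
     (\<exists>c::complex. F (2*m) = ([:c:] * \<rho> ^ m) \<cdot>\<^sub>m 1\<^sub>m N))"

end

theory Submission
  imports Defs "HOL-Probability.Distributions" "HOL-Real_Asymp.Real_Asymp"
    "HOL-Computational_Algebra.Fundamental_Theorem_Algebra"
begin

text \<open>Let \<open>L\<^sub>i\<close> be integration against \<open>w\<^sub>i\<close>. An operator in the algebra preserves the spaces of
  row polynomials of bounded degree and their orthogonal complements, so it has an adjoint with the
  same property. Conjugation by \<open>T = I + A x\<close>, whose inverse \<open>I - A x\<close> is polynomial because
  \<open>A\<^sup>2 = 0\<close>, turns it into an operator \<open>E\<close> with polynomial coefficients and an adjoint with respect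
  to the diagonal weight, that is \<open>L\<^sub>j ((E\<^sub>i\<^sub>j f) g) = L\<^sub>i (f (\<psi> g))\<close>. For \<open>f\<close> in a
  sequence like \<open>x\<^sup>n\<close>, \<open>(1 \<plusminus> x)\<^sup>n\<close> or the Hermite polynomials, the two sides are rational functions of \<open>n\<close>
  times the moments of \<open>w\<^sub>j\<close> and of \<open>w\<^sub>i\<close>. The quotient of these moments is not rational in \<open>n\<close> if
  \<open>i \<noteq> j\<close>, hence \<open>E\<close> is diagonal.

  The entry \<open>E\<^sub>i\<^sub>i\<close> acts on the orthogonal polynomials of \<open>w\<^sub>i\<close> by an eigenvalue
  \<open>\<Lambda>\<^sub>i n\<close> which is polynomial in \<open>n\<close>. It is thus a polynomial in the classical operator
  \<open>\<rho> \<partial>\<^sup>2 + \<tau> \<partial>\<close> (Hermite, Laguerre) or at least commutes with it (Jacobi), and in both cases its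
  leading coefficient is \<open>c\<^sub>i \<rho>\<^sup>m\<close>, where \<open>c\<^sub>i\<close> is read off from \<open>\<Lambda>\<^sub>i\<close>. The
  off-diagonal entries of the original operator are \<open>a (E\<^sub>s (x f) - x E\<^sub>r f)\<close> for neighbours
  \<open>r\<close> and \<open>s\<close>. As they do not raise degrees, \<open>\<Lambda>\<^sub>s (n + 1) = \<Lambda>\<^sub>r n\<close>, so all \<open>c\<^sub>i\<close> agree and
  the leading coefficient is scalar.\<close>

hide_const (open) Module.smult

subsection \<open>Moment functionals of the classical weights\<close>

text \<open>The adjoint is obtained from Riesz representation on finite-dimensional spaces, so it is
  only a map on polynomials, not known to be a differential operator; every comparison has to
  tolerate an arbitrary map on that side. Two devices achieve this. A degree-lowering map whose
  adjoint does not raise degrees is zero, which promotes equality of leading terms to equality of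
  operators. And a sequence with consecutive ratios \<open>r n\<close> is measured by the limit of
  \<open>n (r n - 1)\<close>: for rational functions of \<open>n\<close> this is an integer, whereas
  quotients of moments give differences of exponents up to integers (Laguerre, Jacobi) or no finite
  limit at all (Hermite, where the quotients are geometric). The Jacobi case leaves the common
  pattern because the classical eigenvalue is quadratic in \<open>n\<close>: a polynomial in
  \<open>n\<close> is not evidently a polynomial in that quadratic, so the operator cannot simply be
  written through the classical one. Commuting with it is enough, since the highest coefficient of
  the commutator is a first-order differential equation for the leading coefficient.\<close>

locale pos_functional =
  fixes L :: "complex poly \<Rightarrow> complex"
  assumes L_add: "L (p + q) = L p + L q"
    and L_smult: "L (smult c p) = c * L p"
    and L_cnj: "L (map_poly cnj p) = cnj (L p)"
    and L_nonneg: "0 \<le> Re (L (p * map_poly cnj p))"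
    and L_pos: "L (p * map_poly cnj p) = 0 \<Longrightarrow> p = 0"

text \<open>Weak form of the Pearson equation \<open>(\<rho> w)' = \<tau> w\<close>: the argument of
  \<open>L\<close> times \<open>w\<close> is the derivative of \<open>\<rho> p w\<close>, so for a
  weight the axiom says that the boundary terms vanish.\<close>

locale pearson_functional = pos_functional +
  fixes \<rho> \<tau> :: "complex poly"
  assumes pearson: "L (\<rho> * pderiv p + \<tau> * p) = 0"

definition moment_functional :: "real set \<Rightarrow> (real \<Rightarrow> real) \<Rightarrow> complex poly \<Rightarrow> complex" where
  "moment_functional S w p = integral S (\<lambda>x. poly p (of_real x) * of_real (w x))"

definition poly_integrable :: "real set \<Rightarrow> (real \<Rightarrow> real) \<Rightarrow> bool" where
  "poly_integrable S w \<longleftrightarrow>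
     (\<forall>p :: complex poly. set_integrable lborel S (\<lambda>x. poly p (of_real x) * of_real (w x)))"

text \<open>The centre \<open>c\<close> is free so that Gaussian moments can be taken about the
  mean; powers of \<open>x - c\<close> span all polynomials, and \<open>q\<close> is the Taylor
  shift of \<open>p\<close>.\<close>

lemma poly_integrable_monomialsI:
  assumes "\<And>n. set_integrable lborel S (\<lambda>x. (x - c) ^ n * w x)"
  shows "poly_integrable S w"
  unfolding poly_integrable_def
proof
  fix p :: "complex poly"
  define q where "q = pcompose p [:of_real c, 1:]"
  have *: "poly p (of_real x) = (\<Sum>i\<le>degree q. coeff q i * of_real ((x - c) ^ i))" for x
  proof -
    have "poly p (of_real x) = poly q (of_real (x - c))"
      by (simp add: q_def poly_pcompose)
    then show ?thesis
      by (simp add: poly_altdef)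
  qed
  have "integrable lborel (\<lambda>x. \<Sum>i\<le>degree q. indicator S x *\<^sub>R (coeff q i * complex_of_real ((x - c) ^ i * w x)))"
  proof (intro Bochner_Integration.integrable_sum set_integrable_mult_right[unfolded set_integrable_def])
    fix i
    have "set_integrable lborel S (\<lambda>x. complex_of_real ((x - c) ^ i * w x))"
      using integrable_of_real[OF assms[of i, unfolded set_integrable_def]]
      unfolding set_integrable_def by (simp add: scaleR_conv_of_real)
    then show "integrable lborel (\<lambda>x. indicator S x *\<^sub>R complex_of_real ((x - c) ^ i * w x))"
      by (simp add: set_integrable_def)
  qed
  then show "set_integrable lborel S (\<lambda>x. poly p (of_real x) * of_real (w x))"
    by (simp add: * set_integrable_def sum_distrib_right scaleR_sum_right mult.assoc)
qed

lemma poly_integrable_on: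
  assumes "poly_integrable S w"
  shows "(\<lambda>x. poly p (complex_of_real x) * of_real (w x)) integrable_on S"
  using assms unfolding poly_integrable_def by (blast intro: set_borel_integral_eq_integral)

text \<open>Definiteness is the point: a vanishing integral of \<open>|p|^2 w\<close> forces
  \<open>p\<close> to vanish almost everywhere on \<open>S\<close>, so a nonzero \<open>p\<close>,
  having finitely many zeros, would make the nonempty open set \<open>S\<close> null.\<close>

lemma pos_functional_moment_functional:
  assumes int: "poly_integrable S w" and S: "open S" "S \<noteq> {}"
    and pos: "\<And>x. x \<in> S \<Longrightarrow> w x > 0"
  shows "pos_functional (moment_functional S w)"
proof
  note I = poly_integrable_on[OF int]
  fix p q :: "complex poly" and c
  show "moment_functional S w (p + q) = moment_functional S w p + moment_functional S w q"
    unfolding moment_functional_def by (simp add: ring_distribs integral_add[OF I I])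
  show "moment_functional S w (smult c p) = c * moment_functional S w p"
    unfolding moment_functional_def by (simp add: mult.assoc)
  show "moment_functional S w (map_poly cnj p) = cnj (moment_functional S w p)"
    unfolding moment_functional_def integral_cnj
    by (intro integral_cong) (simp add: poly_cnj_real flip: poly_cnj)
  define g where "g x = (norm (poly p (complex_of_real x)))\<^sup>2 * w x" for x
  have g: "poly (p * map_poly cnj p) (complex_of_real x) * of_real (w x) = of_real (g x)" for x
  proof -
    have "poly (map_poly cnj p) (complex_of_real x) = cnj (poly p (of_real x))"
      using poly_cnj[of p "of_real x"] by simp
    then show ?thesis by (simp add: g_def flip: complex_norm_square)
  qed
  have "set_integrable lborel S (\<lambda>x. complex_of_real (g x))"
    using int unfolding poly_integrable_def g[symmetric] by blast
  then have gi: "set_integrable lborel S g"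
    unfolding set_integrable_def using integrable_Re by fastforce
  have L: "moment_functional S w (p * map_poly cnj p) = of_real (integral S g)"
    using integral_linear[OF set_borel_integral_eq_integral(1)[OF gi] bounded_linear_of_real[where 'a=complex]]
    unfolding moment_functional_def g by (simp add: o_def)
  show "0 \<le> Re (moment_functional S w (p * map_poly cnj p))"
    unfolding L using pos set_borel_integral_eq_integral(1)[OF gi]
    by (auto simp: g_def less_imp_le intro!: integral_nonneg)
  assume "moment_functional S w (p * map_poly cnj p) = 0"
  then have "integral S g = 0" by (simp add: L)
  then have "(LINT x:S|lborel. g x) = 0"
    using set_borel_integral_eq_integral(2)[OF gi] by simp
  then have "AE x in lborel. indicator S x *\<^sub>R g x = 0"
    unfolding set_lebesgue_integral_def using gi[unfolded set_integrable_def]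
    by (subst (asm) integral_nonneg_eq_0_iff_AE) (auto simp: indicator_def g_def pos less_imp_le)
  then have ae: "AE x in lborel. x \<in> S \<longrightarrow> poly p (complex_of_real x) = 0"
    by eventually_elim (use pos in \<open>fastforce simp: g_def indicator_def\<close>)
  show "p = 0"
  proof (rule ccontr)
    assume "p \<noteq> 0"
    then have "finite (complex_of_real -` {z. poly p z = 0})"
      by (intro finite_vimageI poly_roots_finite) (auto simp: inj_def)
    then have "AE x in lborel. x \<notin> complex_of_real -` {z. poly p z = 0}"
      by (intro AE_not_in finite_imp_null_set_lborel)
    with ae have "AE x in lborel. x \<notin> S"
      by eventually_elim auto
    then have "emeasure lborel S = 0"
      using S by (subst (asm) AE_iff_measurable[where N=S]) auto
    then have "S \<in> null_sets lborel" using S by auto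
    then show False
      using S open_not_negligible[of S] by (auto simp: negligible_iff_null_sets intro: null_sets_completionI)
  qed
qed

text \<open>Fundamental theorem of calculus for \<open>F = \<rho> p w\<close>, whose one-sided
  limits at both ends are zero. The assumption \<open>rho\<close> is the Pearson equation solved for
  \<open>\<rho> w'\<close>, and it makes \<open>f\<close> the derivative of
  \<open>F\<close>.\<close>

lemma pearson_functional_moment_functional:
  fixes a b :: ereal
  assumes S: "S = einterval a b" "a < b" and int: "poly_integrable S w"
    and pos: "\<And>x. x \<in> S \<Longrightarrow> w x > 0"
    and deriv: "\<And>x. x \<in> S \<Longrightarrow> (w has_real_derivative w' x) (at x)"
    and rho: "\<And>x. x \<in> S \<Longrightarrow> poly \<rho> (of_real x) * of_real (w' x) = poly (\<tau> - pderiv \<rho>) (of_real x) * complex_of_real (w x)"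
    and lim: "\<And>p. (((\<lambda>x. poly (\<rho> * p) (of_real x) * complex_of_real (w x)) \<circ> real_of_ereal) \<longlongrightarrow> 0) (at_right a)"
             "\<And>p. (((\<lambda>x. poly (\<rho> * p) (of_real x) * complex_of_real (w x)) \<circ> real_of_ereal) \<longlongrightarrow> 0) (at_left b)"
  shows "pearson_functional (moment_functional S w) \<rho> \<tau>"
proof -
  have "S \<noteq> {}" using S einterval_nonempty by auto
  then interpret pos_functional "moment_functional S w"
    using S pos by (intro pos_functional_moment_functional int) auto
  have "moment_functional S w (\<rho> * pderiv p + \<tau> * p) = 0" for p
  proof -
    define f where "f x = poly (\<rho> * pderiv p + \<tau> * p) (of_real x) * complex_of_real (w x)" for x
    define F where "F x = poly (\<rho> * p) (of_real x) * complex_of_real (w x)" for x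
    have F: "(F has_vector_derivative f x) (at x)" if "x \<in> S" for x
    proof -
      have 1: "((\<lambda>x. poly (\<rho> * p) (of_real x)) has_vector_derivative poly (pderiv (\<rho> * p)) (of_real x)) (at x)"
        by (rule has_vector_derivative_real_field) (rule poly_DERIV)
      have 2: "((\<lambda>x. complex_of_real (w x)) has_vector_derivative of_real (w' x)) (at x)"
        using deriv[OF that] by (auto intro!: has_vector_derivative_of_real simp: has_real_derivative_iff_has_vector_derivative)
      have "f x = poly (\<rho> * p) (of_real x) * of_real (w' x) + poly (pderiv (\<rho> * p)) (of_real x) * of_real (w x)"
        using arg_cong[OF rho[OF that], of "\<lambda>t. poly p (of_real x) * t"]
        by (simp add: f_def pderiv_mult algebra_simps)
      then show ?thesis
        unfolding F_def using has_vector_derivative_mult[OF 1 2] by simp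
    qed
    have "isCont f x" if "x \<in> S" for x
      unfolding f_def using deriv[OF that] 
      by (intro continuous_intros) (auto dest: DERIV_isCont)
    moreover have fi: "set_integrable lborel S f"
      using int unfolding poly_integrable_def f_def by blast
    ultimately have "(LBINT x=a..b. f x) = 0 - 0"
      using S F lim[of p, folded F_def]
      by (intro interval_integral_FTC_integrable[where F=F]) (auto simp: einterval_def)
    then have "(LINT x:S|lborel. f x) = 0"
      using S by (simp add: interval_lebesgue_integral_def less_imp_le)
    then show ?thesis
      using set_borel_integral_eq_integral(2)[OF fi] by (simp only: moment_functional_def flip: f_def)
  qed
  then show ?thesis by unfold_locales
qed

lemma poly_mult_tendsto_zeroI:
  assumes "\<And>n. ((\<lambda>x. x ^ n * v x) \<longlongrightarrow> 0) F"
  shows "((\<lambda>x. poly p (complex_of_real x) * complex_of_real (v x)) \<longlongrightarrow> 0) F"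
proof -
  have "((\<lambda>x. \<Sum>i\<le>degree p. coeff p i * complex_of_real (x ^ i * v x)) \<longlongrightarrow>
          (\<Sum>i\<le>degree p. coeff p i * of_real 0)) F"
    by (intro tendsto_intros assms)
  then show ?thesis
    by (simp add: poly_altdef sum_distrib_right mult.assoc)
qed

section \<open>Integrability and Pearson equation for the three weight families\<close>

lemma poly_integrable_hermite: "poly_integrable UNIV (hermite_w b)"
proof (rule poly_integrable_monomialsI)
  fix n
  \<comment> \<open>Completing the square: the weight is a multiple of the normal density with mean
    \<open>b\<close> and variance 1/2; the factor undoes the normalisation and the shift.\<close>
  have "(x - b) ^ n * hermite_w b x =
      (exp (b\<^sup>2) * sqrt pi) * (normal_density b (1 / sqrt 2) x * (x - b) ^ n)" for x
  proof -
    have "exp (b\<^sup>2) * exp (- (x - b)\<^sup>2) = hermite_w b x"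
      by (simp add: hermite_w_def power2_eq_square algebra_simps flip: exp_add)
    then show ?thesis
      by (simp add: normal_density_def power_divide field_simps)
  qed
  then show "set_integrable lborel UNIV (\<lambda>x. (x - b) ^ n * hermite_w b x)"
    by (simp only: set_integrable_def indicator_UNIV scaleR_one)
      (intro integrable_mult_right integrable_normal_moment, simp)
qed

lemma pearson_functional_hermite:
  "pearson_functional (moment_functional UNIV (hermite_w b)) 1 [:2 * of_real b, -2:]"
proof (rule pearson_functional_moment_functional[where a="-\<infinity>" and b="\<infinity>" and w'="\<lambda>x. (2 * b - 2 * x) * hermite_w b x"])
  show "(hermite_w b has_real_derivative (2 * b - 2 * x) * hermite_w b x) (at x)" for x
    unfolding hermite_w_def by (auto intro!: derivative_eq_intros simp: algebra_simps)
  show "poly 1 (complex_of_real x) * complex_of_real ((2 * b - 2 * x) * hermite_w b x) =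
      poly ([:2 * of_real b, -2:] - pderiv 1) (complex_of_real x) * complex_of_real (hermite_w b x)" for x
    by (simp add: algebra_simps)
  have "((\<lambda>x. x ^ n * hermite_w b x) \<longlongrightarrow> 0) at_top" for n
    unfolding hermite_w_def by real_asymp
  then show "(((\<lambda>x. poly (1 * p) (complex_of_real x) * complex_of_real (hermite_w b x)) \<circ> real_of_ereal) \<longlongrightarrow> 0) (at_left \<infinity>)" for p
    unfolding ereal_tendsto_simps by (rule poly_mult_tendsto_zeroI)
  have "((\<lambda>x. x ^ n * hermite_w b x) \<longlongrightarrow> 0) at_bot" for n
    unfolding hermite_w_def by real_asymp
  then show "(((\<lambda>x. poly (1 * p) (complex_of_real x) * complex_of_real (hermite_w b x)) \<circ> real_of_ereal) \<longlongrightarrow> 0) (at_right (-\<infinity>))" for p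
    unfolding ereal_tendsto_simps by (rule poly_mult_tendsto_zeroI)
qed (auto simp: poly_integrable_hermite hermite_w_def)

lemma poly_integrable_laguerre:
  assumes "\<alpha> > -1"
  shows "poly_integrable {0<..} (laguerre_w \<alpha>)"
proof (rule poly_integrable_monomialsI[where c=0])
  fix n
  have eq: "complex_of_real t powr (of_real (\<alpha> + n + 1) - 1) / of_real (exp t) = of_real (t ^ n * laguerre_w \<alpha> t)"
    if "t \<in> {0<..}" for t
  proof -
    have "complex_of_real t powr (of_real (\<alpha> + n + 1) - 1) = of_real (t powr (\<alpha> + n))"
      using that powr_of_real[of t "\<alpha> + n"] by simp
    also have "\<dots> = of_real (t ^ n * t powr \<alpha>)"
      using that by (simp add: powr_add powr_realpow)
    finally show ?thesis
      by (simp add: laguerre_w_def exp_minus field_simps)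
  qed
  \<comment> \<open>The Gamma integral with parameter \<open>\<alpha> + n + 1\<close>, which is
    positive for every \<open>n\<close> since \<open>\<alpha> > -1\<close>.\<close>
  have "(\<lambda>t. complex_of_real t powr (of_real (\<alpha> + n + 1) - 1) / of_real (exp t)) absolutely_integrable_on {0<..}"
    using assms by (intro absolutely_integrable_Gamma_integral') simp
  then have "(\<lambda>t. complex_of_real (t ^ n * laguerre_w \<alpha> t)) absolutely_integrable_on {0<..}"
    by (subst (asm) set_integrable_cong[OF refl refl eq]) auto
  then have "set_integrable lebesgue {0<..} (\<lambda>t. t ^ n * laguerre_w \<alpha> t)"
    unfolding set_integrable_def using integrable_Re by fastforce
  then show "set_integrable lborel {0<..} (\<lambda>t. (t - 0) ^ n * laguerre_w \<alpha> t)"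
    unfolding set_integrable_def laguerre_w_def by (subst (asm) integrable_completion) auto
qed

lemma pearson_functional_laguerre:
  assumes "\<alpha> > -1"
  shows "pearson_functional (moment_functional {0<..} (laguerre_w \<alpha>)) [:0, 1:] [:of_real \<alpha> + 1, -1:]"
proof (rule pearson_functional_moment_functional[where a="0" and b="\<infinity>" and w'="\<lambda>x. (\<alpha> / x - 1) * laguerre_w \<alpha> x"])
  show "(laguerre_w \<alpha> has_real_derivative (\<alpha> / x - 1) * laguerre_w \<alpha> x) (at x)" if "x \<in> {0<..}" for x
    using that unfolding laguerre_w_def
    by (auto intro!: derivative_eq_intros simp: algebra_simps powr_diff)
  show "poly [:0, 1:] (complex_of_real x) * complex_of_real ((\<alpha> / x - 1) * laguerre_w \<alpha> x) =
      poly ([:of_real \<alpha> + 1, -1:] - pderiv [:0, 1:]) (complex_of_real x) * complex_of_real (laguerre_w \<alpha> x)"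
    if "x \<in> {0<..}" for x
    using that by (simp add: field_simps pderiv_pCons)
  have "((\<lambda>x. x ^ n * laguerre_w \<alpha> x) \<longlongrightarrow> 0) at_top" for n
    unfolding laguerre_w_def by real_asymp
  then show "(((\<lambda>x. poly ([:0, 1:] * p) (complex_of_real x) * complex_of_real (laguerre_w \<alpha> x)) \<circ> real_of_ereal) \<longlongrightarrow> 0) (at_left \<infinity>)" for p
    unfolding ereal_tendsto_simps by (rule poly_mult_tendsto_zeroI)
  \<comment> \<open>At the origin the weight itself may blow up; the factor \<open>x\<close> from
    \<open>\<rho>\<close> turns the power into \<open>x powr (\<alpha> + 1)\<close>, which tends to
    0.\<close>
  have "((\<lambda>x. x * laguerre_w \<alpha> x) \<longlongrightarrow> 0) (at_right 0)"
    unfolding laguerre_w_def using assms by real_asymp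
  then have "((\<lambda>x. poly p (complex_of_real x) * of_real (x * laguerre_w \<alpha> x)) \<longlongrightarrow> poly p (of_real 0) * of_real 0) (at_right 0)" for p
    by (intro tendsto_intros)
  then have "((\<lambda>x. poly ([:0, 1:] * p) (complex_of_real x) * complex_of_real (laguerre_w \<alpha> x)) \<longlongrightarrow> 0) (at_right 0)" for p
    by (simp add: algebra_simps)
  then show "(((\<lambda>x. poly ([:0, 1:] * p) (complex_of_real x) * complex_of_real (laguerre_w \<alpha> x)) \<circ> real_of_ereal) \<longlongrightarrow> 0) (at_right 0)" for p
    unfolding ereal_tendsto_simps zero_ereal_def by simp
qed (use assms in \<open>auto simp: poly_integrable_laguerre laguerre_w_def einterval_def zero_ereal_def\<close>)

lemma poly_integrable_jacobi:
  assumes "\<alpha> > -1" "\<beta> > -1"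
  shows "poly_integrable {-1<..<1} (jacobi_w \<alpha> \<beta>)"
proof (rule poly_integrable_monomialsI[where c=0])
  fix n
  have "set_integrable lborel {0..1} (\<lambda>t. t powr (\<beta> + 1 - 1) * (1 - t) powr (\<alpha> + 1 - 1))"
    using assms by (intro integrable_Beta) auto
  then have "integrable lborel (\<lambda>t. indicator {0..1} t *\<^sub>R (t powr \<beta> * (1 - t) powr \<alpha>))"
    by (simp add: set_integrable_def)
  \<comment> \<open>Substituting \<open>t = (1 + x) / 2\<close> carries the Beta integrand to the
    weight, and \<open>2 powr (\<alpha> + \<beta>)\<close> clears the halves. The powers of
    \<open>x\<close> are bounded by 1.\<close>
  from lborel_integrable_real_affine[OF this, of "1/2" "1/2"]
  have "integrable lborel (\<lambda>x. 2 powr (\<alpha> + \<beta>) * (indicator {0..1} (1/2 + 1/2 * x) *\<^sub>R ((1/2 + 1/2 * x) powr \<beta> * (1 - (1/2 + 1/2 * x)) powr \<alpha>)))"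
    by (intro integrable_mult_right) simp
  moreover have "2 powr (\<alpha> + \<beta>) * (indicator {0..1} (1/2 + 1/2 * x) *\<^sub>R ((1/2 + 1/2 * x) powr \<beta> * (1 - (1/2 + 1/2 * x)) powr \<alpha>))
      = indicator {-1..1} x *\<^sub>R jacobi_w \<alpha> \<beta> x" for x :: real
  proof (cases "x \<in> {-1..1}")
    case True
    have "1/2 + 1/2 * x = (1 + x) / 2" "1 - (1/2 + 1/2 * x) = (1 - x) / 2" by auto
    with True show ?thesis
      by (simp only: powr_divide jacobi_w_def) (simp add: powr_add indicator_def powr_divide)
  qed (auto simp: indicator_def)
  ultimately have "integrable lborel (\<lambda>x. indicator {-1..1} x *\<^sub>R jacobi_w \<alpha> \<beta> x)"
    by (simp only:)
  then show "set_integrable lborel {-1<..<1} (\<lambda>x. (x - 0) ^ n * jacobi_w \<alpha> \<beta> x)"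
    unfolding set_integrable_def
  proof (rule Bochner_Integration.integrable_bound)
    show "(\<lambda>x. indicator {-1<..<1} x *\<^sub>R ((x - 0) ^ n * jacobi_w \<alpha> \<beta> x)) \<in> borel_measurable lborel"
      unfolding jacobi_w_def by measurable
    have "\<bar>x ^ n * jacobi_w \<alpha> \<beta> x\<bar> \<le> jacobi_w \<alpha> \<beta> x" if "x \<in> {-1<..<1}" for x
    proof -
      have "\<bar>x\<bar> ^ n \<le> 1" using that by (intro power_le_one) auto
      then show ?thesis
        by (auto simp: abs_mult power_abs jacobi_w_def intro: mult_left_le_one_le)
    qed
    then show "AE x in lborel. norm (indicator {-1<..<1} x *\<^sub>R ((x - 0) ^ n * jacobi_w \<alpha> \<beta> x))
        \<le> norm (indicator {-1..1} x *\<^sub>R jacobi_w \<alpha> \<beta> x)"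
      by (intro AE_I2) (fastforce simp: indicator_def)
  qed
qed

lemma pearson_functional_jacobi:
  assumes "\<alpha> > -1" "\<beta> > -1"
  shows "pearson_functional (moment_functional {-1<..<1} (jacobi_w \<alpha> \<beta>)) [:1, 0, -1:]
           [:of_real \<beta> - of_real \<alpha>, - (of_real \<alpha> + of_real \<beta> + 2):]"
proof (rule pearson_functional_moment_functional[where a="-1" and b="1" and w'="\<lambda>x. (\<beta> / (1 + x) - \<alpha> / (1 - x)) * jacobi_w \<alpha> \<beta> x"])
  show "(jacobi_w \<alpha> \<beta> has_real_derivative (\<beta> / (1 + x) - \<alpha> / (1 - x)) * jacobi_w \<alpha> \<beta> x) (at x)"
    if "x \<in> {-1<..<1}" for x
    using that unfolding jacobi_w_def
    by (auto intro!: derivative_eq_intros simp: algebra_simps powr_diff)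
  show "poly [:1, 0, -1:] (complex_of_real x) * complex_of_real ((\<beta> / (1 + x) - \<alpha> / (1 - x)) * jacobi_w \<alpha> \<beta> x) =
      poly ([:of_real \<beta> - of_real \<alpha>, - (of_real \<alpha> + of_real \<beta> + 2):] - pderiv [:1, 0, -1:]) (complex_of_real x)
        * complex_of_real (jacobi_w \<alpha> \<beta> x)"
    if "x \<in> {-1<..<1}" for x
  proof -
    have "(1 - x * x) * (\<beta> / (1 + x) - \<alpha> / (1 - x)) = \<beta> - \<alpha> - (\<alpha> + \<beta>) * x"
    proof -
      have "(1 - x * x) * (\<beta> / (1 + x)) = \<beta> * (1 - x)" "(1 - x * x) * (\<alpha> / (1 - x)) = \<alpha> * (1 + x)"
        using that by (auto simp: field_simps)
      then show ?thesis by (simp add: algebra_simps)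
    qed
    then have "complex_of_real ((1 - x * x) * (\<beta> / (1 + x) - \<alpha> / (1 - x))) = of_real (\<beta> - \<alpha> - (\<alpha> + \<beta>) * x)"
      by (rule arg_cong)
    then have *: "poly [:1, 0, -1:] (complex_of_real x) * complex_of_real (\<beta> / (1 + x) - \<alpha> / (1 - x)) =
      poly ([:of_real \<beta> - of_real \<alpha>, - (of_real \<alpha> + of_real \<beta> + 2):] - pderiv [:1, 0, -1:]) (complex_of_real x)"
      by (simp add: pderiv_pCons algebra_simps)
    show ?thesis
      unfolding of_real_mult mult.assoc[symmetric] * ..
  qed
  \<comment> \<open>\<open>v\<close> is \<open>\<rho>\<close> times the weight. Both exponents are
    raised by one and hence positive, so \<open>v\<close> vanishes at either endpoint.\<close>
  define v where "v x = (1 - x\<^sup>2) * jacobi_w \<alpha> \<beta> x" for x :: real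
  have v: "(v \<longlongrightarrow> 0) (at_right (-1))" "(v \<longlongrightarrow> 0) (at_left 1)"
  proof -
    have eq: "(1 - x) powr (\<alpha> + 1) * (1 + x) powr (\<beta> + 1) = v x" if "x > -1" "x < 1" for x
      using that by (simp add: v_def jacobi_w_def powr_add power2_eq_square algebra_simps)
    have "((\<lambda>x. (1 - x) powr (\<alpha> + 1) * (1 + x) powr (\<beta> + 1)) \<longlongrightarrow> (1 - (-1)) powr (\<alpha> + 1) * (1 + (-1)) powr (\<beta> + 1)) (at_right (-1))"
      using assms by (intro tendsto_intros tendsto_powr') (auto simp: eventually_at intro!: exI[of _ 1])
    then show "(v \<longlongrightarrow> 0) (at_right (-1))"
      by (rule Lim_transform_eventually[THEN tendsto_eq_rhs])
         (auto simp: eventually_at dist_real_def intro!: exI[of _ 1] eq)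
    have "((\<lambda>x. (1 - x) powr (\<alpha> + 1) * (1 + x) powr (\<beta> + 1)) \<longlongrightarrow> (1 - 1) powr (\<alpha> + 1) * (1 + 1) powr (\<beta> + 1)) (at_left 1)"
      using assms by (intro tendsto_intros tendsto_powr') (auto simp: eventually_at intro!: exI[of _ 1])
    then show "(v \<longlongrightarrow> 0) (at_left 1)"
      by (rule Lim_transform_eventually[THEN tendsto_eq_rhs])
         (auto simp: eventually_at dist_real_def intro!: exI[of _ 1] eq)
  qed
  have "((\<lambda>x. poly p (complex_of_real x) * of_real (v x)) \<longlongrightarrow> poly p (of_real (-1)) * of_real 0) (at_right (-1))"
       "((\<lambda>x. poly p (complex_of_real x) * of_real (v x)) \<longlongrightarrow> poly p (of_real 1) * of_real 0) (at_left 1)" for p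
    by (intro tendsto_intros v)+
  then have *: "((\<lambda>x. poly ([:1, 0, -1:] * p) (complex_of_real x) * complex_of_real (jacobi_w \<alpha> \<beta> x)) \<longlongrightarrow> 0) (at_right (-1))"
       "((\<lambda>x. poly ([:1, 0, -1:] * p) (complex_of_real x) * complex_of_real (jacobi_w \<alpha> \<beta> x)) \<longlongrightarrow> 0) (at_left 1)" for p
    by (simp_all add: v_def algebra_simps power2_eq_square)
  show "(((\<lambda>x. poly ([:1, 0, -1:] * p) (complex_of_real x) * complex_of_real (jacobi_w \<alpha> \<beta> x)) \<circ> real_of_ereal) \<longlongrightarrow> 0) (at_right (-1))"
    "(((\<lambda>x. poly ([:1, 0, -1:] * p) (complex_of_real x) * complex_of_real (jacobi_w \<alpha> \<beta> x)) \<circ> real_of_ereal) \<longlongrightarrow> 0) (at_left 1)" for p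
    using * unfolding one_ereal_def uminus_ereal.simps ereal_tendsto_simps by blast+
qed (use assms in \<open>auto simp: poly_integrable_jacobi jacobi_w_def einterval_def one_ereal_def\<close>)

subsection \<open>Polynomials of bounded degree\<close>

text \<open>Coefficients instead of \<open>degree p < n\<close>, so that \<open>deg_lt 0\<close>
  contains exactly 0 and every \<open>deg_lt n\<close> is a subspace; inductions on \<open>n\<close>
  then start from a trivial case.\<close>

definition deg_lt :: "nat \<Rightarrow> complex poly set" where
  "deg_lt n = {p. \<forall>i\<ge>n. coeff p i = 0}"

lemma deg_lt_0_iff: "p \<in> deg_lt 0 \<longleftrightarrow> p = 0"
  by (auto simp: deg_lt_def poly_eq_iff)

lemma zero_in_deg_lt [simp]: "0 \<in> deg_lt n"
  by (simp add: deg_lt_def)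

lemma deg_lt_add: "p \<in> deg_lt n \<Longrightarrow> q \<in> deg_lt n \<Longrightarrow> p + q \<in> deg_lt n"
  and deg_lt_diff: "p \<in> deg_lt n \<Longrightarrow> q \<in> deg_lt n \<Longrightarrow> p - q \<in> deg_lt n"
  and deg_lt_smult: "p \<in> deg_lt n \<Longrightarrow> smult c p \<in> deg_lt n"
  and deg_lt_cnj: "p \<in> deg_lt n \<Longrightarrow> map_poly cnj p \<in> deg_lt n"
  and deg_lt_mono: "p \<in> deg_lt n \<Longrightarrow> n \<le> n' \<Longrightarrow> p \<in> deg_lt n'"
  by (auto simp: deg_lt_def coeff_map_poly)

lemma deg_lt_sum: "(\<And>i. i \<in> I \<Longrightarrow> p i \<in> deg_lt n) \<Longrightarrow> sum p I \<in> deg_lt n"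
  by (auto simp: deg_lt_def coeff_sum)

lemma deg_lt_degree: "p \<in> deg_lt (Suc (degree p))"
  by (simp add: deg_lt_def coeff_eq_0)

lemma degree_le_iff_deg_lt: "degree p \<le> n \<longleftrightarrow> p \<in> deg_lt (Suc n)"
  by (auto simp: deg_lt_def coeff_eq_0 intro: degree_le)

lemma deg_lt_Suc_pderiv: "p \<in> deg_lt (Suc n) \<Longrightarrow> pderiv p \<in> deg_lt n"
  by (auto simp: deg_lt_def coeff_pderiv)

lemma deg_lt_mult:
  assumes "p \<in> deg_lt (Suc m)" "q \<in> deg_lt n"
  shows "p * q \<in> deg_lt (m + n)"
proof (cases "p = 0 \<or> q = 0")
  case False
  with assms(2) have "degree q < n"
    unfolding deg_lt_def by (metis (mono_tags, lifting) leading_coeff_0_iff mem_Collect_eq not_le_imp_less)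
  moreover have "degree p \<le> m" using assms(1) by (simp add: degree_le_iff_deg_lt)
  ultimately have "degree (p * q) < m + n"
    using degree_mult_le[of p q] by linarith
  then show ?thesis by (auto simp: deg_lt_def coeff_eq_0)
qed auto

lemma deg_lt_SucE:
  assumes "p \<in> deg_lt (Suc n)"
  obtains q where "p = monom (coeff p n) n + q" "q \<in> deg_lt n"
proof
  show "p = monom (coeff p n) n + (p - monom (coeff p n) n)" by simp
  show "p - monom (coeff p n) n \<in> deg_lt n"
    using assms by (auto simp: deg_lt_def)
qed

lemma deg_lt_if_lower: "p \<in> deg_lt (Suc n) \<Longrightarrow> coeff p n = 0 \<Longrightarrow> p \<in> deg_lt n"
  by (auto elim!: deg_lt_SucE)

lemma monom_in_deg_lt: "m < n \<Longrightarrow> monom c m \<in> deg_lt n"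
  by (auto simp: deg_lt_def)

lemma map_poly_cnj_simps [simp]:
  "map_poly cnj (map_poly cnj p) = p"
  "map_poly cnj (p + q) = map_poly cnj p + map_poly cnj q"
  "map_poly cnj (p - q) = map_poly cnj p - map_poly cnj q"
  "map_poly cnj (smult c p) = smult (cnj c) (map_poly cnj p)"
  "map_poly cnj (p * q) = map_poly cnj p * map_poly cnj q"
  by (auto simp: poly_eq_iff coeff_map_poly coeff_mult)

subsection \<open>Positive functionals and adjoint pairs\<close>

context pos_functional
begin

lemma L_0 [simp]: "L 0 = 0"
  using L_add[of 0 0] by simp

lemma L_diff: "L (p - q) = L p - L q"
  using L_add[of "p - q" q] by simp

lemma L_sum: "L (sum p I) = (\<Sum>i\<in>I. L (p i))"
  by (induction I rule: infinite_finite_induct) (auto simp: L_add)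

lemma nondegenerate: "(\<And>q. L (p * q) = 0) \<Longrightarrow> p = 0"
  using L_pos by blast

lemma L_1_nonzero: "L 1 \<noteq> 0"
  using L_pos[of 1] by auto

text \<open>By induction on the degree both maps vanish: if they vanish below degree \<open>n\<close> and \<open>f\<close> has
  degree \<open>n\<close>, then \<open>C f\<close> is of lower degree, so that \<open>L (C f * cnj (C f)) = L (f * C' (cnj (C f))) = 0\<close>.\<close>

lemma lowering_with_adjoint_eq_0:
  assumes lower: "\<And>n f. f \<in> deg_lt (Suc n) \<Longrightarrow> C f \<in> deg_lt n"
    and keep: "\<And>n f. f \<in> deg_lt n \<Longrightarrow> C' f \<in> deg_lt n"
    and adj: "\<And>f g. L (C f * g) = L (f * C' g)"
  shows "C f = 0"
proof -
  have "(\<forall>f\<in>deg_lt n. C f = 0) \<and> (\<forall>f\<in>deg_lt n. C' f = 0)" for n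
  proof (induction n)
    case 0
    have "C 0 = 0" "C' 0 = 0"
      using lower[of 0 0] keep[of 0 0] by (auto simp: deg_lt_0_iff)
    then show ?case by (simp add: deg_lt_0_iff)
  next
    case (Suc n)
    have C: "C f = 0" if "f \<in> deg_lt (Suc n)" for f
    proof (rule L_pos)
      have "C' (map_poly cnj (C f)) = 0"
        using Suc.IH lower[OF that] by (blast intro: deg_lt_cnj)
      then show "L (C f * map_poly cnj (C f)) = 0"
        by (simp add: adj)
    qed
    have "C' f = 0" if "f \<in> deg_lt (Suc n)" for f
    proof (rule L_pos)
      have "C (map_poly cnj (C' f)) = 0"
        using C keep[OF that] by (blast intro: deg_lt_cnj)
      then show "L (C' f * map_poly cnj (C' f)) = 0"
        using adj[of "map_poly cnj (C' f)" f] by (simp add: mult.commute)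
    qed
    with C show ?case by blast
  qed
  then show ?thesis using deg_lt_degree by blast
qed

end

subsection \<open>Scalar differential operators\<close>

text \<open>\<open>diffop K \<phi>\<close> means that \<open>\<phi>\<close> is a differential operator of order strictly below \<open>K\<close>.\<close>

definition diff_sum :: "nat \<Rightarrow> (nat \<Rightarrow> complex poly) \<Rightarrow> complex poly \<Rightarrow> complex poly" where
  "diff_sum K G f = (\<Sum>k<K. (pderiv ^^ k) f * G k)"

definition diffop :: "nat \<Rightarrow> (complex poly \<Rightarrow> complex poly) \<Rightarrow> bool" where
  "diffop K \<phi> \<longleftrightarrow> (\<exists>G. \<phi> = diff_sum K G)"

lemma diffop_diff_sum: "diffop K (diff_sum K G)"
  by (auto simp: diffop_def)

lemma diffop_zero: "diffop K (\<lambda>f. 0)"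
  unfolding diffop_def by (rule exI[of _ "\<lambda>_. 0"]) (simp add: diff_sum_def fun_eq_iff)

lemma diffop_add: "diffop K \<phi> \<Longrightarrow> diffop K \<psi> \<Longrightarrow> diffop K (\<lambda>f. \<phi> f + \<psi> f)"
proof -
  assume "diffop K \<phi>" "diffop K \<psi>"
  then obtain G G' where "\<phi> = diff_sum K G" "\<psi> = diff_sum K G'" by (auto simp: diffop_def)
  then show ?thesis
    unfolding diffop_def
    by (intro exI[of _ "\<lambda>k. G k + G' k"]) (simp add: diff_sum_def fun_eq_iff algebra_simps sum.distrib)
qed

lemma diffop_mult_right: "diffop K \<phi> \<Longrightarrow> diffop K (\<lambda>f. \<phi> f * q)"
proof -
  assume "diffop K \<phi>"
  then obtain G where "\<phi> = diff_sum K G" by (auto simp: diffop_def)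
  then show ?thesis
    unfolding diffop_def
    by (intro exI[of _ "\<lambda>k. G k * q"]) (simp add: diff_sum_def fun_eq_iff mult.assoc sum_distrib_right)
qed

lemma diffop_mult_left: "diffop K \<phi> \<Longrightarrow> diffop K (\<lambda>f. q * \<phi> f)"
  using diffop_mult_right[of K \<phi> q] by (simp add: mult.commute)

lemma diffop_smult: "diffop K \<phi> \<Longrightarrow> diffop K (\<lambda>f. smult c (\<phi> f))"
  using diffop_mult_left[of K \<phi> "[:c:]"] by simp

lemma diffop_minus: "diffop K \<phi> \<Longrightarrow> diffop K (\<lambda>f. - \<phi> f)"
  using diffop_mult_left[of K \<phi> "-1"] by simp

lemma diffop_diff: "diffop K \<phi> \<Longrightarrow> diffop K \<psi> \<Longrightarrow> diffop K (\<lambda>f. \<phi> f - \<psi> f)"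
  using diffop_add[OF _ diffop_minus] by simp

lemma diffop_sum: "(\<And>i. i \<in> I \<Longrightarrow> diffop K (\<phi> i)) \<Longrightarrow> diffop K (\<lambda>f. \<Sum>i\<in>I. \<phi> i f)"
  by (induction I rule: infinite_finite_induct) (auto intro: diffop_zero diffop_add)

lemma diffop_higher_pderiv:
  assumes "k < K" shows "diffop K (\<lambda>f. (pderiv ^^ k) f)"
  unfolding diffop_def
  by (rule exI[of _ "\<lambda>j. if j = k then 1 else 0"]) (use assms in \<open>simp add: diff_sum_def fun_eq_iff if_distrib cong: if_cong\<close>)

lemma diffop_mono: assumes "diffop K \<phi>" "K \<le> K'" shows "diffop K' \<phi>"
proof -
  obtain G where G: "\<phi> = diff_sum K G" using assms by (auto simp: diffop_def)
  have "diffop K' (\<lambda>f. \<Sum>k<K. (pderiv ^^ k) f * G k)"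
    using assms by (intro diffop_sum diffop_mult_right diffop_higher_pderiv) auto
  then show ?thesis by (simp add: G diff_sum_def[abs_def])
qed

lemma diffop_pderiv: assumes "diffop K \<phi>" shows "diffop (Suc K) (\<lambda>f. pderiv (\<phi> f))"
proof -
  obtain G where G: "\<phi> = diff_sum K G" using assms by (auto simp: diffop_def)
  have "diffop (Suc K) (\<lambda>f. \<Sum>k<K. (pderiv ^^ k) f * pderiv (G k) + (pderiv ^^ Suc k) f * G k)"
    by (intro diffop_sum diffop_add diffop_mult_right diffop_higher_pderiv) auto
  moreover have "pderiv (\<phi> f) = (\<Sum>k<K. (pderiv ^^ k) f * pderiv (G k) + (pderiv ^^ Suc k) f * G k)" for f
    by (simp add: G diff_sum_def higher_pderiv_sum[of 1, simplified] pderiv_mult algebra_simps)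
  ultimately show ?thesis by simp
qed

lemma diffop_pderiv_funpow: "diffop K \<phi> \<Longrightarrow> diffop (k + K) (\<lambda>f. (pderiv ^^ k) (\<phi> f))"
  by (induction k) (auto dest: diffop_pderiv)

lemma diffop_comp:
  assumes "diffop K \<phi>" "diffop (Suc J) \<psi>" shows "diffop (K + J) (\<lambda>f. \<phi> (\<psi> f))"
proof -
  obtain G where G: "\<phi> = diff_sum K G" using assms by (auto simp: diffop_def)
  have "diffop (K + J) (\<lambda>f. \<Sum>k<K. (pderiv ^^ k) (\<psi> f) * G k)"
    by (intro diffop_sum diffop_mult_right diffop_mono[OF diffop_pderiv_funpow[OF assms(2)]]) auto
  then show ?thesis by (simp add: G diff_sum_def)
qed

lemma diffop_mult: "diffop (Suc 0) (\<lambda>f. q * f)"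
  using diffop_mult_left[OF diffop_higher_pderiv[of 0 "Suc 0"]] by simp

lemma diff_sum_add: "diff_sum K G (f + g) = diff_sum K G f + diff_sum K G g"
  by (simp add: diff_sum_def higher_pderiv_add algebra_simps sum.distrib)

lemma diff_sum_smult: "diff_sum K G (smult c f) = smult c (diff_sum K G f)"
  using sum_distrib_left[of "[:c:]" "\<lambda>k. (pderiv ^^ k) f * G k" "{..<K}"]
  by (simp add: diff_sum_def higher_pderiv_smult)

lemma diff_sum_diff: "diff_sum K G (f - g) = diff_sum K G f - diff_sum K G g"
  using diff_sum_add[of K G "f - g" g] by simp

text \<open>Triangularity on monomials: at \<open>x^k\<close> the derivatives of order above
  \<open>k\<close> vanish, the terms below vanish by induction, and what remains is
  \<open>k!\<close> times \<open>G k\<close>.\<close>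

lemma diff_sum_eq_0_imp:
  assumes "\<And>f. diff_sum K G f = 0" "k < K"
  shows "G k = 0"
  using assms(2)
proof (induction k rule: less_induct)
  case (less k)
  let ?f = "monom 1 k :: complex poly"
  have "(pderiv ^^ j) ?f * G j = 0" if "j \<noteq> k" for j
  proof (cases "j < k")
    case True
    then show ?thesis using less by simp
  next
    case False
    then have "k < j" using that by simp
    then have "(pderiv ^^ j) ?f = 0" by (auto simp: poly_eq_iff coeff_higher_pderiv)
    then show ?thesis by simp
  qed
  then have "diff_sum K G ?f = (\<Sum>j<K. if j = k then (pderiv ^^ k) ?f * G k else 0)"
    unfolding diff_sum_def by (intro sum.cong) auto
  also have "\<dots> = (pderiv ^^ k) ?f * G k"
    using less by simp
  finally have "(pderiv ^^ k) ?f * G k = 0" using assms by simp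
  moreover have "(pderiv ^^ k) ?f \<noteq> 0"
  proof -
    have "coeff ((pderiv ^^ k) ?f) 0 \<noteq> 0"
      by (simp add: coeff_higher_pderiv pochhammer_fact[symmetric])
    then show ?thesis by auto
  qed
  ultimately show ?case by simp
qed

text \<open>\<open>t\<close> is the coefficient of the \<open>K\<close>-th derivative modulo lower
  order. It may be 0, so the order need not be exactly \<open>K\<close>.\<close>

definition has_top :: "nat \<Rightarrow> (complex poly \<Rightarrow> complex poly) \<Rightarrow> complex poly \<Rightarrow> bool" where
  "has_top K \<phi> t \<longleftrightarrow> (\<exists>R. diffop K R \<and> (\<forall>f. \<phi> f = (pderiv ^^ K) f * t + R f))"

lemma has_topI: "diffop K R \<Longrightarrow> (\<And>f. \<phi> f = (pderiv ^^ K) f * t + R f) \<Longrightarrow> has_top K \<phi> t"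
  by (auto simp: has_top_def)

lemma has_top_diff_sum: "has_top K (diff_sum (Suc K) G) (G K)"
  by (rule has_topI[OF diffop_diff_sum[of K G]]) (simp add: diff_sum_def)

text \<open>The leading coefficient depends on the map alone, so it may be read off from two
  different expressions for the same operator and compared.\<close>

lemma has_top_unique:
  assumes "has_top K \<phi> t" "has_top K \<phi> t'" shows "t = t'"
proof -
  from assms obtain G G' where G: "\<And>f. \<phi> f = (pderiv ^^ K) f * t + diff_sum K G f"
    "\<And>f. \<phi> f = (pderiv ^^ K) f * t' + diff_sum K G' f"
    unfolding has_top_def diffop_def by blast
  have "diff_sum (Suc K) (\<lambda>k. if k = K then t - t' else G k - G' k) f = 0" for f
    using G(1)[of f] G(2)[of f] by (simp add: diff_sum_def algebra_simps sum_subtractf)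
  from diff_sum_eq_0_imp[OF this, of K] show ?thesis by simp
qed

lemma has_top_imp_diffop: "has_top K \<phi> t \<Longrightarrow> K < K' \<Longrightarrow> diffop K' \<phi>"
proof -
  assume "has_top K \<phi> t" "K < K'"
  then obtain R where R: "diffop K R" "\<phi> = (\<lambda>f. (pderiv ^^ K) f * t + R f)"
    by (auto simp: has_top_def)
  show ?thesis
    unfolding R using R(1) \<open>K < K'\<close>
    by (intro diffop_add diffop_mult_right diffop_higher_pderiv) (auto intro: diffop_mono)
qed

lemma diffop_imp_has_top_0: "diffop K \<phi> \<Longrightarrow> has_top K \<phi> 0"
  by (rule has_topI[of K \<phi>]) auto

lemma has_top_add: "has_top K \<phi> t \<Longrightarrow> has_top K \<psi> t' \<Longrightarrow> has_top K (\<lambda>f. \<phi> f + \<psi> f) (t + t')"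
proof -
  assume "has_top K \<phi> t" "has_top K \<psi> t'"
  then obtain R R' where "diffop K R" "\<And>f. \<phi> f = (pderiv ^^ K) f * t + R f"
      "diffop K R'" "\<And>f. \<psi> f = (pderiv ^^ K) f * t' + R' f"
    unfolding has_top_def by blast
  then show ?thesis
    by (intro has_topI[of K "\<lambda>f. R f + R' f"] diffop_add) (auto simp: algebra_simps)
qed

lemma has_top_smult: "has_top K \<phi> t \<Longrightarrow> has_top K (\<lambda>f. smult c (\<phi> f)) (smult c t)"
proof -
  assume "has_top K \<phi> t"
  then obtain R where "diffop K R" "\<And>f. \<phi> f = (pderiv ^^ K) f * t + R f"
    by (auto simp: has_top_def)
  then show ?thesis
    by (intro has_topI[of K "\<lambda>f. smult c (R f)"] diffop_smult) (auto simp: smult_add_right)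
qed

lemma higher_pderiv_mult_top: "\<exists>R. diffop k R \<and>
    (\<forall>f. (pderiv ^^ k) (p * f) = p * (pderiv ^^ k) f + R f)"
proof (induction k)
  case 0
  show ?case by (auto intro!: exI[of _ "\<lambda>_. 0"] diffop_zero)
next
  case (Suc k)
  then obtain R where R: "diffop k R" "\<And>f. (pderiv ^^ k) (p * f) = p * (pderiv ^^ k) f + R f" by blast
  have "diffop (Suc k) (\<lambda>f. pderiv p * (pderiv ^^ k) f + pderiv (R f))"
    using R(1) by (intro diffop_add diffop_mult_left diffop_higher_pderiv diffop_pderiv) auto
  moreover have "(pderiv ^^ Suc k) (p * f) =
      p * (pderiv ^^ Suc k) f + (pderiv p * (pderiv ^^ k) f + pderiv (R f))" for f
    by (simp add: R(2) pderiv_add pderiv_mult)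
  ultimately show ?case by blast
qed

text \<open>Leibniz rule with its two leading terms; the order of \<open>R\<close> is strictly below
  \<open>k\<close>. Commutators with a second-order operator need the second term because the first
  one cancels.\<close>

lemma higher_pderiv_mult_top2: "\<exists>R. diffop k R \<and>
    (\<forall>f. (pderiv ^^ Suc k) (p * f) = p * (pderiv ^^ Suc k) f + of_nat (Suc k) * (pderiv p * (pderiv ^^ k) f) + R f)"
proof (induction k)
  case 0
  show ?case by (auto intro!: exI[of _ "\<lambda>_. 0"] diffop_zero simp: pderiv_mult)
next
  case (Suc k)
  then obtain R where R: "diffop k R" "\<And>f. (pderiv ^^ Suc k) (p * f) =
      p * (pderiv ^^ Suc k) f + of_nat (Suc k) * (pderiv p * (pderiv ^^ k) f) + R f" by blast
  have "diffop (Suc k) (\<lambda>f. of_nat (Suc k) * (pderiv (pderiv p) * (pderiv ^^ k) f) + pderiv (R f))"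
    using R(1) by (intro diffop_add diffop_mult_left diffop_higher_pderiv diffop_pderiv) auto
  moreover have "(pderiv ^^ Suc (Suc k)) (p * f) = p * (pderiv ^^ Suc (Suc k)) f
      + of_nat (Suc (Suc k)) * (pderiv p * (pderiv ^^ Suc k) f)
      + (of_nat (Suc k) * (pderiv (pderiv p) * (pderiv ^^ k) f) + pderiv (R f))" for f
  proof -
    have "(pderiv ^^ Suc (Suc k)) (p * f) = pderiv ((pderiv ^^ Suc k) (p * f))" by simp
    also have "\<dots> = pderiv (p * (pderiv ^^ Suc k) f + of_nat (Suc k) * (pderiv p * (pderiv ^^ k) f) + R f)"
      by (simp only: R(2))
    also have "\<dots> = pderiv p * (pderiv ^^ Suc k) f + p * (pderiv ^^ Suc (Suc k)) f
        + of_nat (Suc k) * (pderiv (pderiv p) * (pderiv ^^ k) f + pderiv p * (pderiv ^^ Suc k) f) + pderiv (R f)"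
      by (simp only: pderiv_add pderiv_mult funpow.simps o_apply pderiv_of_nat)
         (simp add: algebra_simps)
    finally show ?thesis by (simp add: algebra_simps)
  qed
  ultimately show ?case by blast
qed

section \<open>Action on leading terms: eigenvalues as polynomials in the degree\<close>

definition falling_poly :: "nat \<Rightarrow> complex poly" where
  "falling_poly k = (\<Prod>i<k. [:- of_nat i, 1:])"

lemma degree_falling_poly: "degree (falling_poly k) = k"
  and lead_coeff_falling_poly: "coeff (falling_poly k) k = 1"
proof -
  show *: "degree (falling_poly k) = k"
    unfolding falling_poly_def by (subst degree_prod_eq_sum_degree) auto
  have "lead_coeff (falling_poly k) = 1"
    unfolding falling_poly_def by (subst lead_coeff_prod) auto
  then show "coeff (falling_poly k) k = 1" by (simp add: *)
qed

lemma falling_poly_Suc: "falling_poly (Suc k) = falling_poly k * [:- of_nat k, 1:]"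
  by (simp add: falling_poly_def)

text \<open>\<open>falling_poly k\<close> is the falling factorial, which is 0 at every natural
  number below \<open>k\<close>; this makes the truncated exponent \<open>n - k\<close>
  harmless.\<close>

lemma higher_pderiv_monom_falling:
  "(pderiv ^^ k) (monom 1 n) = monom (poly (falling_poly k) (of_nat n)) (n - k)"
proof (induction k)
  case 0
  show ?case by (simp add: falling_poly_def)
next
  case (Suc k)
  show ?case
  proof (cases "k < n")
    case True
    then show ?thesis
      by (simp add: Suc pderiv_monom falling_poly_Suc of_nat_diff algebra_simps Suc_diff_Suc[symmetric])
  next
    case False
    then have "poly (falling_poly (Suc k)) (of_nat n) = 0"
      by (auto simp: falling_poly_def poly_prod prod_zero_iff)
    moreover have "n - k = 0" using False by simp
    ultimately show ?thesis by (simp add: Suc pderiv_monom)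
  qed
qed

text \<open>Only the coefficient of degree \<open>k\<close> in \<open>G k\<close> can contribute
  \<open>x^n\<close> to the image of \<open>x^n\<close>. For an operator that does not raise
  degrees, the value at \<open>n\<close> is the factor by which the leading coefficient in degree
  \<open>n\<close> is multiplied.\<close>

definition eigen_poly :: "nat \<Rightarrow> (nat \<Rightarrow> complex poly) \<Rightarrow> complex poly" where
  "eigen_poly K G = (\<Sum>k\<le>K. smult (coeff (G k) k) (falling_poly k))"

lemma coeff_diff_sum_monom: "coeff (diff_sum (Suc K) G (monom 1 n)) n = poly (eigen_poly K G) (of_nat n)"
proof -
  have "coeff ((pderiv ^^ k) (monom 1 n) * G k) n = coeff (G k) k * poly (falling_poly k) (of_nat n)" for k
  proof (cases "k \<le> n")
    case True
    then show ?thesis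
      by (simp add: higher_pderiv_monom_falling coeff_monom_mult)
  next
    case False
    then have "poly (falling_poly k) (of_nat n) = 0"
      by (auto simp: falling_poly_def poly_prod prod_zero_iff)
    then show ?thesis by (simp add: higher_pderiv_monom_falling)
  qed
  then show ?thesis
    by (simp add: diff_sum_def eigen_poly_def coeff_sum poly_sum lessThan_Suc_atMost)
qed

lemma coeff_diff_sum:
  assumes keep: "\<And>n f. f \<in> deg_lt n \<Longrightarrow> diff_sum (Suc K) G f \<in> deg_lt n" and f: "f \<in> deg_lt (Suc n)"
  shows "coeff (diff_sum (Suc K) G f) n = poly (eigen_poly K G) (of_nat n) * coeff f n"
proof -
  obtain g where g: "f = monom (coeff f n) n + g" "g \<in> deg_lt n"
    by (rule deg_lt_SucE[OF f])
  have "coeff (diff_sum (Suc K) G g) n = 0"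
    using keep[OF g(2)] by (simp add: deg_lt_def)
  moreover have "monom (coeff f n) n = smult (coeff f n) (monom 1 n)"
    by (simp add: smult_monom)
  ultimately show ?thesis
    by (subst g(1)) (simp add: diff_sum_add diff_sum_smult coeff_diff_sum_monom)
qed

lemma degree_eigen_poly: "degree (eigen_poly K G) \<le> K"
  unfolding eigen_poly_def
  by (intro degree_sum_le) (auto intro: order_trans[OF degree_smult_le] simp: degree_falling_poly)

lemma coeff_eigen_poly: "coeff (eigen_poly K G) K = coeff (G K) K"
proof -
  have "coeff (eigen_poly K G) K = (\<Sum>k\<le>K. if k = K then coeff (G K) K else 0)"
    unfolding eigen_poly_def coeff_sum
    by (intro sum.cong) (auto simp: lead_coeff_falling_poly coeff_eq_0 degree_falling_poly)
  then show ?thesis by simp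
qed

subsection \<open>Scalar operators with an adjoint\<close>

text \<open>The eigenvalue of an operator of order \<open>2 * m\<close> is a polynomial of degree \<open>d\<close> in \<open>n\<close>
  (\<open>d = m\<close> for Hermite and Laguerre, \<open>d = 2 * m\<close> for Jacobi), and \<open>k\<close> is the ratio of the two
  leading coefficients.\<close>

definition leading_from_eigenvalues ::
    "(complex poly \<Rightarrow> complex) \<Rightarrow> nat \<Rightarrow> nat \<Rightarrow> complex \<Rightarrow> complex poly \<Rightarrow> bool" where
  "leading_from_eigenvalues L m d k \<rho> \<longleftrightarrow> (\<forall>G C'.
     (\<forall>n. \<forall>f\<in>deg_lt n. diff_sum (Suc (2 * m)) G f \<in> deg_lt n) \<and>
     (\<forall>n. \<forall>f\<in>deg_lt n. C' f \<in> deg_lt n) \<and>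
     (\<forall>f g. L (diff_sum (Suc (2 * m)) G f * g) = L (f * C' g)) \<longrightarrow>
     degree (eigen_poly (2 * m) G) \<le> d \<and>
     G (2 * m) = smult (coeff (eigen_poly (2 * m) G) d * k) (\<rho> ^ m))"

definition polyop :: "(complex poly \<Rightarrow> complex poly) \<Rightarrow> complex poly \<Rightarrow> complex poly \<Rightarrow> complex poly" where
  "polyop D q f = (\<Sum>i\<le>degree q. smult (coeff q i) ((D ^^ i) f))"

text \<open>At the zeros 1 and -1 of \<open>[:1, 0, -1:]\<close> the left side vanishes while the
  derivative of this quadratic does not. So for \<open>Suc m\<close> both linear factors divide
  \<open>G\<close>, and the quotient \<open>H\<close> solves the equation for \<open>m\<close>; the
  case 0 leaves the constants.\<close>

lemma jacobi_ode:
  fixes G :: "complex poly"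
  assumes "[:1, 0, -1:] * pderiv G = of_nat m * pderiv [:1, 0, -1:] * G"
  shows "\<exists>c. G = smult c ([:1, 0, -1:] ^ m)"
  using assms
proof (induction m arbitrary: G)
  case 0
  then have "pderiv G = 0"
    by (simp only: of_nat_0 mult_zero_left mult_eq_0_iff) simp
  then have "degree G = 0" by (simp add: pderiv_eq_0_iff)
  then obtain c where "G = [:c:]" by (rule degree_eq_zeroE)
  then show ?case by (intro exI[of _ c]) simp
next
  case (Suc m)
  have ne: "(1 :: complex) + of_nat m \<noteq> 0"
    using of_nat_eq_0_iff[of "Suc m", where 'a=complex] by (simp only: of_nat_Suc)
  have "poly G 1 = 0"
    using arg_cong[OF Suc.prems, of "\<lambda>p. poly p 1"] ne by (simp add: pderiv_pCons)
  then have "[:-1, 1:] dvd G" using poly_eq_0_iff_dvd[of G 1] by simp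
  then obtain G1 where G1: "G = [:-1, 1:] * G1" by (elim dvdE)
  have "poly G (-1) = 0"
    using arg_cong[OF Suc.prems, of "\<lambda>p. poly p (-1)"] ne by (simp add: pderiv_pCons)
  then have "poly G1 (-1) = 0" by (simp add: G1)
  then have "[:1, 1:] dvd G1" using poly_eq_0_iff_dvd[of G1 "-1"] by simp
  then obtain G2 where G2: "G1 = [:1, 1:] * G2" by (elim dvdE)
  \<comment> \<open>The sign: \<open>[:-1, 1:] * [:1, 1:]\<close> is the negative of
    \<open>[:1, 0, -1:]\<close>.\<close>
  define H where "H = - G2"
  have G: "G = [:1, 0, -1:] * H"
    by (simp add: G1 G2 H_def)
  let ?r = "[:1, 0, -1:] :: complex poly"
  have "?r * (?r * pderiv H + pderiv ?r * H) = ?r * (of_nat (Suc m) * pderiv ?r * H)"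
    using Suc.prems unfolding G pderiv_mult by (simp only: mult_ac)
  then have "?r * pderiv H + pderiv ?r * H = of_nat (Suc m) * pderiv ?r * H"
    by (subst (asm) mult_cancel_left) simp
  then have "?r * pderiv H = of_nat m * pderiv ?r * H"
    by (simp add: algebra_simps)
  then obtain c where "H = smult c (?r ^ m)" using Suc.IH by blast
  then have "G = smult c (?r ^ Suc m)"
    by (simp only: G power_Suc mult_smult_right)
  then show ?case by blast
qed

context pearson_functional
begin

text \<open>The second-order operator of the classical orthogonal polynomials; for a weight with the
  Pearson equation it is \<open>(\<rho> w f')' / w\<close>.\<close>

definition delta :: "complex poly \<Rightarrow> complex poly" where
  "delta f = \<rho> * pderiv (pderiv f) + \<tau> * pderiv f"

definition delta_coeffs :: "nat \<Rightarrow> complex poly" where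
  "delta_coeffs k = (if k = 1 then \<tau> else if k = 2 then \<rho> else 0)"

lemma delta_eq_diff_sum: "delta = diff_sum (Suc 2) delta_coeffs"
  by (simp add: delta_def diff_sum_def delta_coeffs_def fun_eq_iff numeral_2_eq_2 mult.commute)

lemmas delta_linear = diff_sum_add[of "Suc 2" delta_coeffs, folded delta_eq_diff_sum]
  diff_sum_diff[of "Suc 2" delta_coeffs, folded delta_eq_diff_sum]
  diff_sum_smult[of "Suc 2" delta_coeffs, folded delta_eq_diff_sum]

text \<open>Integration by parts: Pearson at \<open>pderiv f * g\<close> rewrites the left side as
  \<open>- L (\<rho> * pderiv f * pderiv g)\<close>, which is symmetric in \<open>f\<close> and
  \<open>g\<close>.\<close>

lemma delta_symmetric: "L (delta f * g) = L (f * delta g)"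
proof -
  have *: "L (delta f * g) = - L (\<rho> * pderiv f * pderiv g)" for f g
  proof -
    have "\<rho> * pderiv (pderiv f * g) + \<tau> * (pderiv f * g) = delta f * g + \<rho> * pderiv f * pderiv g"
      by (simp add: delta_def pderiv_mult algebra_simps)
    then show ?thesis
      using pearson[of "pderiv f * g"] L_add[of "delta f * g" "\<rho> * pderiv f * pderiv g"]
      by (simp add: eq_neg_iff_add_eq_0)
  qed
  show ?thesis
    using *[of f g] *[of g f] by (simp add: mult.commute mult.left_commute)
qed

lemma delta_deg_lt:
  assumes "\<rho> \<in> deg_lt (Suc 2)" "\<tau> \<in> deg_lt (Suc 1)" "f \<in> deg_lt n"
  shows "delta f \<in> deg_lt n"
proof (cases n)
  case 0
  then show ?thesis using assms by (simp add: deg_lt_0_iff delta_def)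
next
  case (Suc k)
  then have f': "pderiv f \<in> deg_lt k" using assms deg_lt_Suc_pderiv by blast
  then have 1: "\<tau> * pderiv f \<in> deg_lt n"
    using deg_lt_mult[OF assms(2) f'] Suc by simp
  have "\<rho> * pderiv (pderiv f) \<in> deg_lt n"
  proof (cases k)
    case 0
    then show ?thesis using f' by (simp add: deg_lt_0_iff)
  next
    case (Suc j)
    then show ?thesis
      using deg_lt_mult[OF assms(1) deg_lt_Suc_pderiv[of "pderiv f" j]] f' \<open>n = Suc k\<close> by simp
  qed
  with 1 show ?thesis by (simp add: delta_def deg_lt_add)
qed

text \<open>The terms of order \<open>k + 2\<close> cancel, and so do those from
  \<open>\<tau>\<close> at order \<open>k + 1\<close>. What is left at that order is the cross term
  of the second derivative of a product, minus the second Leibniz term of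
  \<open>\<rho>\<close>.\<close>

lemma commutator_monomial_has_top:
  "has_top (Suc k) (\<lambda>f. delta ((pderiv ^^ k) f * g) - (pderiv ^^ k) (delta f) * g)
     (2 * \<rho> * pderiv g - of_nat k * pderiv \<rho> * g)"
proof -
  obtain R1 where R1: "diffop k R1"
    "\<And>f. (pderiv ^^ k) (\<tau> * f) = \<tau> * (pderiv ^^ k) f + R1 f"
    using higher_pderiv_mult_top by blast
  \<comment> \<open>For \<open>k = 0\<close> the truncated \<open>k - 1\<close> is harmless: the
    factor \<open>of_nat k\<close> is 0, and \<open>diffop 0\<close> forces \<open>R2\<close> to be
    zero.\<close>
  obtain R2 where R2: "diffop (k - 1) R2" "\<And>f. (pderiv ^^ k) (\<rho> * f) =
      \<rho> * (pderiv ^^ k) f + of_nat k * (pderiv \<rho> * (pderiv ^^ (k - 1)) f) + R2 f"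
  proof (cases k)
    case 0
    then show ?thesis using that[of "\<lambda>_. 0"] by (simp add: diffop_zero)
  next
    case (Suc j)
    then show ?thesis using that higher_pderiv_mult_top2[of j \<rho>] by (metis diff_Suc_1)
  qed
  have D: "(pderiv ^^ j) (pderiv f) = (pderiv ^^ Suc j) f" for j f
    by (simp add: funpow_swap1)
  have R1': "diffop (Suc k) (\<lambda>f. R1 (pderiv f))"
    using diffop_comp[OF R1(1) diffop_higher_pderiv[of 1 "Suc 1"]] by simp
  have R2': "diffop (Suc k) (\<lambda>f. R2 (pderiv (pderiv f)))"
  proof (cases k)
    case 0
    then have "R2 = (\<lambda>_. 0)" using R2(1) by (auto simp: diffop_def diff_sum_def)
    then show ?thesis by (simp add: diffop_zero)
  next
    case (Suc j)
    then show ?thesis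
      using diffop_comp[OF R2(1) diffop_higher_pderiv[of 2 "Suc 2"]] by (simp add: numeral_2_eq_2)
  qed
  have k: "of_nat k * (pderiv \<rho> * (pderiv ^^ (k - 1)) (pderiv (pderiv f))) =
      of_nat k * (pderiv \<rho> * (pderiv ^^ Suc k) f)" for f
    by (cases k) (simp_all add: funpow_swap1)
  have "(pderiv ^^ k) (delta f) = \<rho> * (pderiv ^^ Suc (Suc k)) f
      + of_nat k * (pderiv \<rho> * (pderiv ^^ Suc k) f) + R2 (pderiv (pderiv f))
      + \<tau> * (pderiv ^^ Suc k) f + R1 (pderiv f)" for f
    unfolding delta_def higher_pderiv_add R1 R2 k by (simp add: D)
  moreover have "delta ((pderiv ^^ k) f * g) = \<rho> * (pderiv ^^ Suc (Suc k)) f * g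
      + 2 * \<rho> * (pderiv ^^ Suc k) f * pderiv g + \<rho> * (pderiv ^^ k) f * pderiv (pderiv g)
      + \<tau> * (pderiv ^^ Suc k) f * g + \<tau> * (pderiv ^^ k) f * pderiv g" for f
    by (simp add: delta_def pderiv_mult pderiv_add algebra_simps)
  ultimately have "delta ((pderiv ^^ k) f * g) - (pderiv ^^ k) (delta f) * g =
      (pderiv ^^ Suc k) f * (2 * \<rho> * pderiv g - of_nat k * pderiv \<rho> * g) +
      ((pderiv ^^ k) f * (\<rho> * pderiv (pderiv g) + \<tau> * pderiv g)
        - R2 (pderiv (pderiv f)) * g - R1 (pderiv f) * g)" for f
    by (simp add: algebra_simps)
  moreover have "diffop (Suc k) (\<lambda>f. (pderiv ^^ k) f * (\<rho> * pderiv (pderiv g) + \<tau> * pderiv g)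
        - R2 (pderiv (pderiv f)) * g - R1 (pderiv f) * g)"
    by (intro diffop_diff diffop_mult_right R1' R2' diffop_higher_pderiv) simp
  ultimately show ?thesis
    by (intro has_topI)
qed

text \<open>Summands below \<open>K\<close> have commutators of order at most \<open>K\<close>, so
  the coefficient at order \<open>K + 1\<close> sees \<open>G K\<close> only.\<close>

lemma commutator_has_top:
  "has_top (Suc K) (\<lambda>f. delta (diff_sum (Suc K) G f) - diff_sum (Suc K) G (delta f))
     (2 * \<rho> * pderiv (G K) - of_nat K * pderiv \<rho> * G K)"
proof -
  define c where "c k f = delta ((pderiv ^^ k) f * G k) - (pderiv ^^ k) (delta f) * G k" for k f
  have delta_0: "delta 0 = 0" by (simp add: delta_def)
  have "delta (\<Sum>k\<in>I. p k) = (\<Sum>k\<in>I. delta (p k))" if "finite I" for p and I :: "nat set"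
    using that by (induction I rule: finite_induct) (simp_all add: delta_linear delta_0)
  then have eq: "delta (diff_sum (Suc K) G f) - diff_sum (Suc K) G (delta f) = c K f + (\<Sum>k<K. c k f)" for f
    by (simp add: diff_sum_def c_def delta_linear sum_subtractf)
  have "diffop (Suc K) (\<lambda>f. \<Sum>k<K. c k f)"
    unfolding c_def
    by (intro diffop_sum has_top_imp_diffop[OF commutator_monomial_has_top]) auto
  moreover have "has_top (Suc K) (c K) (2 * \<rho> * pderiv (G K) - of_nat K * pderiv \<rho> * G K)"
    unfolding c_def by (rule commutator_monomial_has_top)
  ultimately have "has_top (Suc K) (\<lambda>f. c K f + (\<Sum>k<K. c k f)) (2 * \<rho> * pderiv (G K) - of_nat K * pderiv \<rho> * G K)"
    using has_top_add[OF _ diffop_imp_has_top_0] by fastforce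
  with eq show ?thesis by simp
qed

text \<open>\<open>delta\<close> and the given operator both multiply the leading coefficient in
  degree \<open>n\<close> by a number, so their commutator lowers degrees. It has an adjoint because
  \<open>delta\<close> is symmetric, hence it vanishes, and its coefficient at order
  \<open>2 * m + 1\<close> is the equation solved in \<open>jacobi_ode\<close>.\<close>

lemma leading_from_eigenvalues_jacobi:
  assumes \<rho>: "\<rho> = [:1, 0, -1:]" and \<tau>: "\<tau> \<in> deg_lt (Suc 1)"
  shows "leading_from_eigenvalues L m (2 * m) ((-1) ^ m) \<rho>"
  unfolding leading_from_eigenvalues_def
proof (intro allI impI, elim conjE)
  fix G C'
  let ?e = "diff_sum (Suc (2 * m)) G"
  assume keep: "\<forall>n. \<forall>f\<in>deg_lt n. ?e f \<in> deg_lt n"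
    and keep': "\<forall>n. \<forall>f\<in>deg_lt n. C' f \<in> deg_lt n"
    and adj: "\<forall>f g. L (?e f * g) = L (f * C' g)"
  have \<rho>3: "\<rho> \<in> deg_lt (Suc 2)"
    by (auto simp: \<rho> degree_le_iff_deg_lt[symmetric] numeral_2_eq_2)
  note dd = delta_deg_lt[OF \<rho>3 \<tau>]
  have cd: "coeff (delta f) n = poly (eigen_poly 2 delta_coeffs) (of_nat n) * coeff f n" if "f \<in> deg_lt (Suc n)" for n f
    using coeff_diff_sum[of 2 delta_coeffs f n] that dd unfolding delta_eq_diff_sum by blast
  have ce: "coeff (?e f) n = poly (eigen_poly (2 * m) G) (of_nat n) * coeff f n" if "f \<in> deg_lt (Suc n)" for n f
    using coeff_diff_sum[of "2 * m" G f n] that keep by blast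
  have "delta (?e f) - ?e (delta f) = 0" for f
  proof (rule lowering_with_adjoint_eq_0[where C="\<lambda>f. delta (?e f) - ?e (delta f)"
        and C'="\<lambda>g. C' (delta g) - delta (C' g)"])
    fix n f assume f: "f \<in> deg_lt (Suc n)"
    then have "delta f \<in> deg_lt (Suc n)" "?e f \<in> deg_lt (Suc n)" using dd keep by auto
    then show "delta (?e f) - ?e (delta f) \<in> deg_lt n"
      using f dd keep by (rule_tac deg_lt_if_lower) (auto simp: cd ce intro!: deg_lt_diff)
  next
    fix n f assume "f \<in> deg_lt n"
    then show "C' (delta f) - delta (C' f) \<in> deg_lt n"
      using dd keep' by (intro deg_lt_diff) auto
  next
    fix f g
    show "L ((delta (?e f) - ?e (delta f)) * g) = L (f * (C' (delta g) - delta (C' g)))"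
      by (simp only: left_diff_distrib right_diff_distrib L_diff delta_symmetric adj[rule_format])
  qed
  then have "has_top (Suc (2 * m)) (\<lambda>f. 0) (2 * \<rho> * pderiv (G (2 * m)) - of_nat (2 * m) * pderiv \<rho> * G (2 * m))"
    using commutator_has_top[of "2 * m" G] by simp
  from has_top_unique[OF this diffop_imp_has_top_0[OF diffop_zero]]
  have "2 * (\<rho> * pderiv (G (2 * m))) = 2 * (of_nat m * pderiv \<rho> * G (2 * m))"
    by (simp add: algebra_simps)
  then have "\<rho> * pderiv (G (2 * m)) = of_nat m * pderiv \<rho> * G (2 * m)"
    by (subst (asm) mult_cancel_left) simp
  then obtain c where c: "G (2 * m) = smult c (\<rho> ^ m)"
    using jacobi_ode[of "G (2 * m)" m] unfolding \<rho> by blast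
  \<comment> \<open>Origin of the constant \<open>(-1) ^ m\<close>: being its own inverse, this
    leading coefficient of \<open>\<rho> ^ m\<close> recovers \<open>c\<close> from the top
    coefficient of the eigenvalue polynomial.\<close>
  have "coeff (\<rho> ^ m) (2 * m) = (-1) ^ m"
  proof -
    have "degree (\<rho> ^ m) = 2 * m" by (subst degree_power_eq) (auto simp: \<rho>)
    then show ?thesis
      using lead_coeff_power[of \<rho> m] by (simp add: \<rho>)
  qed
  then have "coeff (eigen_poly (2 * m) G) (2 * m) = c * (-1) ^ m"
    by (simp add: coeff_eigen_poly c)
  then show "degree (eigen_poly (2 * m) G) \<le> 2 * m \<and>
      G (2 * m) = smult (coeff (eigen_poly (2 * m) G) (2 * m) * (-1) ^ m) (\<rho> ^ m)"
    by (simp add: degree_eigen_poly c mult.assoc flip: power_mult_distrib)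
qed

lemma delta_has_top:
  assumes "has_top K \<phi> t"
  shows "has_top (Suc (Suc K)) (\<lambda>f. delta (\<phi> f)) (\<rho> * t)"
proof -
  obtain R where R: "diffop K R" "\<And>f. \<phi> f = (pderiv ^^ K) f * t + R f"
    using assms by (auto simp: has_top_def)
  have "diffop (Suc (Suc K)) (\<lambda>f. (pderiv ^^ Suc K) f * (2 * \<rho> * pderiv t + \<tau> * t)
      + (pderiv ^^ K) f * (\<rho> * pderiv (pderiv t) + \<tau> * pderiv t)
      + (\<rho> * pderiv (pderiv (R f)) + \<tau> * pderiv (R f)))"
    by (intro diffop_add diffop_mult_right diffop_mult_left diffop_higher_pderiv diffop_pderiv
        diffop_mono[OF diffop_pderiv[OF R(1)]] R(1)) auto
  then show ?thesis
    by (rule has_topI) (simp add: delta_def R(2) pderiv_mult pderiv_add algebra_simps)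
qed

text \<open>The second-order term lowers degrees when \<open>\<rho>\<close> has degree at most 1, so
  \<open>\<kappa>\<close> times \<open>delta\<close> multiplies the leading coefficient in degree
  \<open>n\<close> by exactly \<open>n\<close>. Substituting this operator into the eigenvalue
  polynomial \<open>q\<close> gives one that differs from the given operator by a degree-lowering
  map with an adjoint, hence by 0.\<close>

lemma leading_from_eigenvalues_linear:
  assumes \<rho>: "\<rho> \<in> deg_lt (Suc 1)" "\<rho> \<noteq> 0" and \<tau>: "\<tau> \<in> deg_lt (Suc 1)"
    and \<kappa>: "\<kappa> * coeff \<tau> 1 = 1"
  shows "leading_from_eigenvalues L m m (\<kappa> ^ m) \<rho>"
  unfolding leading_from_eigenvalues_def
proof (intro allI impI, elim conjE)
  fix G C'
  let ?e = "diff_sum (Suc (2 * m)) G"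
  assume keep: "\<forall>n. \<forall>f\<in>deg_lt n. ?e f \<in> deg_lt n"
    and keep': "\<forall>n. \<forall>f\<in>deg_lt n. C' f \<in> deg_lt n"
    and adj: "\<forall>f g. L (?e f * g) = L (f * C' g)"
  define q where "q = eigen_poly (2 * m) G"
  define D where "D f = smult \<kappa> (delta f)" for f
  have \<rho>3: "\<rho> \<in> deg_lt (Suc 2)"
    by (rule deg_lt_mono[OF \<rho>(1)]) simp
  have D_deg: "(D ^^ i) f \<in> deg_lt n" if "f \<in> deg_lt n" for f n i
    using that by (induction i) (auto simp: D_def intro: deg_lt_smult delta_deg_lt[OF \<rho>3 \<tau>])
  have ev: "poly (eigen_poly 2 delta_coeffs) (of_nat n) = coeff \<tau> 1 * of_nat n" for n
    using \<rho>(1) by (simp add: eigen_poly_def delta_coeffs_def numeral_2_eq_2 deg_lt_def falling_poly_Suc falling_poly_def)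
  have D_coeff1: "coeff (D f) n = of_nat n * coeff f n" if "f \<in> deg_lt (Suc n)" for f n
  proof -
    have "coeff (delta f) n = coeff \<tau> 1 * of_nat n * coeff f n"
      using coeff_diff_sum[of 2 delta_coeffs f n] that delta_deg_lt[OF \<rho>3 \<tau>]
      unfolding ev delta_eq_diff_sum by blast
    then have "coeff (D f) n = (\<kappa> * coeff \<tau> 1) * of_nat n * coeff f n"
      by (simp add: D_def)
    then show ?thesis by (simp only: \<kappa>) simp
  qed
  have D_coeff: "coeff ((D ^^ i) f) n = of_nat n ^ i * coeff f n" if "f \<in> deg_lt (Suc n)" for f n i
    using that by (induction i) (auto simp: D_coeff1 D_deg)
  have D_sym: "L ((D ^^ i) f * g) = L (f * (D ^^ i) g)" for i f g
  proof (induction i arbitrary: f g)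
    case (Suc i)
    have "L ((D ^^ Suc i) f * g) = \<kappa> * L (delta ((D ^^ i) f) * g)"
      by (simp add: D_def[of "(D ^^ i) f"] L_smult)
    also have "\<dots> = L ((D ^^ i) f * D g)"
      by (simp add: delta_symmetric D_def[of g] L_smult)
    also have "\<dots> = L (f * (D ^^ Suc i) g)"
      by (simp add: Suc.IH funpow_swap1)
    finally show ?case .
  qed simp
  have D_top: "has_top (2 * i) (D ^^ i) (smult \<kappa> \<rho> ^ i)" for i
  proof (induction i)
    case 0
    show ?case by (rule has_topI[OF diffop_zero]) simp
  next
    case (Suc i)
    from has_top_smult[OF delta_has_top[OF this], of \<kappa>]
    show ?case by (simp add: o_def D_def[abs_def])
  qed
  have P_coeff: "coeff (polyop D q f) n = poly q (of_nat n) * coeff f n" if "f \<in> deg_lt (Suc n)" for f n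
    by (simp add: polyop_def coeff_sum D_coeff[OF that] poly_altdef sum_distrib_right mult.assoc)
  have P_deg: "polyop D q f \<in> deg_lt n" if "f \<in> deg_lt n" for f n
    unfolding polyop_def by (intro deg_lt_sum deg_lt_smult D_deg that)
  have P_sym: "L (polyop D q f * g) = L (f * polyop D q g)" for f g
    by (simp add: polyop_def sum_distrib_left sum_distrib_right L_sum L_smult D_sym)
  have P_top: "has_top (2 * d) (polyop D q) (smult (coeff q d) (smult \<kappa> \<rho> ^ d))" if "degree q \<le> d" for d
  proof -
    have "polyop D q f = smult (coeff q d) ((D ^^ d) f) + (\<Sum>i<d. smult (coeff q i) ((D ^^ i) f))" for f
    proof -
      have "polyop D q f = (\<Sum>i\<le>d. smult (coeff q i) ((D ^^ i) f))"
        unfolding polyop_def using that by (intro sum.mono_neutral_left) (auto simp: coeff_eq_0)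
      also have "{..d} = insert d {..<d}" by auto
      finally show ?thesis by simp
    qed
    moreover have "diffop (2 * d) (\<lambda>f. \<Sum>i<d. smult (coeff q i) ((D ^^ i) f))"
      by (intro diffop_sum diffop_smult has_top_imp_diffop[OF D_top]) auto
    from has_top_add[OF has_top_smult[OF D_top] diffop_imp_has_top_0[OF this]]
    have "has_top (2 * d) (\<lambda>f. smult (coeff q d) ((D ^^ d) f) + (\<Sum>i<d. smult (coeff q i) ((D ^^ i) f)))
        (smult (coeff q d) (smult \<kappa> \<rho> ^ d))" by simp
    ultimately show ?thesis by presburger
  qed
  have "?e f - polyop D q f = 0" for f
  proof (rule lowering_with_adjoint_eq_0[where C="\<lambda>f. ?e f - polyop D q f"
        and C'="\<lambda>g. C' g - polyop D q g"])
    fix n f assume f: "f \<in> deg_lt (Suc n)"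
    then have "coeff (?e f) n = coeff (polyop D q f) n"
      using coeff_diff_sum[of "2 * m" G f n] keep P_coeff by (auto simp: q_def)
    then show "?e f - polyop D q f \<in> deg_lt n"
      using f keep P_deg by (rule_tac deg_lt_if_lower) (auto intro!: deg_lt_diff)
  next
    fix n f assume "f \<in> deg_lt n"
    then show "C' f - polyop D q f \<in> deg_lt n"
      using P_deg keep' by (intro deg_lt_diff) auto
  next
    fix f g
    show "L ((?e f - polyop D q f) * g) = L (f * (C' g - polyop D q g))"
      by (simp only: left_diff_distrib right_diff_distrib L_diff P_sym adj[rule_format])
  qed
  then have e: "polyop D q = ?e" by (auto simp: fun_eq_iff)
  \<comment> \<open>Otherwise the given operator, of order at most \<open>2 * m\<close>, would have
    a nonzero coefficient at order \<open>2 * degree q\<close>.\<close>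
  have d: "degree q \<le> m"
  proof (rule ccontr)
    assume "\<not> degree q \<le> m"
    then have "diffop (2 * degree q) ?e"
      by (intro has_top_imp_diffop[OF has_top_diff_sum]) auto
    from has_top_unique[OF diffop_imp_has_top_0[OF this] P_top[OF order.refl, unfolded e]]
    have "lead_coeff q = 0"
      using \<rho>(2) \<kappa> by auto
    with \<open>\<not> degree q \<le> m\<close> show False by auto
  qed
  have "G (2 * m) = smult (coeff q m) (smult \<kappa> \<rho> ^ m)"
    by (rule has_top_unique[OF has_top_diff_sum P_top[OF d, unfolded e]])
  with d show "degree (eigen_poly (2 * m) G) \<le> m \<and>
      G (2 * m) = smult (coeff (eigen_poly (2 * m) G) m * \<kappa> ^ m) (\<rho> ^ m)"
    by (simp add: q_def smult_power)
qed

end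

subsection \<open>Incomparable moment sequences\<close>

text \<open>As in Raabe's test: if \<open>r\<close> is the ratio of consecutive terms of a sequence
  like \<open>n^l\<close>, the limit is the exponent \<open>l\<close>. Slopes add under
  products.\<close>

definition slope :: "(nat \<Rightarrow> complex) \<Rightarrow> complex \<Rightarrow> bool" where
  "slope r l \<longleftrightarrow> (\<lambda>n. of_nat n * (r n - 1)) \<longlonglongrightarrow> l"

lemma slope_imp_tendsto_1:
  assumes "slope r l" shows "r \<longlonglongrightarrow> 1"
proof -
  have "(\<lambda>n. (of_nat n * (r n - 1)) * (1 / of_nat n)) \<longlonglongrightarrow> l * 0"
    using assms unfolding slope_def by (intro tendsto_mult lim_1_over_n)
  then have "(\<lambda>n. r n - 1) \<longlonglongrightarrow> 0"
    by (rule Lim_transform_eventually[THEN tendsto_eq_rhs])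
       (rule eventually_mono[OF eventually_gt_at_top[of 0]], simp_all)
  then show ?thesis by (simp add: LIM_zero_iff)
qed

lemma slope_mult:
  assumes "slope r l" "slope r' l'" shows "slope (\<lambda>n. r n * r' n) (l + l')"
proof -
  have "(\<lambda>n. of_nat n * (r n - 1) * r' n + of_nat n * (r' n - 1)) \<longlonglongrightarrow> l * 1 + l'"
    using assms slope_imp_tendsto_1[OF assms(2)] unfolding slope_def by (intro tendsto_intros)
  then show ?thesis unfolding slope_def by (simp add: algebra_simps)
qed

lemma slope_inverse:
  assumes "slope r l" shows "slope (\<lambda>n. inverse (r n)) (- l)"
proof -
  have r: "r \<longlonglongrightarrow> 1" by (rule slope_imp_tendsto_1[OF assms])
  have "(\<lambda>n. - (of_nat n * (r n - 1)) * inverse (r n)) \<longlonglongrightarrow> (- l) * inverse 1"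
    using assms r unfolding slope_def by (intro tendsto_intros) auto
  moreover have "eventually (\<lambda>n. r n \<noteq> 0) sequentially"
    using r by (rule tendsto_imp_eventually_ne) simp
  then have "eventually (\<lambda>n. - (of_nat n * (r n - 1)) * inverse (r n) = of_nat n * (inverse (r n) - 1)) sequentially"
    by eventually_elim (simp add: field_simps)
  ultimately show ?thesis
    unfolding slope_def by (rule Lim_transform_eventually[THEN tendsto_eq_rhs]) simp
qed

lemma slope_divide: "slope r l \<Longrightarrow> slope r' l' \<Longrightarrow> slope (\<lambda>n. r n / r' n) (l - l')"
  using slope_mult[OF _ slope_inverse] by (simp add: divide_inverse)

lemma slope_cong:
  assumes "slope r l" "eventually (\<lambda>n. r n = r' n) sequentially" shows "slope r' l"
  using assms(1) unfolding slope_def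
  by (rule Lim_transform_eventually) (use assms(2) in eventually_elim, simp)

lemma slope_unique: "slope r l \<Longrightarrow> slope r l' \<Longrightarrow> l = l'"
  unfolding slope_def by (rule LIMSEQ_unique)

lemma slope_const: "slope (\<lambda>_. c) l \<Longrightarrow> c = 1"
  using slope_imp_tendsto_1 LIMSEQ_const_iff by metis

lemma slope_linear_fraction: "slope (\<lambda>n. (of_nat n + a) / (of_nat n + b)) (a - b)"
proof -
  have "(\<lambda>n. (a - b) / (1 + b / of_nat n)) \<longlonglongrightarrow> (a - b) / (1 + 0)"
    by (intro tendsto_intros lim_const_over_n) auto
  moreover have "eventually (\<lambda>n. of_nat n \<noteq> - b) sequentially"
  proof (cases "\<exists>k. of_nat k = - b")
    case True
    then obtain k where k: "of_nat k = - b" by blast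
    show ?thesis
      using eventually_gt_at_top[of k] by eventually_elim (metis k of_nat_eq_iff less_irrefl)
  qed auto
  then have "eventually (\<lambda>n. (a - b) / (1 + b / of_nat n) =
      of_nat n * ((of_nat n + a) / (of_nat n + b) - 1)) sequentially"
    using eventually_gt_at_top[of 0]
  proof eventually_elim
    case (elim n)
    then have "of_nat n + b \<noteq> 0" "1 + b / of_nat n \<noteq> 0"
      by (auto simp: add_eq_0_iff field_simps)
    with elim show ?case by (simp add: field_simps)
  qed
  ultimately show ?thesis
    unfolding slope_def by (rule Lim_transform_eventually[THEN tendsto_eq_rhs]) simp
qed

text \<open>Over the complex numbers a polynomial splits into factors \<open>x - z\<close>, and each
  contributes \<open>(n + 1 - z) / (n - z)\<close>, which has slope 1.\<close>

lemma slope_poly: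
  assumes "p \<noteq> 0"
  shows "slope (\<lambda>n. poly p (of_nat (Suc n)) / poly p (of_nat n)) (of_nat (degree p))"
  using assms
proof (induction "degree p" arbitrary: p)
  case 0
  then obtain c where c: "p = [:c:]" by (metis degree_eq_zeroE)
  with 0 show ?case by (simp add: slope_def)
next
  case (Suc d)
  then have "\<not> constant (poly p)" by (simp add: constant_degree)
  then obtain z where "poly p z = 0" using fundamental_theorem_of_algebra by blast
  then obtain q where q: "p = [:-z, 1:] * q"
    by (auto simp: poly_eq_0_iff_dvd)
  with Suc have "q \<noteq> 0" by auto
  then have dq: "degree p = Suc (degree q)"
    unfolding q by (subst degree_mult_eq) auto
  with Suc have "slope (\<lambda>n. poly q (of_nat (Suc n)) / poly q (of_nat n)) (of_nat (degree q))"
    using \<open>q \<noteq> 0\<close> by auto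
  from slope_mult[OF slope_linear_fraction[of "1 - z" "- z"] this] show ?case
    unfolding dq by (simp add: q algebra_simps)
qed

lemma poly_eq_0_if_nat_roots:
  fixes p :: "complex poly"
  assumes "\<And>n. poly p (of_nat (n + k)) = 0" shows "p = 0"
proof (rule ccontr)
  assume "p \<noteq> 0"
  then have "finite {z. poly p z = 0}" by (rule poly_roots_finite)
  moreover have "range (\<lambda>n. of_nat (n + k)) \<subseteq> {z. poly p z = 0}" using assms by auto
  ultimately have "finite (range (\<lambda>n. of_nat (n + k) :: complex))" by (rule rev_finite_subset)
  then show False
    by (subst (asm) finite_image_iff) (auto simp: inj_on_def)
qed

lemma eventually_poly_nonzero:
  fixes p :: "complex poly"
  assumes "p \<noteq> 0" shows "eventually (\<lambda>n. poly p (of_nat n) \<noteq> 0) sequentially"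
proof -
  have "finite (of_nat -` {z. poly p z = 0} :: nat set)"
    using assms by (intro finite_vimageI poly_roots_finite) (auto simp: inj_def)
  then have "eventually (\<lambda>n. n \<notin> (of_nat -` {z. poly p z = 0})) sequentially"
    using eventually_cofinite[of "\<lambda>n. n \<notin> (of_nat -` {z. poly p z = 0})"]
    by (simp add: cofinite_eq_sequentially)
  then show ?thesis by simp
qed

text \<open>\<open>s\<close> is the rational function \<open>P / Q\<close> times \<open>M\<close>,
  written without division; \<open>Q\<close> has no natural zeros, so every value of
  \<open>s\<close> is determined by \<open>P\<close>.\<close>

definition rational_multiple :: "(nat \<Rightarrow> complex) \<Rightarrow> (nat \<Rightarrow> complex) \<Rightarrow> bool" where
  "rational_multiple M s \<longleftrightarrow> (\<exists>P Q. (\<forall>n. poly Q (of_nat n) \<noteq> 0) \<and>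
     (\<forall>n. s n * poly Q (of_nat n) = poly P (of_nat n) * M n))"

lemma rational_multipleI:
  "(\<And>n. poly Q (of_nat n) \<noteq> 0) \<Longrightarrow> (\<And>n. s n * poly Q (of_nat n) = poly P (of_nat n) * M n) \<Longrightarrow>
     rational_multiple M s"
  unfolding rational_multiple_def by blast

lemma rational_multipleE:
  assumes "rational_multiple M s"
  obtains P Q where "\<And>n. poly Q (of_nat n) \<noteq> 0" "\<And>n. s n * poly Q (of_nat n) = poly P (of_nat n) * M n"
  using assms unfolding rational_multiple_def by blast

lemma rational_multiple_refl: "rational_multiple M M"
  by (rule rational_multipleI[of 1 _ 1]) auto

lemma rational_multiple_add:
  assumes "rational_multiple M s" "rational_multiple M t"
  shows "rational_multiple M (\<lambda>n. s n + t n)"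
proof -
  obtain P Q where 1: "\<And>n. poly Q (of_nat n) \<noteq> 0" "\<And>n. s n * poly Q (of_nat n) = poly P (of_nat n) * M n"
    using assms(1) by (rule rational_multipleE) blast
  obtain P' Q' where 2: "\<And>n. poly Q' (of_nat n) \<noteq> 0" "\<And>n. t n * poly Q' (of_nat n) = poly P' (of_nat n) * M n"
    using assms(2) by (rule rational_multipleE) blast
  show ?thesis
  proof (rule rational_multipleI[of "Q * Q'" _ "P * Q' + P' * Q"])
    fix n
    have "(s n + t n) * poly (Q * Q') (of_nat n) = s n * poly Q (of_nat n) * poly Q' (of_nat n) + t n * poly Q' (of_nat n) * poly Q (of_nat n)"
      by (simp add: algebra_simps)
    also have "\<dots> = poly (P * Q' + P' * Q) (of_nat n) * M n"
      unfolding 1 2 by (simp add: algebra_simps)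
    finally show "(s n + t n) * poly (Q * Q') (of_nat n) = poly (P * Q' + P' * Q) (of_nat n) * M n" .
  qed (use 1 2 in auto)
qed

lemma rational_multiple_poly_mult:
  assumes "rational_multiple M s"
  shows "rational_multiple M (\<lambda>n. poly p (of_nat n) * s n)"
proof -
  obtain P Q where 1: "\<And>n. poly Q (of_nat n) \<noteq> 0" "\<And>n. s n * poly Q (of_nat n) = poly P (of_nat n) * M n"
    using assms(1) by (rule rational_multipleE) blast
  then show ?thesis
    by (intro rational_multipleI[of Q _ "p * P"]) (auto simp: mult.assoc)
qed

lemma rational_multiple_const_mult:
  "rational_multiple M s \<Longrightarrow> rational_multiple M (\<lambda>n. c * s n)"
  using rational_multiple_poly_mult[of M s "[:c:]"] by simp

lemma rational_multiple_sum:
  "(\<And>i. i \<in> I \<Longrightarrow> rational_multiple M (s i)) \<Longrightarrow> rational_multiple M (\<lambda>n. \<Sum>i\<in>I. s i n)"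
proof (induction I rule: infinite_finite_induct)
  case (insert i I)
  then show ?case by (simp add: rational_multiple_add)
qed (use rational_multiple_const_mult[OF rational_multiple_refl, of M 0] in auto)

text \<open>\<open>M\<close> is a hypergeometric term: its consecutive quotient is rational in the
  index, without zeros or poles at natural numbers. Hence a shifted rational multiple of
  \<open>M\<close> is again one.\<close>

locale moment_ratio =
  fixes M :: "nat \<Rightarrow> complex" and u v :: "complex poly"
  assumes ratio: "M (Suc n) * poly v (of_nat n) = poly u (of_nat n) * M n"
    and u_nz: "poly u (of_nat n) \<noteq> 0" and v_nz: "poly v (of_nat n) \<noteq> 0" and M0: "M 0 \<noteq> 0"
begin

lemma M_nz: "M n \<noteq> 0"
proof (induction n)
  case (Suc n)
  then show ?case using ratio[of n] u_nz[of n] by auto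
qed (rule M0)

lemma M_Suc: "M (Suc n) = poly u (of_nat n) / poly v (of_nat n) * M n"
  using ratio[of n] v_nz[of n] by (simp add: field_simps)

lemma rational_multiple_Suc:
  assumes "rational_multiple M s"
  shows "rational_multiple M (\<lambda>n. s (Suc n))"
proof -
  obtain P Q where 1: "\<And>n. poly Q (of_nat n) \<noteq> 0" "\<And>n. s n * poly Q (of_nat n) = poly P (of_nat n) * M n"
    using assms(1) by (rule rational_multipleE) blast
  show ?thesis
  proof (rule rational_multipleI[of "pcompose Q [:1, 1:] * v" _ "pcompose P [:1, 1:] * u"])
    fix n
    have "s (Suc n) * poly (pcompose Q [:1, 1:] * v) (of_nat n) = (s (Suc n) * poly Q (of_nat (Suc n))) * poly v (of_nat n)"
      by (simp add: poly_pcompose)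
    also have "\<dots> = poly P (of_nat (Suc n)) * (M (Suc n) * poly v (of_nat n))"
      unfolding 1 by simp
    finally show "s (Suc n) * poly (pcompose Q [:1, 1:] * v) (of_nat n) = poly (pcompose P [:1, 1:] * u) (of_nat n) * M n"
      unfolding ratio by (simp add: poly_pcompose)
    show "poly (pcompose Q [:1, 1:] * v) (of_nat n) \<noteq> 0"
      using 1(1)[of "Suc n"] v_nz[of n] by (simp add: poly_pcompose)
  qed
qed

lemma rational_multiple_shift:
  "rational_multiple M s \<Longrightarrow> rational_multiple M (\<lambda>n. s (n + k))"
  by (induction k) (auto dest: rational_multiple_Suc)

end

lemma rational_multiple_shift_both:
  assumes "rational_multiple M s"
  shows "rational_multiple (\<lambda>n. M (n + k)) (\<lambda>n. s (n + k))"
proof -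
  obtain P Q where 1: "\<And>n. poly Q (of_nat n) \<noteq> 0" "\<And>n. s n * poly Q (of_nat n) = poly P (of_nat n) * M n"
    using assms(1) by (rule rational_multipleE) blast
  show ?thesis
    using 1[of "n + k" for n]
    by (intro rational_multipleI[of "pcompose Q [:of_nat k, 1:]" _ "pcompose P [:of_nat k, 1:]"])
       (simp_all add: poly_pcompose add.commute)
qed

text \<open>If \<open>s\<close> is not zero, clearing denominators gives
  \<open>X(n) M(n) = Y(n) M'(n)\<close> with nonzero polynomials, so the slope of
  \<open>r / r'\<close> is \<open>degree Y - degree X\<close>, an integer.\<close>

lemma common_rational_multiple_eq_0:
  assumes s: "rational_multiple M s" "rational_multiple M' s"
    and M: "\<And>n. M n \<noteq> 0" "\<And>n. M (Suc n) = r n * M n"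
    and M': "\<And>n. M' n \<noteq> 0" "\<And>n. M' (Suc n) = r' n * M' n"
    and no_slope: "\<And>e :: int. \<not> slope (\<lambda>n. r n / r' n) (of_int e)"
  shows "s n = 0"
proof -
  obtain P Q where 1: "\<And>n. poly Q (of_nat n) \<noteq> 0" "\<And>n. s n * poly Q (of_nat n) = poly P (of_nat n) * M n"
    using s(1) by (rule rational_multipleE) blast
  obtain P' Q' where 2: "\<And>n. poly Q' (of_nat n) \<noteq> 0" "\<And>n. s n * poly Q' (of_nat n) = poly P' (of_nat n) * M' n"
    using s(2) by (rule rational_multipleE) blast
  have "P = 0"
  proof (rule ccontr)
    assume "P \<noteq> 0"
    define X Y where "X = P * Q'" and "Y = P' * Q"
    have XY: "poly X (of_nat n) * M n = poly Y (of_nat n) * M' n" for n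
    proof -
      have "poly X (of_nat n) * M n = (s n * poly Q (of_nat n)) * poly Q' (of_nat n)"
        unfolding 1 X_def by simp
      also have "\<dots> = (s n * poly Q' (of_nat n)) * poly Q (of_nat n)" by simp
      finally show ?thesis unfolding 2 Y_def by simp
    qed
    have "X \<noteq> 0" using \<open>P \<noteq> 0\<close> 2(1)[of 0] by (auto simp: X_def)
    have "Y \<noteq> 0"
    proof
      assume "Y = 0"
      then have "poly X (of_nat (n + 0)) = 0" for n using XY[of n] M(1)[of n] by simp
      with poly_eq_0_if_nat_roots[of X 0] \<open>X \<noteq> 0\<close> show False by blast
    qed
    define x y where "x n = poly X (of_nat (Suc n)) / poly X (of_nat n)"
      and "y n = poly Y (of_nat (Suc n)) / poly Y (of_nat n)" for n
    have "slope (\<lambda>n. y n / x n) (of_nat (degree Y) - of_nat (degree X))"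
      unfolding x_def y_def by (intro slope_divide slope_poly \<open>X \<noteq> 0\<close> \<open>Y \<noteq> 0\<close>)
    then have "slope (\<lambda>n. r n / r' n) (of_nat (degree Y) - of_nat (degree X))"
    proof (rule slope_cong)
      have XS: "eventually (\<lambda>n. poly X (of_nat (Suc n)) \<noteq> 0) sequentially"
        using eventually_poly_nonzero[OF \<open>X \<noteq> 0\<close>] by (simp add: eventually_sequentially_Suc[of "\<lambda>n. poly X (of_nat n) \<noteq> 0"] del: of_nat_Suc)
      show "eventually (\<lambda>n. y n / x n = r n / r' n) sequentially"
        using eventually_poly_nonzero[OF \<open>X \<noteq> 0\<close>] eventually_poly_nonzero[OF \<open>Y \<noteq> 0\<close>] XS
      proof eventually_elim
        case (elim n)
        have r': "r' n \<noteq> 0" using M'(1)[of "Suc n"] M'(2)[of n] by auto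
        have "poly X (of_nat (Suc n)) * r n * (poly X (of_nat n) * M n) = poly X (of_nat n) * (poly Y (of_nat (Suc n)) * M' (Suc n))"
          unfolding XY[of "Suc n", symmetric] M(2) by simp
        also have "\<dots> = poly X (of_nat n) * poly Y (of_nat (Suc n)) * r' n * M' n"
          unfolding M'(2) by simp
        finally have "(poly X (of_nat (Suc n)) * r n * poly Y (of_nat n)) * M' n =
            (poly X (of_nat n) * poly Y (of_nat (Suc n)) * r' n) * M' n"
          unfolding XY by (simp only: mult.assoc)
        then have "poly X (of_nat (Suc n)) * r n * poly Y (of_nat n) =
            poly X (of_nat n) * poly Y (of_nat (Suc n)) * r' n"
          using M'(1)[of n] by (simp del: of_nat_Suc)
        then show ?case
          using elim r' by (simp only: x_def y_def) (simp add: frac_eq_eq mult_ac del: of_nat_Suc)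
      qed
    qed
    then show False
      using no_slope[of "int (degree Y) - int (degree X)"] by simp
  qed
  then show ?thesis using 1[of n] by simp
qed

section \<open>Test sequences that separate two functionals\<close>

definition incompatible :: "(complex poly \<Rightarrow> complex) \<Rightarrow> (complex poly \<Rightarrow> complex) \<Rightarrow> bool" where
  "incompatible L' L \<longleftrightarrow> (\<forall>K \<phi> \<psi>. diffop K \<phi> \<and> (\<forall>f g. L (\<phi> f * g) = L' (f * \<psi> g)) \<longrightarrow> (\<forall>f. \<phi> f = 0))"

text \<open>The polynomial factor \<open>p\<close> in the last axiom absorbs the coefficients of a
  differential operator and the second argument of the pairing.\<close>

locale test_sequence = pos_functional L + moment_ratio "\<lambda>n. L (F n)" u v
  for L and F :: "nat \<Rightarrow> complex poly" and u v +
  assumes F_rational: "rational_multiple (\<lambda>n. L (F n)) (\<lambda>n. L (F n * p))"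

text \<open>The \<open>F n\<close> behave like powers under differentiation. Indexing by
  \<open>n + k\<close> avoids truncated subtraction and leaves a factor polynomial in
  \<open>n\<close>.\<close>

lemma derivative_sequence_higher:
  fixes F :: "nat \<Rightarrow> complex poly"
  assumes "\<And>n. pderiv (F (Suc n)) = smult (\<kappa> * of_nat (Suc n)) (F n)"
  shows "\<exists>p. \<forall>n. (pderiv ^^ k) (F (n + k)) = smult (poly p (of_nat n)) (F n)"
proof (induction k)
  case 0
  show ?case by (rule exI[of _ 1]) simp
next
  case (Suc k)
  then obtain p where p: "\<And>n. (pderiv ^^ k) (F (n + k)) = smult (poly p (of_nat n)) (F n)" by blast
  have "(pderiv ^^ Suc k) (F (n + Suc k)) = smult (poly (p * [:\<kappa> * of_nat (Suc k), \<kappa>:]) (of_nat n)) (F n)" for n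
  proof -
    have "(pderiv ^^ Suc k) (F (n + Suc k)) = (pderiv ^^ k) (pderiv (F (Suc (n + k))))"
      by (simp add: funpow_swap1)
    also have "\<dots> = smult (\<kappa> * of_nat (Suc (n + k)) * poly p (of_nat n)) (F n)"
      unfolding assms higher_pderiv_smult p by simp
    finally show ?thesis by (simp add: algebra_simps)
  qed
  then show ?case by blast
qed

lemma derivative_sequence_coeff:
  fixes F :: "nat \<Rightarrow> complex poly"
  assumes F: "\<And>n. pderiv (F (Suc n)) = smult (\<kappa> * of_nat (Suc n)) (F n)" and F0: "F 0 = 1"
  shows "coeff (F n) n = \<kappa> ^ n \<and> F n \<in> deg_lt (Suc n)"
proof (induction n)
  case 0
  show ?case by (auto simp: F0 deg_lt_def coeff_eq_0)
next
  case (Suc n)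
  have *: "of_nat (Suc i) * coeff (F (Suc n)) (Suc i) = \<kappa> * of_nat (Suc n) * coeff (F n) i" for i
    using arg_cong[OF F[of n], of "\<lambda>p. coeff p i"] by (simp add: coeff_pderiv)
  have "coeff (F (Suc n)) (Suc n) = \<kappa> ^ Suc n"
    using *[of n] Suc.IH by (simp del: of_nat_Suc)
  moreover have "coeff (F (Suc n)) i = 0" if "i \<ge> Suc (Suc n)" for i
  proof -
    define j where "j = i - 1"
    have j: "i = Suc j" "j \<ge> Suc n" using that by (auto simp: j_def)
    then show ?thesis using *[of j] Suc.IH by (simp add: deg_lt_def del: of_nat_Suc)
  qed
  ultimately show ?case by (auto simp: deg_lt_def)
qed

text \<open>Testing \<open>L (\<phi> f * g) = L' (f * \<psi> g)\<close> on \<open>f = F n\<close> makes one sequence a rational multiple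
  of the moments of both functionals.\<close>

lemma incompatibleI:
  assumes L': "test_sequence L' F u' v'" and L: "test_sequence L F u v"
    and F: "\<And>n. pderiv (F (Suc n)) = smult (\<kappa> * of_nat (Suc n)) (F n)" and F0: "F 0 = 1" and \<kappa>: "\<kappa> \<noteq> 0"
    and no_slope: "\<And>K (e :: int). \<not> slope (\<lambda>n. (poly u (of_nat n) / poly v (of_nat n)) /
                 (poly u' (of_nat (n + K)) / poly v' (of_nat (n + K)))) (of_int e)"
  shows "incompatible L' L"
  unfolding incompatible_def
proof (intro allI impI, elim conjE)
  interpret L: test_sequence L F u v by (rule L)
  interpret L': test_sequence L' F u' v' by (rule L')
  fix K \<phi> \<psi> f
  assume \<phi>: "diffop K \<phi>" and adj: "\<forall>f g. L (\<phi> f * g) = L' (f * \<psi> g)"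
  obtain G where G: "\<phi> = diff_sum K G" using \<phi> by (auto simp: diffop_def)
  have \<psi>: "\<psi> g = 0" for g
  proof -
    \<comment> \<open>The offset \<open>K\<close> exceeds every order of differentiation in
      \<open>\<phi>\<close>, so no index falls below 0.\<close>
    define s where "s n = L (\<phi> (F (n + K)) * g)" for n
    have s1: "rational_multiple (\<lambda>n. L (F n)) s"
    proof -
      have "rational_multiple (\<lambda>n. L (F n)) (\<lambda>n. L ((pderiv ^^ k) (F (n + K)) * G k * g))" if "k < K" for k
      proof -
        obtain p where p: "\<And>n. (pderiv ^^ k) (F (n + k)) = smult (poly p (of_nat n)) (F n)"
          using derivative_sequence_higher[OF F] by blast
        have "(pderiv ^^ k) (F (n + K)) = smult (poly p (of_nat (n + (K - k)))) (F (n + (K - k)))" for n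
          using p[of "n + (K - k)"] that by (simp add: add.assoc)
        then have "L ((pderiv ^^ k) (F (n + K)) * G k * g) =
            poly p (of_nat (n + (K - k))) * L (F (n + (K - k)) * (G k * g))" for n
          by (simp add: L.L_smult mult.assoc)
        moreover have "rational_multiple (\<lambda>n. L (F n)) (\<lambda>n. poly p (of_nat (n + (K - k))) * L (F (n + (K - k)) * (G k * g)))"
          by (rule L.rational_multiple_shift[OF rational_multiple_poly_mult[OF L.F_rational]])
        ultimately show ?thesis by simp
      qed
      then have "rational_multiple (\<lambda>n. L (F n)) (\<lambda>n. \<Sum>k<K. L ((pderiv ^^ k) (F (n + K)) * G k * g))"
        by (intro rational_multiple_sum) auto
      then show ?thesis
        by (simp add: s_def[abs_def] G diff_sum_def sum_distrib_right L.L_sum)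
    qed
    have s': "s n = L' (F (n + K) * \<psi> g)" for n
      using adj by (simp add: s_def)
    then have s2: "rational_multiple (\<lambda>n. L' (F (n + K))) s"
      using rational_multiple_shift_both[OF L'.F_rational, of K "\<psi> g"] by (simp add: s'[abs_def])
    have s0: "s n = 0" for n
    proof (rule common_rational_multiple_eq_0[OF s1 s2 L.M_nz L.M_Suc L'.M_nz _ no_slope])
      show "L' (F (Suc n + K)) = poly u' (of_nat (n + K)) / poly v' (of_nat (n + K)) * L' (F (n + K))" for n
        using L'.M_Suc[of "n + K"] by simp
    qed
    obtain P Q where PQ: "\<And>n. poly Q (of_nat n) \<noteq> 0" "\<And>n. L' (F n * \<psi> g) * poly Q (of_nat n) = poly P (of_nat n) * L' (F n)"
      using L'.F_rational[of "\<psi> g"] by (rule rational_multipleE) blast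
    \<comment> \<open>So far the pairing vanishes only for indices from \<open>K\<close> on. A
      polynomial with that many roots is 0, which settles the indices below \<open>K\<close> as
      well.\<close>
    have "poly P (of_nat (n + K)) = 0" for n
      using PQ(2)[of "n + K"] s0[of n] s'[of n] L'.M_nz[of "n + K"] by simp
    then have "P = 0" by (rule poly_eq_0_if_nat_roots)
    then have F_orth: "L' (F n * \<psi> g) = 0" for n
      using PQ[of n] by simp
    have orth: "\<forall>p\<in>deg_lt n. L' (p * \<psi> g) = 0" for n
    proof (induction n)
      case 0
      then show ?case by (simp add: deg_lt_0_iff)
    next
      case (Suc n)
      show ?case
      proof
        fix p assume p: "p \<in> deg_lt (Suc n)"
        \<comment> \<open>\<open>F n\<close> has degree exactly \<open>n\<close> with leading
          coefficient \<open>\<kappa> ^ n\<close>, so subtracting this multiple lowers the degree: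
          the \<open>F n\<close> span all polynomials.\<close>
        define c where "c = coeff p n / \<kappa> ^ n"
        have Fn: "coeff (F n) n = \<kappa> ^ n" "F n \<in> deg_lt (Suc n)"
          using derivative_sequence_coeff[OF F F0] by blast+
        have "p - smult c (F n) \<in> deg_lt n"
          using Fn \<kappa> p by (intro deg_lt_if_lower[OF deg_lt_diff[OF p deg_lt_smult]]) (simp_all add: c_def)
        with Suc.IH have "L' ((p - smult c (F n)) * \<psi> g) = 0" by blast
        then show "L' (p * \<psi> g) = 0"
          by (simp add: left_diff_distrib L'.L_diff L'.L_smult F_orth)
      qed
    qed
    have "L' (\<psi> g * q) = 0" for q
      using orth deg_lt_degree[of q] by (metis mult.commute)
    then show "\<psi> g = 0" by (rule L'.nondegenerate)
  qed
  show "\<phi> f = 0"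
    by (rule L.nondegenerate) (simp add: adj \<psi>)
qed

lemma pderiv_linear_power:
  "pderiv ([:a, c:] ^ Suc n) = smult (c * of_nat (Suc n)) ([:a, c:] ^ n)"
  by (simp add: pderiv_power_Suc pderiv_pCons mult.commute del: power_Suc of_nat_Suc)

text \<open>Multiplication by \<open>x = ((a + c x) - a) / c\<close> either raises the power by one
  or keeps it, and both preserve rational multiples; the claim follows by induction on the
  coefficients of \<open>p\<close>.\<close>

lemma test_sequence_linear_power:
  assumes "pos_functional L" "moment_ratio (\<lambda>n. L ([:a, c:] ^ n)) u v" "c \<noteq> 0"
  shows "test_sequence L (\<lambda>n. [:a, c:] ^ n) u v"
proof -
  interpret pos_functional L by fact
  interpret moment_ratio "\<lambda>n. L ([:a, c:] ^ n)" u v by fact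
  have "rational_multiple (\<lambda>n. L ([:a, c:] ^ n)) (\<lambda>n. L ([:a, c:] ^ n * p))" for p
  proof (induction p)
    case 0
    show ?case using rational_multiple_const_mult[OF rational_multiple_refl, of _ 0] by simp
  next
    case (pCons d p)
    have "[:a, c:] ^ n * pCons d p = smult d ([:a, c:] ^ n) +
        (smult (1 / c) ([:a, c:] ^ Suc n * p) + smult (- a / c) ([:a, c:] ^ n * p))" for n
    proof -
      have "pCons d p = smult d 1 + (smult (1 / c) ([:a, c:] * p) + smult (- a / c) p)"
        using assms(3) by (simp add: smult_add_right)
      then show ?thesis
        by (simp only: distrib_left mult_smult_right power_Suc mult_1_right) (simp only: mult_ac)
    qed
    then have "L ([:a, c:] ^ n * pCons d p) = d * L ([:a, c:] ^ n) +
        (1 / c * L ([:a, c:] ^ Suc n * p) + - a / c * L ([:a, c:] ^ n * p))" for n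
      by (simp only: L_add L_smult)
    then show ?case
      using rational_multiple_Suc[OF pCons.IH]
      by (simp only:) (intro rational_multiple_add rational_multiple_const_mult pCons.IH rational_multiple_refl)
  qed
  then show ?thesis by unfold_locales
qed

section \<open>Laguerre and Jacobi weights: moment ratios and incompatibility\<close>

lemma moment_ratio_laguerre:
  assumes "pearson_functional L [:0, 1:] [:a + 1, -1:]" "\<And>n. a + 1 + of_nat n \<noteq> 0"
  shows "moment_ratio (\<lambda>n. L ([:0, 1:] ^ n)) [:a + 1, 1:] 1"
proof -
  interpret pearson_functional L "[:0, 1:]" "[:a + 1, -1:]" by fact
  have "[:0, 1:] * pderiv ([:0, 1:] ^ n) = smult (of_nat n) ([:0, 1:] ^ n)" for n :: nat
    by (cases n) (simp_all only: pderiv_linear_power, simp_all)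
  then have "[:0, 1:] * pderiv ([:0, 1:] ^ n) + [:a + 1, -1:] * [:0, 1:] ^ n =
      smult (a + 1 + of_nat n) ([:0, 1:] ^ n) - [:0, 1:] ^ Suc n" for n :: nat
    by (simp add: algebra_simps smult_add_left)
  \<comment> \<open>Pearson at \<open>x^n\<close> yields the moment recurrence, which is the
    functional equation of the Gamma function.\<close>
  then have "L (smult (a + 1 + of_nat n) ([:0, 1:] ^ n) - [:0, 1:] ^ Suc n) = 0" for n
    using pearson[of "[:0, 1:] ^ n"] by metis
  then have "L ([:0, 1:] ^ Suc n) = (a + 1 + of_nat n) * L ([:0, 1:] ^ n)" for n
    by (simp only: L_diff L_smult) simp
  then show ?thesis
    using L_1_nonzero assms(2) by unfold_locales (simp_all del: power_Suc)
qed

lemma incompatible_laguerre: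
  assumes "\<alpha> > -1" "\<alpha>' > -1" "\<alpha> - \<alpha>' \<notin> \<int>"
  shows "incompatible (moment_functional {0<..} (laguerre_w \<alpha>')) (moment_functional {0<..} (laguerre_w \<alpha>))"
proof -
  have nz: "complex_of_real a + 1 + of_nat n \<noteq> 0" if "a > -1" for a n
  proof -
    have "a + 1 + real n \<noteq> 0" using that by (simp add: add_nonneg_eq_0_iff)
    then show ?thesis by (metis of_real_1 of_real_add of_real_eq_0_iff of_real_of_nat_eq)
  qed
  have ts: "test_sequence (moment_functional {0<..} (laguerre_w a)) (\<lambda>n. [:0, 1:] ^ n) [:of_real a + 1, 1:] 1"
    if "a > -1" for a
    using that pearson_functional_laguerre[OF that]
    by (intro test_sequence_linear_power moment_ratio_laguerre nz) (auto simp: pearson_functional_def)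
  show ?thesis
  proof (rule incompatibleI[OF ts ts pderiv_linear_power])
    fix K and e :: int
    show "\<not> slope (\<lambda>n. poly [:complex_of_real \<alpha> + 1, 1:] (of_nat n) / poly 1 (of_nat n) /
        (poly [:complex_of_real \<alpha>' + 1, 1:] (of_nat (n + K)) / poly 1 (of_nat (n + K)))) (of_int e)"
    proof
      assume "slope (\<lambda>n. poly [:complex_of_real \<alpha> + 1, 1:] (of_nat n) / poly 1 (of_nat n) /
        (poly [:complex_of_real \<alpha>' + 1, 1:] (of_nat (n + K)) / poly 1 (of_nat (n + K)))) (of_int e)"
      then have "slope (\<lambda>n. (of_nat n + (of_real \<alpha> + 1)) / (of_nat n + (of_real \<alpha>' + 1 + of_nat K))) (of_int e)"
        by (simp add: algebra_simps)
      \<comment> \<open>The slope is \<open>\<alpha> - \<alpha>' - K\<close>; if it were an integer,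
        so would be \<open>\<alpha> - \<alpha>'\<close>.\<close>
      from slope_unique[OF this slope_linear_fraction]
      have "complex_of_real (\<alpha> - \<alpha>') = of_real (of_int (e + int K))" by (simp add: algebra_simps)
      then have "\<alpha> - \<alpha>' = of_int (e + int K)" by (simp only: of_real_eq_iff)
      with assms(3) show False by (metis Ints_of_int)
    qed
  qed (use assms in auto)
qed

text \<open>In the application \<open>c\<close> is the exponent at the zero of
  \<open>1 + \<sigma> x\<close>, and \<open>s\<close> the sum of both exponents. Writing
  \<open>1 - \<sigma> x\<close> as \<open>2 - (1 + \<sigma> x)\<close> turns Pearson at
  \<open>(1 + \<sigma> x)^n\<close> into a first-order recurrence.\<close>

lemma moment_ratio_jacobi:
  assumes "pearson_functional L [:1, 0, -1:] \<tau>" and \<tau>: "\<tau> = smult \<sigma> ([:2 * c + 2:] - smult (s + 2) [:1, \<sigma>:])"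
    and \<sigma>: "\<sigma> * \<sigma> = 1" and nz: "\<And>n. c + 1 + of_nat n \<noteq> 0" "\<And>n. s + 2 + of_nat n \<noteq> 0"
  shows "moment_ratio (\<lambda>n. L ([:1, \<sigma>:] ^ n)) [:2 * c + 2, 2:] [:s + 2, 1:]"
proof -
  interpret pearson_functional L "[:1, 0, -1:]" \<tau> by fact
  have \<rho>: "[:1, 0, -1:] = [:1, \<sigma>:] * [:1, - \<sigma>:]" using \<sigma> by simp
  have r: "[:1, - \<sigma>:] = [:2:] - [:1, \<sigma>:]" by simp
  have "[:1, \<sigma>:] * pderiv ([:1, \<sigma>:] ^ n) = smult (\<sigma> * of_nat n) ([:1, \<sigma>:] ^ n)" for n :: nat
  proof (cases n)
    case (Suc k)
    have "[:1, \<sigma>:] * pderiv ([:1, \<sigma>:] ^ Suc k) = smult (\<sigma> * of_nat (Suc k)) ([:1, \<sigma>:] ^ Suc k)"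
      unfolding pderiv_linear_power by (simp only: mult_smult_right power_Suc)
    then show ?thesis unfolding Suc .
  qed simp
  then have "[:1, 0, -1:] * pderiv ([:1, \<sigma>:] ^ n) = [:1, - \<sigma>:] * smult (\<sigma> * of_nat n) ([:1, \<sigma>:] ^ n)" for n :: nat
    unfolding \<rho> by (metis mult.assoc mult.commute)
  also have "[:1, - \<sigma>:] * smult (\<sigma> * of_nat n) ([:1, \<sigma>:] ^ n) =
      smult (\<sigma> * of_nat n) (smult 2 ([:1, \<sigma>:] ^ n) - [:1, \<sigma>:] ^ Suc n)" for n :: nat
  proof -
    have "[:2:] * p = smult 2 p" for p :: "complex poly" by simp
    then show ?thesis
      unfolding r by (simp only: left_diff_distrib mult_smult_right power_Suc smult_diff_right)
  qed
  finally have 1: "[:1, 0, -1:] * pderiv ([:1, \<sigma>:] ^ n) =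
      smult (\<sigma> * of_nat n) (smult 2 ([:1, \<sigma>:] ^ n) - [:1, \<sigma>:] ^ Suc n)" for n .
  have 2: "\<tau> * [:1, \<sigma>:] ^ n = smult \<sigma> (smult (2 * c + 2) ([:1, \<sigma>:] ^ n) - smult (s + 2) ([:1, \<sigma>:] ^ Suc n))" for n
  proof -
    have "\<tau> * [:1, \<sigma>:] ^ n = smult \<sigma> ([:2 * c + 2:] * [:1, \<sigma>:] ^ n - smult (s + 2) [:1, \<sigma>:] * [:1, \<sigma>:] ^ n)"
      unfolding \<tau> by (simp only: mult_smult_left left_diff_distrib)
    then show ?thesis by (simp only: mult_smult_left power_Suc) simp
  qed
  have *: "\<sigma> * (of_nat n * (2 * L ([:1, \<sigma>:] ^ n) - L ([:1, \<sigma>:] ^ Suc n)) +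
      ((2 * c + 2) * L ([:1, \<sigma>:] ^ n) - (s + 2) * L ([:1, \<sigma>:] ^ Suc n))) = 0" for n
    using pearson[of "[:1, \<sigma>:] ^ n"] unfolding 1 2
    by (simp only: L_add L_diff L_smult) (simp add: algebra_simps)
  have "L ([:1, \<sigma>:] ^ Suc n) * (s + 2 + of_nat n) = (2 * c + 2 + 2 * of_nat n) * L ([:1, \<sigma>:] ^ n)" for n
  proof -
    have "\<sigma> \<noteq> 0" using \<sigma> by auto
    then have "of_nat n * (2 * L ([:1, \<sigma>:] ^ n) - L ([:1, \<sigma>:] ^ Suc n)) +
        ((2 * c + 2) * L ([:1, \<sigma>:] ^ n) - (s + 2) * L ([:1, \<sigma>:] ^ Suc n)) = 0"
      using *[of n] unfolding mult_eq_0_iff by blast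
    then show ?thesis by (simp add: algebra_simps del: power_Suc)
  qed
  moreover have "2 * c + 2 + of_nat n * 2 \<noteq> 0" for n
  proof
    assume "2 * c + 2 + of_nat n * 2 = 0"
    then have "2 * (c + 1 + of_nat n) = 0" by (simp add: algebra_simps)
    then show False using nz(1)[of n] unfolding mult_eq_0_iff by simp
  qed
  ultimately show ?thesis
    using L_1_nonzero nz(2) by unfold_locales (simp_all add: mult.commute del: power_Suc)
qed

text \<open>The exponents at the endpoints \<open>1\<close> and \<open>-1\<close> are separated by the test sequences
  \<open>(1 + x) ^ n\<close> and \<open>(1 - x) ^ n\<close>, that is \<open>\<sigma> = 1\<close> and \<open>\<sigma> = -1\<close>.\<close>

lemma incompatible_jacobi_aux:
  fixes c c' s s' :: real and \<sigma> :: complex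
  assumes L: "pearson_functional L [:1, 0, -1:] (smult \<sigma> ([:2 * of_real c + 2:] - smult (of_real s + 2) [:1, \<sigma>:]))"
    and L': "pearson_functional L' [:1, 0, -1:] (smult \<sigma> ([:2 * of_real c' + 2:] - smult (of_real s' + 2) [:1, \<sigma>:]))"
    and \<sigma>: "\<sigma> * \<sigma> = 1" and gt: "c > -1" "c' > -1" "s > -2" "s' > -2"
    and nonint: "(s - c) - (s' - c') \<notin> \<int>"
  shows "incompatible L' L"
proof -
  have nz: "complex_of_real a + of_nat k + of_nat n \<noteq> 0" if "a > - real k" for a k n
  proof -
    have "a + real k + real n \<noteq> 0" using that by (simp add: add_nonneg_eq_0_iff)
    then show ?thesis by (metis of_real_add of_real_eq_0_iff of_real_of_nat_eq)
  qed
  have nz1: "complex_of_real a + 1 + of_nat n \<noteq> 0" if "a > - 1" for a n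
    using nz[of 1 a n] that by simp
  have nz2: "complex_of_real a + 2 + of_nat n \<noteq> 0" if "a > - 2" for a n
    using nz[of 2 a n] that by simp
  have \<sigma>0: "\<sigma> \<noteq> 0" using \<sigma> by auto
  have ts: "test_sequence L'' (\<lambda>n. [:1, \<sigma>:] ^ n) [:2 * complex_of_real d + 2, 2:] [:complex_of_real t + 2, 1:]"
    if "pearson_functional L'' [:1, 0, -1:] (smult \<sigma> ([:2 * of_real d + 2:] - smult (of_real t + 2) [:1, \<sigma>:]))"
      "d > -1" "t > -2" for L'' d t
    using that \<sigma>0
    by (intro test_sequence_linear_power moment_ratio_jacobi[OF that(1) refl \<sigma>] nz1 nz2)
       (auto simp: pearson_functional_def)
  show ?thesis
  proof (rule incompatibleI[OF ts[OF L' gt(2,4)] ts[OF L gt(1,3)] pderiv_linear_power _ \<sigma>0])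
    fix K and e :: int
    let ?r = "\<lambda>n. poly [:2 * complex_of_real c + 2, 2:] (of_nat n) / poly [:complex_of_real s + 2, 1:] (of_nat n) /
        (poly [:2 * complex_of_real c' + 2, 2:] (of_nat (n + K)) / poly [:complex_of_real s' + 2, 1:] (of_nat (n + K)))"
    show "\<not> slope ?r (of_int e)"
    proof
      assume *: "slope ?r (of_int e)"
      have "?r n = ((of_nat n + (of_real c + 1)) / (of_nat n + (of_real c' + 1 + of_nat K))) *
          ((of_nat n + (of_real s' + 2 + of_nat K)) / (of_nat n + (of_real s + 2)))" for n
      proof -
        have "poly [:2 * complex_of_real c + 2, 2:] (of_nat n) = 2 * (of_nat n + (of_real c + 1))"
          "poly [:complex_of_real s + 2, 1:] (of_nat n) = of_nat n + (of_real s + 2)"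
          "poly [:2 * complex_of_real c' + 2, 2:] (of_nat (n + K)) = 2 * (of_nat n + (of_real c' + 1 + of_nat K))"
          "poly [:complex_of_real s' + 2, 1:] (of_nat (n + K)) = of_nat n + (of_real s' + 2 + of_nat K)"
          by (simp_all add: algebra_simps)
        moreover have "2 * A / B / (2 * C / D) = (A / C) * (D / B)" for A B C D :: complex by simp
        ultimately show ?thesis by (simp only:)
      qed
      with * have "slope (\<lambda>n. ((of_nat n + (of_real c + 1)) / (of_nat n + (of_real c' + 1 + of_nat K))) *
          ((of_nat n + (of_real s' + 2 + of_nat K)) / (of_nat n + (of_real s + 2)))) (of_int e)"
        by (simp only:)
      \<comment> \<open>The offset \<open>K\<close> cancels between the two fractions: the slope is
        \<open>(s' - c') - (s - c)\<close>, a difference of exponents at the other endpoint.\<close>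
      from slope_unique[OF this slope_mult[OF slope_linear_fraction slope_linear_fraction]]
      have "complex_of_real ((s - c) - (s' - c')) = of_real (of_int (- e))"
        by (simp add: algebra_simps)
      then have "(s - c) - (s' - c') = of_int (- e)" by (simp only: of_real_eq_iff)
      with nonint show False by (metis Ints_of_int)
    qed
  qed simp
qed

lemma incompatible_jacobi:
  assumes gt: "\<alpha> > -1" "\<beta> > -1" "\<alpha>' > -1" "\<beta>' > -1"
    and nonint: "\<alpha> - \<alpha>' \<notin> \<int> \<or> \<beta> - \<beta>' \<notin> \<int>"
  shows "incompatible (moment_functional {-1<..<1} (jacobi_w \<alpha>' \<beta>')) (moment_functional {-1<..<1} (jacobi_w \<alpha> \<beta>))"
proof -
  note P = pearson_functional_jacobi[OF gt(1,2)] pearson_functional_jacobi[OF gt(3,4)]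
  have t1: "[:of_real b - of_real a, - (of_real a + of_real b + 2):] =
      smult 1 ([:2 * complex_of_real b + 2:] - smult (of_real (a + b) + 2) [:1, 1:])" for a b :: real
    by simp
  have t2: "[:of_real b - of_real a, - (of_real a + of_real b + 2):] =
      smult (-1) ([:2 * complex_of_real a + 2:] - smult (of_real (a + b) + 2) [:1, -1:])" for a b :: real
    by simp
  from nonint show ?thesis
  proof
    assume *: "\<alpha> - \<alpha>' \<notin> \<int>"
    show ?thesis
      by (rule incompatible_jacobi_aux[OF P[unfolded t1]]) (use gt * in auto)
  next
    assume *: "\<beta> - \<beta>' \<notin> \<int>"
    show ?thesis
      by (rule incompatible_jacobi_aux[OF P[unfolded t2]]) (use gt * in auto)
  qed
qed

subsection \<open>Hermite test sequences\<close>

text \<open>Physicists' Hermite polynomials at \<open>x - c\<close>. Gaussian moments of powers obey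
  a three-term recurrence and have no rational ratio; these polynomials keep the derivative rule of
  powers and have moments proportional to \<open>(2 (b - c))^n\<close>.\<close>

fun shifted_hermite :: "complex \<Rightarrow> nat \<Rightarrow> complex poly" where
  "shifted_hermite c 0 = 1"
| "shifted_hermite c (Suc n) = [:- 2 * c, 2:] * shifted_hermite c n - pderiv (shifted_hermite c n)"

declare shifted_hermite.simps(2) [simp del]

lemma pderiv_shifted_hermite:
  "pderiv (shifted_hermite c (Suc n)) = smult (2 * of_nat (Suc n)) (shifted_hermite c n)"
proof (induction n)
  case 0
  show ?case by (simp add: shifted_hermite.simps(2) pderiv_pCons)
next
  case (Suc n)
  let ?h = "shifted_hermite c"
  have "pderiv (?h (Suc (Suc n))) = smult 2 (?h (Suc n)) + ([:- 2 * c, 2:] * pderiv (?h (Suc n)) - pderiv (pderiv (?h (Suc n))))"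
  proof -
    have "pderiv [:- 2 * c, 2:] = [:2:]" by (simp add: pderiv_pCons)
    then show ?thesis
      by (subst shifted_hermite.simps(2)) (simp only: pderiv_diff pderiv_mult, simp add: algebra_simps)
  qed
  also have "\<dots> = smult 2 (?h (Suc n)) + smult (2 * of_nat (Suc n)) (?h (Suc n))"
    unfolding Suc.IH
    by (simp only: pderiv_smult mult_smult_right smult_diff_right shifted_hermite.simps(2)[of c n])
  also have "\<dots> = smult (2 * of_nat (Suc (Suc n))) (?h (Suc n))"
    by (simp add: algebra_simps flip: smult_add_left)
  finally show ?case .
qed

lemma test_sequence_hermite:
  assumes "pearson_functional L 1 [:2 * b, -2:]" and "b \<noteq> c"
  shows "test_sequence L (shifted_hermite c) [:2 * (b - c):] 1"
proof -
  interpret pearson_functional L 1 "[:2 * b, -2:]" by fact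
  define h where "h = shifted_hermite c"
  have h_Suc: "h (Suc n) = [:- 2 * c, 2:] * h n - pderiv (h n)" for n
    by (simp add: h_def shifted_hermite.simps(2))
  have h_0: "h 0 = 1" by (simp add: h_def)
  have dh: "pderiv (h (Suc n)) = smult (2 * of_nat (Suc n)) (h n)" for n
    unfolding h_def by (rule pderiv_shifted_hermite)
  have M: "L (h (Suc n)) = 2 * (b - c) * L (h n)" for n
  proof -
    \<comment> \<open>The bracket is the Pearson expression at \<open>h n\<close>, so
      \<open>L\<close> kills it and the moments form a geometric sequence.\<close>
    have "h (Suc n) = smult (2 * (b - c)) (h n) - (1 * pderiv (h n) + [:2 * b, -2:] * h n)"
      unfolding h_Suc by (simp add: algebra_simps smult_diff_left flip: smult_add_left)
    then show ?thesis
      using pearson[of "h n"] by (simp only: L_diff L_smult) simp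
  qed
  interpret moment_ratio "\<lambda>n. L (h n)" "[:2 * (b - c):]" 1
    using assms(2) L_1_nonzero by unfold_locales (auto simp: M h_0)
  have "\<exists>P. \<forall>n. L (h n * p) = poly P (of_nat n) * L (h n)" for p
  proof (induction p)
    case 0
    show ?case by (intro exI[of _ 0]) simp
  next
    case (pCons d p)
    then obtain P where P: "\<And>n. L (h n * p) = poly P (of_nat n) * L (h n)" by blast
    \<comment> \<open>Write \<open>x = c + (2 x - 2 c) / 2\<close>, where multiplying
      \<open>h n\<close> by \<open>2 x - 2 c\<close> gives \<open>h (n + 1)\<close> plus
      \<open>2 n\<close> times \<open>h (n - 1)\<close>. The compositions evaluate \<open>P\<close>
      at the neighbouring indices, whose moments are multiples of \<open>L (h n)\<close>.\<close>
    define P' where "P' = [:d:] + smult (b - c) (pcompose P [:1, 1:]) + smult c P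
      + smult (1 / (2 * (b - c))) ([:0, 1:] * pcompose P [:-1, 1:])"
    have "L (h n * pCons d p) = poly P' (of_nat n) * L (h n)" for n
    proof -
      have "pCons d p = [:d:] + smult c p + smult (1/2) ([:- 2 * c, 2:] * p)"
        by (simp add: smult_diff_right)
      then have "h n * pCons d p = smult d (h n) + smult c (h n * p) + smult (1/2) ([:- 2 * c, 2:] * h n * p)"
        by (simp add: algebra_simps)
      also have "[:- 2 * c, 2:] * h n = h (Suc n) + pderiv (h n)"
        by (simp add: h_Suc)
      finally have "h n * pCons d p = smult d (h n) + smult c (h n * p) + smult (1/2) (h (Suc n) * p)
          + smult (1/2) (pderiv (h n) * p)"
        by (simp add: algebra_simps smult_add_right)
      then have *: "L (h n * pCons d p) = d * L (h n) + c * (poly P (of_nat n) * L (h n)) +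
          (b - c) * (poly P (of_nat n + 1) * L (h n)) + 1/2 * L (pderiv (h n) * p)"
        using P[of "Suc n"] by (simp only: L_add L_smult P M) (simp add: add.commute)
      \<comment> \<open>At \<open>n = 0\<close> the factor \<open>n\<close> removes the meaningless
        value of \<open>P\<close> at -1.\<close>
      have "1/2 * L (pderiv (h n) * p) = 1 / (2 * (b - c)) * (of_nat n * poly P (of_nat n - 1)) * L (h n)"
      proof (cases n)
        case 0
        then show ?thesis by (simp add: h_0)
      next
        case (Suc k)
        have "L (h k) = 1 / (2 * (b - c)) * L (h n)" using assms(2) by (simp add: Suc M)
        moreover have "1/2 * L (pderiv (h n) * p) = of_nat n * L (h k * p)"
          unfolding Suc dh by (simp only: mult_smult_left L_smult) simp
        moreover have "of_nat n - 1 = complex_of_nat k" by (simp add: Suc)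
        ultimately show ?thesis
          by (simp only: P) (simp only: mult_ac)
      qed
      then show ?thesis
        unfolding * P'_def by (simp add: poly_pcompose algebra_simps)
    qed
    then show ?case by blast
  qed
  then have "rational_multiple (\<lambda>n. L (h n)) (\<lambda>n. L (h n * p))" for p
    unfolding rational_multiple_def by (metis mult.right_neutral poly_1 zero_neq_one)
  then show ?thesis
    unfolding h_def[symmetric] by unfold_locales
qed

lemma incompatible_hermite:
  assumes "b \<noteq> b'"
  shows "incompatible (moment_functional UNIV (hermite_w b')) (moment_functional UNIV (hermite_w b))"
proof -
  \<comment> \<open>A common centre below both parameters, so that \<open>b - c\<close> and
    \<open>b' - c\<close> are nonzero.\<close>
  define c where "c = complex_of_real (min b b' - 1)"
  have c: "complex_of_real b \<noteq> c" "complex_of_real b' \<noteq> c"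
    unfolding c_def of_real_eq_iff by auto
  show ?thesis
  proof (rule incompatibleI[OF test_sequence_hermite[OF pearson_functional_hermite c(2)]
        test_sequence_hermite[OF pearson_functional_hermite c(1)] pderiv_shifted_hermite])
    fix K and e :: int
    show "\<not> slope (\<lambda>n. poly [:2 * (complex_of_real b - c):] (of_nat n) / poly 1 (of_nat n) /
        (poly [:2 * (complex_of_real b' - c):] (of_nat (n + K)) / poly 1 (of_nat (n + K)))) (of_int e)"
    proof
      assume "slope (\<lambda>n. poly [:2 * (complex_of_real b - c):] (of_nat n) / poly 1 (of_nat n) /
        (poly [:2 * (complex_of_real b' - c):] (of_nat (n + K)) / poly 1 (of_nat (n + K)))) (of_int e)"
      then have "slope (\<lambda>n. (complex_of_real b - c) / (complex_of_real b' - c)) (of_int e)"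
        by (simp del: right_diff_distrib_numeral)
      \<comment> \<open>A constant ratio other than 1 has no finite slope.\<close>
      then have "(complex_of_real b - c) / (complex_of_real b' - c) = 1" by (rule slope_const)
      then show False using assms c by (simp add: field_simps)
    qed
  qed auto
qed

subsection \<open>Row vectors of polynomials and the factor \<open>T = I + x A\<close>\<close>

definition rows_lt :: "nat \<Rightarrow> nat \<Rightarrow> (nat \<Rightarrow> complex poly) set" where
  "rows_lt N n = {f. \<forall>l<N. f l \<in> deg_lt n}"

definition unit_row :: "nat \<Rightarrow> complex poly \<Rightarrow> nat \<Rightarrow> complex poly" where
  "unit_row i f = (\<lambda>l. if l = i then f else 0)"

text \<open>Rows are functions on all naturals, of which only the entries below \<open>N\<close> are
  meaningful; the last clause makes the functional ignore the others.\<close>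

definition linear_functional :: "nat \<Rightarrow> ((nat \<Rightarrow> complex poly) \<Rightarrow> complex) \<Rightarrow> bool" where
  "linear_functional N \<phi> \<longleftrightarrow> (\<forall>f g. \<phi> (\<lambda>l. f l + g l) = \<phi> f + \<phi> g) \<and>
     (\<forall>c f. \<phi> (\<lambda>l. smult c (f l)) = c * \<phi> f) \<and> (\<forall>f g. (\<forall>l<N. f l = g l) \<longrightarrow> \<phi> f = \<phi> g)"

lemma
  assumes "linear_functional N \<phi>"
  shows linear_functional_add: "\<phi> (\<lambda>l. f l + g l) = \<phi> f + \<phi> g"
    and linear_functional_smult: "\<phi> (\<lambda>l. smult c (f l)) = c * \<phi> f"
    and linear_functional_cong: "(\<And>l. l < N \<Longrightarrow> f l = g l) \<Longrightarrow> \<phi> f = \<phi> g"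
  using assms unfolding linear_functional_def by auto

lemma linear_functional_sum:
  assumes "linear_functional N \<phi>" "finite I"
  shows "\<phi> (\<lambda>l. \<Sum>i\<in>I. smult (c i) (f i l)) = (\<Sum>i\<in>I. c i * \<phi> (f i))"
  using assms(2)
proof (induction I rule: finite_induct)
  case empty
  show ?case using linear_functional_smult[OF assms(1), of 0 "\<lambda>_. 0"] by simp
next
  case (insert i I)
  have "\<phi> (\<lambda>l. smult (c i) (f i l) + (\<Sum>i\<in>I. smult (c i) (f i l))) =
      c i * \<phi> (f i) + \<phi> (\<lambda>l. \<Sum>i\<in>I. smult (c i) (f i l))"
    by (simp only: linear_functional_add[OF assms(1)] linear_functional_smult[OF assms(1)])
  with insert show ?case by simp
qed

lemma rows_lt_diff: "f \<in> rows_lt N n \<Longrightarrow> g \<in> rows_lt N n \<Longrightarrow> (\<lambda>l. f l - g l) \<in> rows_lt N n"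
  and rows_lt_mono: "f \<in> rows_lt N n \<Longrightarrow> n \<le> n' \<Longrightarrow> f \<in> rows_lt N n'"
  by (auto simp: rows_lt_def intro: deg_lt_diff deg_lt_mono)

lemma unit_row_in_rows_lt: "f \<in> deg_lt n \<Longrightarrow> unit_row i f \<in> rows_lt N n"
  by (auto simp: rows_lt_def unit_row_def)

lemma exists_rows_lt: "\<exists>n. f \<in> rows_lt N n"
proof -
  have "f l \<in> deg_lt (Suc (\<Sum>l<N. degree (f l)))" if "l < N" for l
    using member_le_sum[of l "{..<N}" "\<lambda>l. degree (f l)"] that
    by (intro deg_lt_mono[OF deg_lt_degree]) auto
  then show ?thesis by (auto simp: rows_lt_def)
qed

text \<open>With indices from 0, the nonzero entries of \<open>A\<close> sit in even rows and odd
  columns. This pattern implies \<open>A^2 = 0\<close> and is the form in which that fact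
  enters.\<close>

locale matrix_weight =
  fixes N :: nat and A :: "nat \<Rightarrow> nat \<Rightarrow> complex" and L :: "nat \<Rightarrow> complex poly \<Rightarrow> complex"
  assumes pos: "l < N \<Longrightarrow> pos_functional (L l)"
    and A_parity: "A r s \<noteq> 0 \<Longrightarrow> even r \<and> odd s"
begin

definition Tmul :: "(nat \<Rightarrow> complex poly) \<Rightarrow> nat \<Rightarrow> complex poly" where
  "Tmul f l = f l + [:0, 1:] * (\<Sum>r<N. smult (A r l) (f r))"

definition Tinv :: "(nat \<Rightarrow> complex poly) \<Rightarrow> nat \<Rightarrow> complex poly" where
  "Tinv f l = f l - [:0, 1:] * (\<Sum>r<N. smult (A r l) (f r))"

lemma A_even: "even l \<Longrightarrow> A r l = 0"
  using A_parity by blast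

lemma Tmul_even: "even l \<Longrightarrow> Tmul f l = f l"
  and Tinv_even: "even l \<Longrightarrow> Tinv f l = f l"
  using A_even[of l] by (auto simp: Tmul_def Tinv_def)

text \<open>\<open>A^2 = 0\<close> in usable form: \<open>A\<close> reads only the even entries of a
  row, while \<open>Tmul\<close> and \<open>Tinv\<close> change only the odd ones. Hence the two
  maps are inverse to each other.\<close>

lemma A_smult_Tmul: "smult (A r l) (Tmul f r) = smult (A r l) (f r)"
  and A_smult_Tinv: "smult (A r l) (Tinv f r) = smult (A r l) (f r)"
  by (cases "A r l = 0", simp, simp add: A_parity Tmul_even Tinv_even)+

lemma Tinv_Tmul: "Tinv (Tmul f) = f"
  by (rule ext) (simp add: Tinv_def A_smult_Tmul, simp add: Tmul_def)

lemma Tmul_Tinv: "Tmul (Tinv f) = f"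
  by (rule ext) (simp add: Tmul_def A_smult_Tinv, simp add: Tinv_def)

lemma smult_sum_poly: "smult c (sum p I) = (\<Sum>i\<in>I. smult c (p i))"
  using sum_distrib_left[of "[:c:]" p I] by simp

lemma Tmul_add: "Tmul (\<lambda>l. f l + g l) = (\<lambda>l. Tmul f l + Tmul g l)"
  and Tinv_add: "Tinv (\<lambda>l. f l + g l) = (\<lambda>l. Tinv f l + Tinv g l)"
  by (rule ext, simp only: Tmul_def Tinv_def smult_add_right sum.distrib distrib_left, simp only: algebra_simps)+

lemma Tmul_smult: "Tmul (\<lambda>l. smult c (f l)) = (\<lambda>l. smult c (Tmul f l))"
proof -
  have "(\<Sum>r<N. smult (A r l) (smult c (f r))) = smult c (\<Sum>r<N. smult (A r l) (f r))" for l
    unfolding smult_sum_poly by (simp add: mult.commute)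
  then show ?thesis
    by (simp only: Tmul_def smult_add_right mult_smult_right fun_eq_iff simp_thms)
qed

lemma Tmul_cong: "(\<And>l. l < N \<Longrightarrow> f l = g l) \<Longrightarrow> l < N \<Longrightarrow> Tmul f l = Tmul g l"
  and Tinv_cong: "(\<And>l. l < N \<Longrightarrow> f l = g l) \<Longrightarrow> l < N \<Longrightarrow> Tinv f l = Tinv g l"
  by (auto simp: Tmul_def Tinv_def)

lemma Tmul_unit_row:
  assumes "r < N" shows "Tmul (unit_row r f) l = unit_row r f l + smult (A r l) ([:0, 1:] * f)"
proof -
  have "(\<Sum>q<N. smult (A q l) (unit_row r f q)) = (\<Sum>q<N. if q = r then smult (A r l) f else 0)"
    by (intro sum.cong) (auto simp: unit_row_def)
  also have "\<dots> = smult (A r l) f" using assms by simp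
  finally show ?thesis by (simp only: Tmul_def mult_smult_right)
qed

text \<open>The matrix inner product on single rows, with both factors \<open>T\<close> of the
  weight moved onto the rows so that only the diagonal functionals remain.\<close>

definition H :: "(nat \<Rightarrow> complex poly) \<Rightarrow> (nat \<Rightarrow> complex poly) \<Rightarrow> complex" where
  "H f g = (\<Sum>l<N. L l (Tmul f l * map_poly cnj (Tmul g l)))"

lemma L_add: "l < N \<Longrightarrow> L l (p + q) = L l p + L l q"
  and L_diff: "l < N \<Longrightarrow> L l (p - q) = L l p - L l q"
  and L_smult: "l < N \<Longrightarrow> L l (smult c p) = c * L l p"
  and L_0: "l < N \<Longrightarrow> L l 0 = 0"
  using pos_functional.L_add[OF pos] pos_functional.L_diff[OF pos] pos_functional.L_smult[OF pos]
    pos_functional.L_0[OF pos] by auto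

lemma H_add_left: "H (\<lambda>l. f l + g l) h = H f h + H g h"
  by (simp add: H_def Tmul_add algebra_simps L_add sum.distrib)

lemma H_smult_left: "H (\<lambda>l. smult c (f l)) h = c * H f h"
  by (simp add: H_def Tmul_smult L_smult sum_distrib_left)

lemma H_cong: "(\<And>l. l < N \<Longrightarrow> f l = f' l) \<Longrightarrow> (\<And>l. l < N \<Longrightarrow> g l = g' l) \<Longrightarrow> H f g = H f' g'"
  unfolding H_def by (intro sum.cong refl) (simp cong: Tmul_cong)

lemma H_commute: "H g f = cnj (H f g)"
proof -
  have "L l (Tmul g l * map_poly cnj (Tmul f l)) = cnj (L l (Tmul f l * map_poly cnj (Tmul g l)))" if "l < N" for l
    using pos_functional.L_cnj[OF pos[OF that], of "Tmul f l * map_poly cnj (Tmul g l)"] by (simp add: mult.commute)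
  then show ?thesis by (simp add: H_def)
qed

lemma H_add_right: "H h (\<lambda>l. f l + g l) = H h f + H h g"
  using H_add_left[of f g h] H_commute[of h f] H_commute[of h g] H_commute[of h "\<lambda>l. f l + g l"] by simp

lemma H_smult_right: "H h (\<lambda>l. smult c (f l)) = cnj c * H h f"
  using H_smult_left[of c f h] H_commute[of h f] H_commute[of h "\<lambda>l. smult c (f l)"] by simp

lemma H_diff_right: "H h (\<lambda>l. f l - g l) = H h f - H h g"
  using H_add_right[of h "\<lambda>l. f l - g l" g] by simp

lemma H_definite:
  assumes "H f f = 0" "l < N" shows "f l = 0"
proof -
  have "(\<Sum>l<N. Re (L l (Tmul f l * map_poly cnj (Tmul f l)))) = 0"
    using assms(1) unfolding H_def by (metis Re_sum zero_complex.sel(1))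
  moreover have "0 \<le> Re (L l (Tmul f l * map_poly cnj (Tmul f l)))" if "l < N" for l
    using pos_functional.L_nonneg[OF pos[OF that]] .
  ultimately have Re0: "Re (L l (Tmul f l * map_poly cnj (Tmul f l))) = 0" if "l < N" for l
    using that by (subst (asm) sum_nonneg_eq_0_iff) auto
  have T0: "Tmul f l = 0" if "l < N" for l
  proof -
    let ?p = "Tmul f l * map_poly cnj (Tmul f l)"
    \<comment> \<open>Nonnegativity speaks of real parts only; the imaginary part vanishes because
      \<open>?p\<close> equals its own conjugate.\<close>
    have "cnj (L l ?p) = L l ?p"
      using pos_functional.L_cnj[OF pos[OF that], of ?p] by (simp add: mult.commute)
    then have "Im (L l ?p) = 0" by (simp add: complex_eq_iff)
    then have "L l ?p = 0" using Re0[OF that] by (simp add: complex_eq_iff)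
    then show ?thesis using pos_functional.L_pos[OF pos[OF that]] by blast
  qed
  have "f l = Tinv (Tmul f) l" by (simp add: Tinv_Tmul)
  also have "\<dots> = Tinv (\<lambda>_. 0) l" by (rule Tinv_cong) (auto simp: T0 assms)
  finally show ?thesis by (simp add: Tinv_def)
qed

section \<open>Riesz representation on rows of bounded degree\<close>

definition riesz :: "(nat \<Rightarrow> complex poly) set \<Rightarrow> bool" where
  "riesz U \<longleftrightarrow> (\<forall>\<phi>. linear_functional N \<phi> \<longrightarrow> (\<exists>h\<in>U. \<forall>f\<in>U. \<phi> f = H f h))"

lemma linear_functional_H: "linear_functional N (\<lambda>f. H f g)"
  unfolding linear_functional_def using H_add_left H_smult_left H_cong by blast

text \<open>One Gram-Schmidt step: \<open>b'\<close> is \<open>b\<close> minus its projection to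
  \<open>U\<close>, and the representing vector gains a multiple of \<open>b'\<close>.\<close>

lemma riesz_extend:
  assumes U: "riesz U" "U \<subseteq> U'" "b \<in> U'"
    and add: "\<And>f g. f \<in> U \<Longrightarrow> g \<in> U \<Longrightarrow> (\<lambda>l. f l + g l) \<in> U" "\<And>f g. f \<in> U' \<Longrightarrow> g \<in> U' \<Longrightarrow> (\<lambda>l. f l + g l) \<in> U'"
    and scale: "\<And>c f. f \<in> U \<Longrightarrow> (\<lambda>l. smult c (f l)) \<in> U" "\<And>c f. f \<in> U' \<Longrightarrow> (\<lambda>l. smult c (f l)) \<in> U'"
    and span: "\<And>f. f \<in> U' \<Longrightarrow> \<exists>c. (\<lambda>l. f l - smult c (b l)) \<in> U"
  shows "riesz U'"
  unfolding riesz_def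
proof (intro allI impI)
  fix \<phi> assume \<phi>: "linear_functional N \<phi>"
  obtain p where p: "p \<in> U" "\<And>f. f \<in> U \<Longrightarrow> H f b = H f p"
    using U(1) linear_functional_H[of b] unfolding riesz_def by blast
  obtain h where h: "h \<in> U" "\<And>f. f \<in> U \<Longrightarrow> \<phi> f = H f h"
    using U(1) \<phi> unfolding riesz_def by blast
  define b' where "b' = (\<lambda>l. b l - p l)"
  have orth: "H f b' = 0" if "f \<in> U" for f
    using p(2)[OF that] by (simp add: b'_def H_diff_right)
  have b': "b' \<in> U'"
  proof -
    have "(\<lambda>l. b l + smult (-1) (p l)) \<in> U'"
      by (rule add(2)[OF U(3) scale(2)[OF subsetD[OF U(2) p(1)]]])
    then show ?thesis by (simp add: b'_def)
  qed
  have decomp: "\<exists>u\<in>U. \<exists>c. f = (\<lambda>l. u l + smult c (b' l))" if "f \<in> U'" for f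
  proof -
    obtain c where c: "(\<lambda>l. f l - smult c (b l)) \<in> U" using span[OF \<open>f \<in> U'\<close>] by blast
    have "(\<lambda>l. (f l - smult c (b l)) + smult c (p l)) \<in> U"
      using add(1)[OF c scale(1)[OF p(1)]] by simp
    then show ?thesis
      by (rule bexI[rotated]) (auto simp: b'_def smult_diff_right intro!: exI[of _ c])
  qed
  \<comment> \<open>Conjugated because \<open>H\<close> is antilinear in its second
    argument.\<close>
  define d where "d = cnj (\<phi> b' / H b' b')"
  define h' where "h' = (\<lambda>l. h l + smult d (b' l))"
  have h'U: "h' \<in> U'" 
    unfolding h'_def by (rule add(2)[OF subsetD[OF U(2) h(1)] scale(2)[OF b']])
  have "H b' h = 0" using orth[OF h(1)] H_commute[of b' h] by simp
  then have bb: "\<phi> b' = H b' h'"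
  proof (cases "H b' b' = 0")
    \<comment> \<open>This occurs if \<open>b\<close> already lies in \<open>U\<close>: then
      \<open>b'\<close> is zero in all entries below \<open>N\<close> and both sides vanish.\<close>
    case True
    then have z: "\<And>l. l < N \<Longrightarrow> b' l = 0" using H_definite by blast
    have "\<phi> b' = \<phi> (\<lambda>l. smult 0 (b' l))" using z by (intro linear_functional_cong[OF \<phi>]) auto
    also have "\<dots> = 0 * \<phi> b'" by (rule linear_functional_smult[OF \<phi>])
    finally have "\<phi> b' = 0" by simp
    moreover have "H b' h' = 0"
    proof -
      have "H b' h' = H (\<lambda>l. smult 0 (b' l)) h'" using z by (intro H_cong) auto
      also have "\<dots> = 0 * H b' h'" by (rule H_smult_left)
      finally show ?thesis by simp
    qed
    ultimately show ?thesis by simp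
  next
    case False
    then show ?thesis
      using \<open>H b' h = 0\<close> by (simp add: h'_def H_add_right H_smult_right d_def)
  qed
  show "\<exists>h\<in>U'. \<forall>f\<in>U'. \<phi> f = H f h"
  proof (intro bexI[OF _ h'U] ballI)
    fix f assume "f \<in> U'"
    then obtain u c where u: "u \<in> U" "f = (\<lambda>l. u l + smult c (b' l))" using decomp by blast
    have "\<phi> f = \<phi> u + c * \<phi> b'" 
      unfolding u(2) by (simp only: linear_functional_add[OF \<phi>] linear_functional_smult[OF \<phi>])
    also have "\<dots> = H u h' + c * H b' h'"
      using u(1) by (simp add: h bb h'_def H_add_right[of u] H_smult_right[of u] orth)
    also have "\<dots> = H f h'" unfolding u(2) by (simp add: H_add_left H_smult_left)
    finally show "\<phi> f = H f h'" .
  qed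
qed

text \<open>\<open>U n k\<close> allows degree \<open>n\<close> in the first \<open>k\<close>
  entries only, so raising the degree bound of a whole row splits into \<open>N\<close> extensions
  by a single vector.\<close>

lemma riesz_rows_lt: "riesz (rows_lt N n)"
proof -
  define U where "U n k = {f :: nat \<Rightarrow> complex poly. \<forall>l<N. f l \<in> deg_lt (if l < k then Suc n else n)}" for n k
  have cl: "\<And>f g. f \<in> U n k \<Longrightarrow> g \<in> U n k \<Longrightarrow> (\<lambda>l. f l + g l) \<in> U n k"
    "\<And>c f. f \<in> U n k \<Longrightarrow> (\<lambda>l. smult c (f l)) \<in> U n k" for n k
    unfolding U_def mem_Collect_eq by (blast intro: deg_lt_add deg_lt_smult)+
  have step: "riesz (U n k)" if "riesz (U n 0)" "k \<le> N" for n k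
    using that(2)
  proof (induction k)
    case (Suc k)
    show ?case
    proof (rule riesz_extend[of "U n k"])
      show "riesz (U n k)" using Suc by simp
      have "f l \<in> deg_lt (if l < Suc k then Suc n else n)"
        if "f l \<in> deg_lt (if l < k then Suc n else n)" for f :: "nat \<Rightarrow> complex poly" and l
        by (rule deg_lt_mono[OF that]) auto
      then show "U n k \<subseteq> U n (Suc k)" unfolding U_def by blast
      show "unit_row k (monom 1 n) \<in> U n (Suc k)"
        by (auto simp: U_def unit_row_def intro: monom_in_deg_lt)
      fix f assume f: "f \<in> U n (Suc k)"
      have "f k - smult (coeff (f k) n) (monom 1 n) \<in> deg_lt n"
      proof (rule deg_lt_if_lower[OF deg_lt_diff[OF _ deg_lt_smult[OF monom_in_deg_lt]]])
        show "f k \<in> deg_lt (Suc n)"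
          using f Suc.prems unfolding U_def mem_Collect_eq by (metis Suc_le_eq lessI)
      qed auto
      then have "(\<lambda>l. f l - smult (coeff (f k) n) (unit_row k (monom 1 n) l)) \<in> U n k"
        using f by (auto simp: U_def unit_row_def less_Suc_eq split: if_splits)
      then show "\<exists>c. (\<lambda>l. f l - smult c (unit_row k (monom 1 n) l)) \<in> U n k" by blast
    qed (auto intro: cl)
  qed (use that in simp)
  have "riesz (U n 0)"
  proof (induction n)
    case 0
    show ?case
      unfolding riesz_def
    proof (intro allI impI)
      fix \<phi> assume \<phi>: "linear_functional N \<phi>"
      have "\<phi> f = H f (\<lambda>_. 0)" if "f \<in> U 0 0" for f
      proof -
        have "\<phi> f = \<phi> (\<lambda>l. smult 0 (f l))"
          using that by (intro linear_functional_cong[OF \<phi>]) (simp add: U_def deg_lt_0_iff)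
        also have "\<dots> = 0 * \<phi> f" by (rule linear_functional_smult[OF \<phi>])
        finally have "\<phi> f = 0 * \<phi> f" .
        moreover have "H f (\<lambda>_. 0) = 0" using H_smult_right[of f 0 "\<lambda>_. 0"] by simp
        ultimately show ?thesis by simp
      qed
      then show "\<exists>h\<in>U 0 0. \<forall>f\<in>U 0 0. \<phi> f = H f h"
        by (intro bexI[of _ "\<lambda>_. 0"]) (auto simp: U_def)
    qed
  next
    case (Suc n)
    have "U (Suc n) 0 = U n N" by (auto simp: U_def)
    then show ?case using step[OF Suc, of N] by simp
  qed
  moreover have "U n 0 = rows_lt N n" by (auto simp: U_def rows_lt_def)
  ultimately show ?thesis by simp
qed

text \<open>Subtracting its projection from \<open>x^n\<close> in entry \<open>i\<close> leaves row
  \<open>i\<close> of a monic orthogonal matrix polynomial; this supplies the existence of such a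
  sequence.\<close>

lemma exists_orthogonal_row:
  assumes "i < N"
  shows "\<exists>h\<in>rows_lt N n. \<forall>u\<in>rows_lt N n. H u (\<lambda>l. unit_row i (monom 1 n) l - h l) = 0"
proof -
  obtain h where "h \<in> rows_lt N n" "\<And>u. u \<in> rows_lt N n \<Longrightarrow> H u (unit_row i (monom 1 n)) = H u h"
    using riesz_rows_lt[of n] linear_functional_H[of "unit_row i (monom 1 n)"] unfolding riesz_def by blast
  then show ?thesis by (auto simp: H_diff_right)
qed

end

subsection \<open>Matrix differential operators with an eigenbasis of orthogonal rows\<close>

lemma coeff_pcompose_shift:
  fixes p :: "complex poly"
  assumes "degree p \<le> d" shows "coeff (pcompose p [:1, 1:]) d = coeff p d"
proof (cases "degree p = d")
  case True
  have "degree (pcompose p [:1, 1:]) = degree p" by (simp add: degree_pcompose)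
  then show ?thesis using lead_coeff_comp[of "[:1, 1:]" p] True by simp
next
  case False
  then show ?thesis using assms by (simp add: coeff_eq_0 degree_pcompose)
qed

lemma has_top_diff_sum_mult:
  "has_top K (\<lambda>f. diff_sum (Suc K) G (p * f)) (p * G K)"
proof -
  obtain R where R: "diffop K R" "\<And>f. (pderiv ^^ K) (p * f) = p * (pderiv ^^ K) f + R f"
    using higher_pderiv_mult_top by blast
  have "diffop K (\<lambda>f. diff_sum K G (p * f))"
    using diffop_comp[OF diffop_diff_sum[of K G] diffop_mult[of p]] by simp
  then have "diffop K (\<lambda>f. R f * G K + diff_sum K G (p * f))"
    by (intro diffop_add diffop_mult_right R)
  moreover have "diff_sum (Suc K) G (p * f) = (pderiv ^^ K) (p * f) * G K + diff_sum K G (p * f)" for f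
    by (simp add: diff_sum_def)
  ultimately show ?thesis
    unfolding R(2) by (intro has_topI) (auto simp: algebra_simps)
qed

text \<open>\<open>p n i\<close> is row \<open>i\<close> of the orthogonal polynomial of degree
  \<open>n\<close>, \<open>F j r s\<close> is entry \<open>(r, s)\<close> of the coefficient of the
  \<open>j\<close>-th derivative, and \<open>p_eigen\<close> is row \<open>i\<close> of the
  eigenvalue equation.\<close>

locale matrix_operator = matrix_weight N A L
  for N :: nat and A :: "nat \<Rightarrow> nat \<Rightarrow> complex" and L :: "nat \<Rightarrow> complex poly \<Rightarrow> complex" +
  fixes K :: nat and F :: "nat \<Rightarrow> nat \<Rightarrow> nat \<Rightarrow> complex poly"
    and p :: "nat \<Rightarrow> nat \<Rightarrow> nat \<Rightarrow> complex poly" and \<Lambda> :: "nat \<Rightarrow> nat \<Rightarrow> nat \<Rightarrow> complex"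
  assumes p_deg: "i < N \<Longrightarrow> p n i \<in> rows_lt N (Suc n)"
    and p_monic: "i < N \<Longrightarrow> l < N \<Longrightarrow> coeff (p n i l) n = (if i = l then 1 else 0)"
    and p_orth: "i < N \<Longrightarrow> u \<in> rows_lt N n \<Longrightarrow> H (p n i) u = 0"
    and p_eigen: "i < N \<Longrightarrow> s < N \<Longrightarrow>
      (\<Sum>l<N. diff_sum (Suc K) (\<lambda>j. F j l s) (p n i l)) = (\<Sum>q<N. smult (\<Lambda> n i q) (p n q s))"
begin

definition act :: "(nat \<Rightarrow> complex poly) \<Rightarrow> nat \<Rightarrow> complex poly" where
  "act f s = (\<Sum>l<N. diff_sum (Suc K) (\<lambda>j. F j l s) (f l))"

lemma act_add: "act (\<lambda>l. f l + g l) = (\<lambda>l. act f l + act g l)"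
  by (simp add: act_def diff_sum_add sum.distrib fun_eq_iff)

lemma act_smult: "act (\<lambda>l. smult c (f l)) = (\<lambda>l. smult c (act f l))"
  by (simp add: act_def diff_sum_smult smult_sum_poly fun_eq_iff)

lemma act_cong: "(\<And>l. l < N \<Longrightarrow> f l = g l) \<Longrightarrow> act f = act g"
  by (simp add: act_def fun_eq_iff)

lemma diff_sum_0: "diff_sum J G 0 = 0"
  by (simp add: diff_sum_def)

lemma act_unit_row: "r < N \<Longrightarrow> act (unit_row r f) s = diff_sum (Suc K) (\<lambda>j. F j r s) f"
proof -
  assume r: "r < N"
  have "act (unit_row r f) s = (\<Sum>l<N. if l = r then diff_sum (Suc K) (\<lambda>j. F j r s) f else 0)"
    unfolding act_def by (intro sum.cong) (auto simp: unit_row_def diff_sum_0)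
  then show ?thesis using r by simp
qed

lemma linear_functional_act: "linear_functional N (\<lambda>f. H (act f) g - H f h)"
  unfolding linear_functional_def
proof (intro conjI allI impI)
  fix f f' :: "nat \<Rightarrow> complex poly"
  assume "\<forall>l<N. f l = f' l"
  then have "act f = act f'" "H f h = H f' h" by (auto intro: act_cong H_cong)
  then show "H (act f) g - H f h = H (act f') g - H f' h" by simp
qed (simp_all add: act_add act_smult H_add_left H_smult_left algebra_simps)

lemma rows_lt_SucE:
  assumes "f \<in> rows_lt N (Suc n)"
  obtains g c where "g \<in> rows_lt N n" "\<And>l. l < N \<Longrightarrow> f l = (\<Sum>i<N. smult (c i) (p n i l)) + g l"
proof
  let ?c = "\<lambda>i. coeff (f i) n"
  let ?g = "\<lambda>l. f l - (\<Sum>i<N. smult (?c i) (p n i l))"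
  show "f l = (\<Sum>i<N. smult (?c i) (p n i l)) + ?g l" for l by simp
  have "?g l \<in> deg_lt n" if "l < N" for l
  proof (rule deg_lt_if_lower)
    show "?g l \<in> deg_lt (Suc n)"
      using assms p_deg that by (intro deg_lt_diff deg_lt_sum deg_lt_smult) (auto simp: rows_lt_def)
    have "(\<Sum>i<N. ?c i * coeff (p n i l) n) = (\<Sum>i<N. if i = l then ?c l else 0)"
      using that by (intro sum.cong) (auto simp: p_monic)
    then show "coeff (?g l) n = 0" using that by (simp add: coeff_sum)
  qed
  then show "?g \<in> rows_lt N n" by (simp add: rows_lt_def)
qed

lemma functional_eq_0_if_zero_on_basis:
  assumes D: "linear_functional N D" and zero: "\<And>n i. i < N \<Longrightarrow> D (p n i) = 0"
  shows "D f = 0"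
proof -
  have "\<forall>f\<in>rows_lt N n. D f = 0" for n
  proof (induction n)
    case 0
    show ?case
    proof
      fix f assume "f \<in> rows_lt N 0"
      then have "D f = D (\<lambda>l. smult 0 (f l))"
        by (intro linear_functional_cong[OF D]) (simp add: rows_lt_def deg_lt_0_iff)
      also have "\<dots> = 0 * D f" by (rule linear_functional_smult[OF D])
      finally show "D f = 0" by simp
    qed
  next
    case (Suc n)
    show ?case
    proof
      fix f assume "f \<in> rows_lt N (Suc n)"
      then obtain g c where g: "g \<in> rows_lt N n" and fl: "\<And>l. l < N \<Longrightarrow> f l = (\<Sum>i<N. smult (c i) (p n i l)) + g l"
        by (rule rows_lt_SucE) blast
      have "D f = D (\<lambda>l. (\<Sum>i<N. smult (c i) (p n i l)) + g l)"
        by (intro linear_functional_cong[OF D] fl)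
      also have "\<dots> = (\<Sum>i<N. c i * D (p n i)) + D g"
        by (simp add: linear_functional_add[OF D] linear_functional_sum[OF D])
      also have "\<dots> = 0" using Suc.IH g zero by simp
      finally show "D f = 0" .
    qed
  qed
  then show ?thesis using exists_rows_lt by blast
qed

lemma H_sum_left: "H (\<lambda>l. \<Sum>i<N. smult (c i) (f i l)) g = (\<Sum>i<N. c i * H (f i) g)"
  by (rule linear_functional_sum[OF linear_functional_H finite_lessThan])

lemma act_p: "i < N \<Longrightarrow> s < N \<Longrightarrow> act (p n i) s = (\<Sum>q<N. smult (\<Lambda> n i q) (p n q s))"
  by (simp add: act_def p_eigen)

lemma act_rows_lt: "f \<in> rows_lt N n \<Longrightarrow> act f \<in> rows_lt N n"
proof (induction n arbitrary: f)
  case 0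
  then have "act f = act (\<lambda>_. 0)" by (intro act_cong) (simp add: rows_lt_def deg_lt_0_iff)
  then show ?case by (simp add: act_def diff_sum_0 rows_lt_def)
next
  case (Suc n)
  from Suc.prems obtain g c where g: "g \<in> rows_lt N n"
    and fl: "\<And>l. l < N \<Longrightarrow> f l = (\<Sum>i<N. smult (c i) (p n i l)) + g l"
    by (rule rows_lt_SucE) blast
  have "act f = act (\<lambda>l. (\<Sum>i<N. smult (c i) (p n i l)) + g l)"
    by (intro act_cong fl)
  also have "\<dots> = (\<lambda>s. (\<Sum>i<N. smult (c i) (act (p n i) s)) + act g s)"
  proof -
    have "act (\<lambda>l. \<Sum>i\<in>I. smult (c i) (p n i l)) = (\<lambda>s. \<Sum>i\<in>I. smult (c i) (act (p n i) s))" if "finite I" for I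
      using that
    proof (induction I rule: finite_induct)
      case empty
      then show ?case by (simp add: act_def diff_sum_0)
    next
      case (insert i I)
      then show ?case by (simp add: act_add act_smult)
    qed
    then show ?thesis by (simp add: act_add)
  qed
  finally have eq: "act f = (\<lambda>s. (\<Sum>i<N. smult (c i) (act (p n i) s)) + act g s)" .
  have "act g \<in> rows_lt N n" by (rule Suc.IH[OF g])
  moreover have "act (p n i) s \<in> deg_lt (Suc n)" if "i < N" "s < N" for i s
    using that p_deg by (simp add: act_p) (intro deg_lt_sum deg_lt_smult, auto simp: rows_lt_def)
  ultimately show ?case
    unfolding eq by (auto simp: rows_lt_def intro!: deg_lt_add deg_lt_sum deg_lt_smult intro: deg_lt_mono)
qed

text \<open>Riesz on \<open>rows_lt N n\<close> fixes \<open>h\<close>. For \<open>m \<ge> n\<close>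
  the rows \<open>p m i\<close> and their images are orthogonal to both \<open>g\<close> and
  \<open>h\<close>, so the identity extends to the whole basis.\<close>

lemma adjoint_exists: "\<exists>h. (\<forall>n. g \<in> rows_lt N n \<longrightarrow> h \<in> rows_lt N n) \<and> (\<forall>f. H (act f) g = H f h)"
proof -
  \<comment> \<open>Minimality puts \<open>h\<close> into every \<open>rows_lt\<close> that contains
    \<open>g\<close>, so a single \<open>h\<close> respects all degree bounds.\<close>
  define n where "n = (LEAST n. g \<in> rows_lt N n)"
  have g: "g \<in> rows_lt N n" unfolding n_def using exists_rows_lt by (rule LeastI_ex)
  have "linear_functional N (\<lambda>f. H (act f) g)"
    using linear_functional_act[of g "\<lambda>_. 0"] H_smult_right[of _ 0 "\<lambda>_. 0"] by simp
  then obtain h where h: "h \<in> rows_lt N n" "\<And>f. f \<in> rows_lt N n \<Longrightarrow> H (act f) g = H f h"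
    using riesz_rows_lt[of n] unfolding riesz_def by blast
  have "H (act f) g - H f h = 0" for f
  proof (rule functional_eq_0_if_zero_on_basis[OF linear_functional_act])
    fix m i assume i: "i < N"
    show "H (act (p m i)) g - H (p m i) h = 0"
    proof (cases "m < n")
      case True
      then have "p m i \<in> rows_lt N n" by (intro rows_lt_mono[OF p_deg[OF i]]) auto
      then show ?thesis by (simp add: h)
    next
      case False
      then have gm: "g \<in> rows_lt N m" "h \<in> rows_lt N m" using g h(1) rows_lt_mono by auto
      have "H (act (p m i)) g = H (\<lambda>s. \<Sum>q<N. smult (\<Lambda> m i q) (p m q s)) g"
        using i by (intro H_cong) (auto simp: act_p)
      also have "\<dots> = 0" using p_orth gm by (simp add: H_sum_left)
      finally show ?thesis using p_orth[OF i gm(2)] by simp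
    qed
  qed
  moreover have "h \<in> rows_lt N n'" if "g \<in> rows_lt N n'" for n'
    using h(1) Least_le[of "\<lambda>n. g \<in> rows_lt N n" n'] that unfolding n_def by (blast intro: rows_lt_mono)
  ultimately show ?thesis by auto
qed

definition E :: "(nat \<Rightarrow> complex poly) \<Rightarrow> nat \<Rightarrow> complex poly" where
  "E f = Tmul (act (Tinv f))"

lemma diffop_E: "diffop (Suc K) (\<lambda>f. E (unit_row i f) j)"
proof -
  have Ti: "diffop (Suc 0) (\<lambda>f. Tinv (unit_row i f) l)" for l
  proof -
    have u: "diffop (Suc 0) (\<lambda>f. unit_row i f l)" for l
      using diffop_mult[of 1] diffop_zero[of "Suc 0"] by (cases "l = i") (auto simp: unit_row_def)
    show ?thesis
      unfolding Tinv_def by (intro diffop_diff diffop_mult_left diffop_sum diffop_smult u)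
  qed
  have "diffop (Suc K) (\<lambda>f. diff_sum (Suc K) G (Tinv (unit_row i f) l))" for l G
    using diffop_comp[OF diffop_diff_sum[of "Suc K" G] Ti[of l]] by simp
  then have a: "diffop (Suc K) (\<lambda>f. act (Tinv (unit_row i f)) l)" for l
    unfolding act_def by (intro diffop_sum)
  show ?thesis
    unfolding E_def Tmul_def by (intro diffop_add diffop_mult_left diffop_sum diffop_smult a)
qed

lemma H_Tinv: "H (act (Tinv f)) g = (\<Sum>l<N. L l (E f l * map_poly cnj (Tmul g l)))"
  by (simp add: H_def E_def)

lemma single_sum_unit_row:
  assumes "i < N"
  shows "(\<Sum>l<N. L l (unit_row i f l * g l)) = L i (f * g i)" "(\<Sum>l<N. L l (g l * unit_row i f l)) = L i (g i * f)"
proof -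
  have "(\<Sum>l<N. L l (unit_row i f l * g l)) = (\<Sum>l<N. if l = i then L i (f * g i) else 0)"
    by (intro sum.cong) (auto simp: unit_row_def L_0)
  then show 1: "(\<Sum>l<N. L l (unit_row i f l * g l)) = L i (f * g i)" using assms by simp
  then show "(\<Sum>l<N. L l (g l * unit_row i f l)) = L i (g i * f)" by (simp add: mult.commute)
qed

text \<open>Applying \<open>Tinv\<close> to unit rows in both arguments collapses each side of the
  adjoint identity to one term. No degree bound is claimed for \<open>h\<close>, since
  \<open>Tinv\<close> may raise degrees.\<close>

lemma E_adjoint_entry:
  assumes "i < N" "j < N"
  shows "\<exists>h. \<forall>f. L j (E (unit_row i f) j * g) = L i (f * h)"
proof -
  obtain h where h: "\<And>f. H (act f) (Tinv (unit_row j (map_poly cnj g))) = H f h"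
    using adjoint_exists by blast
  have cu: "map_poly cnj (unit_row j (map_poly cnj g) l) = unit_row j g l" for l
    by (simp add: unit_row_def)
  have "L j (E (unit_row i f) j * g) = L i (f * map_poly cnj (Tmul h i))" for f
    using h[of "Tinv (unit_row i f)"]
    unfolding H_Tinv Tmul_Tinv cu single_sum_unit_row(2)[OF assms(2)]
    unfolding H_def Tmul_Tinv single_sum_unit_row(1)[OF assms(1)] .
  then show ?thesis by blast
qed

lemma E_add: "E (\<lambda>l. f l + g l) = (\<lambda>l. E f l + E g l)"
  by (simp add: E_def Tinv_add act_add Tmul_add)

lemma E_cong: "(\<And>l. l < N \<Longrightarrow> f l = g l) \<Longrightarrow> E f = E g"
proof -
  assume "\<And>l. l < N \<Longrightarrow> f l = g l"
  then have "act (Tinv f) = act (Tinv g)" by (intro act_cong Tinv_cong)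
  then show "E f = E g" by (simp add: E_def)
qed

lemma E_expand: "E f = (\<lambda>j. \<Sum>i<N. E (unit_row i (f i)) j)"
proof -
  have "E (\<lambda>l. \<Sum>i\<in>I. unit_row i (f i) l) = (\<lambda>j. \<Sum>i\<in>I. E (unit_row i (f i)) j)" if "finite I" for I
    using that
  proof (induction I rule: finite_induct)
    case empty
    then show ?case by (simp add: E_def Tinv_def[abs_def] Tmul_def[abs_def] act_def diff_sum_0)
  next
    case (insert i I)
    then show ?case by (simp add: E_add)
  qed
  moreover have "E f = E (\<lambda>l. \<Sum>i<N. unit_row i (f i) l)"
    by (rule E_cong) (simp add: unit_row_def)
  ultimately show ?thesis by simp
qed

end

section \<open>Diagonal entries and their comparison\<close>

locale diagonal_operator = matrix_operator N A L K F p \<Lambda>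
  for N :: nat and A L K F p \<Lambda> +
  assumes incomp: "i < N \<Longrightarrow> j < N \<Longrightarrow> i \<noteq> j \<Longrightarrow> incompatible (L i) (L j)"
begin

lemma E_off_diagonal:
  assumes "i < N" "j < N" "i \<noteq> j" shows "E (unit_row i f) j = 0"
proof -
  obtain \<psi> where "\<forall>f g. L j (E (unit_row i f) j * g) = L i (f * \<psi> g)"
    using E_adjoint_entry[OF assms(1,2)] by metis
  with incomp[OF assms] diffop_E[of i j] show ?thesis
    unfolding incompatible_def by blast
qed

definition G :: "nat \<Rightarrow> nat \<Rightarrow> complex poly" where
  "G l = (SOME g. (\<lambda>f. E (unit_row l f) l) = diff_sum (Suc K) g)"

definition e :: "nat \<Rightarrow> complex poly \<Rightarrow> complex poly" where
  "e l = diff_sum (Suc K) (G l)"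

lemma E_unit_row_self: "E (unit_row l f) l = e l f"
proof -
  have "(\<lambda>f. E (unit_row l f) l) = diff_sum (Suc K) (G l)"
    unfolding G_def using diffop_E[of l l] unfolding diffop_def by (rule someI_ex)
  then show ?thesis by (simp add: e_def fun_eq_iff)
qed

lemma E_eq: "l < N \<Longrightarrow> E f l = e l (f l)"
proof -
  assume l: "l < N"
  have "E f l = (\<Sum>i<N. if i = l then e l (f l) else 0)"
    unfolding E_expand[of f] using l by (intro sum.cong) (auto simp: E_unit_row_self E_off_diagonal)
  then show ?thesis using l by simp
qed

text \<open>Undoing the conjugation: as \<open>A^2 = 0\<close>, only the diagonal entry and its
  neighbours under \<open>A\<close> survive. Degree bounds for \<open>act\<close> thereby become
  degree bounds for the expressions on the right.\<close>

lemma act_unit_row_eq: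
  assumes "r < N" "l < N"
  shows "act (unit_row r f) l = (if l = r then e r f else smult (A r l) (e l ([:0, 1:] * f) - [:0, 1:] * e r f))"
proof -
  have e0: "e q 0 = 0" for q by (simp add: e_def diff_sum_0)
  have "act (unit_row r f) = Tinv (E (Tmul (unit_row r f)))"
    by (simp add: E_def Tinv_Tmul)
  then have 1: "act (unit_row r f) l = e l (Tmul (unit_row r f) l) -
      [:0, 1:] * (\<Sum>q<N. smult (A q l) (e q (Tmul (unit_row r f) q)))"
    unfolding Tinv_def using assms by (simp add: E_eq)
  have "smult (A q l) (e q (Tmul (unit_row r f) q)) = (if q = r then smult (A r l) (e r f) else 0)" for q
  proof (cases "A q l = 0")
    case False
    then have "even q" using A_parity by blast
    then show ?thesis by (simp add: Tmul_even unit_row_def e0)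
  qed auto
  then have 2: "(\<Sum>q<N. smult (A q l) (e q (Tmul (unit_row r f) q))) = smult (A r l) (e r f)"
    using assms by simp
  have "A r r = 0" using A_parity[of r r] by blast
  then show ?thesis
    unfolding 1 2 unfolding Tmul_unit_row[OF assms(1)]
    by (auto simp: unit_row_def e_def diff_sum_smult smult_diff_right simp del: mult_pCons_left mult_pCons_right)
qed

lemma e_deg_lt:
  assumes "l < N" "f \<in> deg_lt n" shows "e l f \<in> deg_lt n"
  using act_rows_lt[OF unit_row_in_rows_lt[OF assms(2), of l]] act_unit_row_eq[OF assms(1,1), of f] assms(1)
  unfolding rows_lt_def by force

lemma e_neighbour_deg_lt:
  assumes "r < N" "l < N" "A r l \<noteq> 0" "f \<in> deg_lt n"
  shows "e l ([:0, 1:] * f) - [:0, 1:] * e r f \<in> deg_lt n"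
proof -
  have "l \<noteq> r" using A_parity[OF assms(3)] by blast
  then have "smult (A r l) (e l ([:0, 1:] * f) - [:0, 1:] * e r f) \<in> deg_lt n"
    using act_rows_lt[OF unit_row_in_rows_lt[OF assms(4), of r]] act_unit_row_eq[OF assms(1,2), of f] assms(2)
    unfolding rows_lt_def by force
  from deg_lt_smult[OF this, of "1 / A r l"] assms(3) show ?thesis by simp
qed

text \<open>Testing with \<open>unit_row l\<close> itself, rather than with its image under
  \<open>Tinv\<close> as in \<open>E_adjoint_entry\<close>, keeps degrees. The price is an extra
  term in \<open>Tmul h l\<close> for odd \<open>l\<close>; it vanishes because
  \<open>Tmul ?u r\<close> is zero at the even neighbours \<open>r\<close>, which makes
  \<open>h r\<close> orthogonal to everything.\<close>

lemma e_adjoint: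
  assumes l: "l < N"
  shows "\<exists>C'. (\<forall>n. \<forall>f\<in>deg_lt n. C' f \<in> deg_lt n) \<and> (\<forall>f g. L l (e l f * g) = L l (f * C' g))"
proof -
  have "\<exists>h. (\<forall>n. g \<in> deg_lt n \<longrightarrow> h \<in> deg_lt n) \<and> (\<forall>f. L l (e l f * g) = L l (f * h))" for g
  proof -
    let ?u = "unit_row l (map_poly cnj g)"
    obtain h where h: "\<And>n. ?u \<in> rows_lt N n \<Longrightarrow> h \<in> rows_lt N n" "\<And>f. H (act f) ?u = H f h"
      using adjoint_exists by blast
    have L: "L r (e r f * map_poly cnj (Tmul ?u r)) = L r (f * map_poly cnj (Tmul h r))" if r: "r < N" for r f
    proof -
      have "(\<Sum>q<N. L q (E (unit_row r f) q * map_poly cnj (Tmul ?u q))) =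
          (\<Sum>q<N. L q (unit_row r (e r f) q * map_poly cnj (Tmul ?u q)))"
        using r by (intro sum.cong refl) (auto simp: E_eq unit_row_def e_def diff_sum_0)
      then show ?thesis
        using h(2)[of "Tinv (unit_row r f)"]
        unfolding H_Tinv unfolding H_def Tmul_Tinv single_sum_unit_row(1)[OF r] by simp
    qed
    have "Tmul h l = h l"
    proof (cases "even l")
      case True
      then show ?thesis by (rule Tmul_even)
    next
      case False
      have "smult (A r l) (h r) = 0" if r: "r < N" for r
      proof (cases "A r l = 0")
        case False
        then have r': "even r" "r \<noteq> l" using A_parity by blast+
        have "A l r = 0" using \<open>even r\<close> by (rule A_even)
        then have "Tmul ?u r = 0" using r' by (simp add: Tmul_even unit_row_def)
        then have "L r (map_poly cnj (h r) * q) = 0" for q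
          using L[OF r, of q] r by (simp add: Tmul_even[OF r'(1)] L_0 mult.commute)
        then have "map_poly cnj (h r) = 0"
          by (rule pos_functional.nondegenerate[OF pos[OF r]])
        then have "map_poly cnj (map_poly cnj (h r)) = 0" by simp
        then show ?thesis by simp
      qed simp
      then have "(\<Sum>r<N. smult (A r l) (h r)) = 0" by (intro sum.neutral) auto
      then show ?thesis by (simp add: Tmul_def)
    qed
    moreover have "Tmul ?u l = map_poly cnj g"
    proof -
      have "A l l = 0" using A_parity[of l l] by blast
      then show ?thesis unfolding Tmul_unit_row[OF l] by (simp add: unit_row_def)
    qed
    ultimately have "L l (e l f * g) = L l (f * map_poly cnj (h l))" for f
      using L[OF l, of f] by simp
    moreover have "map_poly cnj (h l) \<in> deg_lt n" if "g \<in> deg_lt n" for n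
      using h(1)[OF unit_row_in_rows_lt[OF deg_lt_cnj[OF that]]] l by (auto simp: rows_lt_def intro: deg_lt_cnj)
    ultimately show ?thesis by blast
  qed
  then obtain C' where "\<And>g. (\<forall>n. g \<in> deg_lt n \<longrightarrow> C' g \<in> deg_lt n) \<and> (\<forall>f. L l (e l f * g) = L l (f * C' g))"
    by metis
  then show ?thesis by blast
qed

text \<open>At \<open>f = x^n\<close> the degree bound kills the coefficient of
  \<open>x^(n+1)\<close> in \<open>e l ([:0, 1:] * f) - [:0, 1:] * e r f\<close>. This equates the
  two polynomials at every natural number.\<close>

lemma eigen_poly_neighbour:
  assumes "r < N" "l < N" "A r l \<noteq> 0"
  shows "pcompose (eigen_poly K (G l)) [:1, 1:] = eigen_poly K (G r)"
proof -
  have "poly (pcompose (eigen_poly K (G l)) [:1, 1:] - eigen_poly K (G r)) (of_nat (n + 0)) = 0" for n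
  proof -
    have x: "[:0, 1:] * monom 1 n = monom (1 :: complex) (Suc n)" by (simp add: monom_Suc)
    have "e l (monom 1 (Suc n)) - [:0, 1:] * e r (monom 1 n) \<in> deg_lt (Suc n)"
      using e_neighbour_deg_lt[OF assms monom_in_deg_lt[of n "Suc n" 1]] unfolding x by simp
    then have "coeff (e l (monom 1 (Suc n))) (Suc n) = coeff ([:0, 1:] * e r (monom 1 n)) (Suc n)"
      unfolding deg_lt_def by (metis (mono_tags, lifting) coeff_diff eq_iff_diff_eq_0 mem_Collect_eq order_refl)
    then have "poly (eigen_poly K (G l)) (of_nat (Suc n)) = poly (eigen_poly K (G r)) (of_nat n)"
      by (simp add: e_def coeff_diff_sum_monom del: of_nat_Suc)
    then show ?thesis by (simp add: poly_pcompose)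
  qed
  then have "pcompose (eigen_poly K (G l)) [:1, 1:] - eigen_poly K (G r) = 0"
    by (rule poly_eq_0_if_nat_roots)
  then show ?thesis by simp
qed

lemma leading_coefficients:
  assumes K: "K = 2 * m" and lead: "\<And>l. l < N \<Longrightarrow> leading_from_eigenvalues (L l) m d k \<rho>"
    and A_chain: "\<And>l. Suc l < N \<Longrightarrow> A l (Suc l) \<noteq> 0 \<or> A (Suc l) l \<noteq> 0"
  shows "\<exists>c. \<forall>r<N. \<forall>s<N. F K r s = (if r = s then smult c (\<rho> ^ m) else 0)"
proof -
  have G: "degree (eigen_poly K (G l)) \<le> d \<and> G l K = smult (coeff (eigen_poly K (G l)) d * k) (\<rho> ^ m)" if l: "l < N" for l
  proof -
    obtain C' where C': "\<And>n f. f \<in> deg_lt n \<Longrightarrow> C' f \<in> deg_lt n" "\<And>f g. L l (e l f * g) = L l (f * C' g)"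
      using e_adjoint[OF l] by blast
    have "\<And>n f. f \<in> deg_lt n \<Longrightarrow> e l f \<in> deg_lt n" using e_deg_lt[OF l] .
    with C' lead[OF l] show ?thesis
      unfolding leading_from_eigenvalues_def K[symmetric] e_def by blast
  qed
  have neighbour: "G r K = G l K" if "r < N" "l < N" "A r l \<noteq> 0" for r l
  proof -
    \<comment> \<open>Shifting the argument by one leaves the coefficient at \<open>d\<close>
      unchanged because \<open>d\<close> bounds the degree.\<close>
    have "coeff (eigen_poly K (G r)) d = coeff (eigen_poly K (G l)) d"
      unfolding eigen_poly_neighbour[OF that, symmetric]
      using G[OF that(2)] by (intro coeff_pcompose_shift) blast
    then show ?thesis using G[OF that(1)] G[OF that(2)] by metis
  qed
  have const: "l < N \<Longrightarrow> G l K = G 0 K" for l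
  proof (induction l)
    case (Suc l)
    then show ?case using A_chain[of l] neighbour[of l "Suc l"] neighbour[of "Suc l" l] by auto
  qed simp
  define c where "c = coeff (eigen_poly K (G 0)) d * k"
  have F: "F K r s = (if r = s then G r K else 0)" if "r < N" "s < N" for r s
  \<comment> \<open>The same entry of the operator is written through \<open>F\<close> and through
    the diagonal operators, and the two leading coefficients are compared.\<close>
  proof (rule has_top_unique[where K=K and \<phi>="\<lambda>f. act (unit_row r f) s"])
    show "has_top K (\<lambda>f. act (unit_row r f) s) (F K r s)"
      using has_top_diff_sum[of K "\<lambda>j. F j r s"] by (simp add: act_unit_row[OF that(1)] )
    show "has_top K (\<lambda>f. act (unit_row r f) s) (if r = s then G r K else 0)"
    proof (cases "r = s")
      case True
      then show ?thesis
        using has_top_diff_sum[of K "G r"]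
        unfolding e_def[symmetric] True[symmetric] by (simp add: act_unit_row_eq[OF that(1,1)])
    next
      case False
      obtain R where R: "diffop K R" "\<And>f. diff_sum (Suc K) (G r) f = (pderiv ^^ K) f * G r K + R f"
        using has_top_diff_sum[of K "G r"] unfolding has_top_def by blast
      have "has_top K (\<lambda>f. smult (-1) ([:0, 1:] * e r f)) (smult (-1) ([:0, 1:] * G r K))"
        unfolding e_def
        by (intro has_top_smult has_topI[OF diffop_mult_left[OF R(1), of "[:0, 1:]"]])
           (simp only: R distrib_left mult.left_commute)
      from has_top_smult[OF has_top_add[OF has_top_diff_sum_mult[of K "G s" "[:0, 1:]"] this], of "A r s"]
      have "has_top K (\<lambda>f. smult (A r s) (e s ([:0, 1:] * f) - [:0, 1:] * e r f))
          (smult (A r s) ([:0, 1:] * G s K - [:0, 1:] * G r K))"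
        by (simp add: e_def del: mult_pCons_left mult_pCons_right)
      \<comment> \<open>Off the diagonal the two leading terms carry the same factor
        \<open>[:0, 1:]\<close>, so they cancel.\<close>
      moreover have "G s K = G r K" 
        by (rule trans[OF const[OF that(2)] const[OF that(1), symmetric]])
      ultimately show ?thesis
        using False by (simp add: act_unit_row_eq[OF that] del: mult_pCons_left mult_pCons_right)
    qed
  qed
  have "G r K = smult c (\<rho> ^ m)" if "r < N" for r
    using const[OF that] G[of 0] that by (cases "N = 0") (auto simp: c_def)
  with F show ?thesis by auto
qed

end

subsection \<open>The matrix weight\<close>

definition A_entry :: "(nat \<Rightarrow> real) \<Rightarrow> nat \<Rightarrow> nat \<Rightarrow> complex" where
  "A_entry a r s = (if s = r + 1 \<and> odd (r + 1) then complex_of_real (a (r + 1))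
     else if r = s + 1 \<and> even (s + 1) then complex_of_real (a (s + 1)) else 0)"

lemma A_entry_parity: "A_entry a r s \<noteq> 0 \<Longrightarrow> even r \<and> odd s"
  by (auto simp: A_entry_def split: if_splits)

lemma A_entry_neighbour:
  assumes "a (Suc l) \<noteq> 0" shows "A_entry a l (Suc l) \<noteq> 0 \<or> A_entry a (Suc l) l \<noteq> 0"
  using assms by (cases "even l") (auto simp: A_entry_def)

lemma dim_cmat_star [simp]: "dim_row (cmat_star M) = dim_col M" "dim_col (cmat_star M) = dim_row M"
  by (simp_all add: cmat_star_def)

lemma cmat_star_carrier: "M \<in> carrier_mat m n \<Longrightarrow> cmat_star M \<in> carrier_mat n m"
  by auto

lemma cmat_star_index:
  "M \<in> carrier_mat m n \<Longrightarrow> i < n \<Longrightarrow> j < m \<Longrightarrow> cmat_star M $$ (i, j) = cnj (M $$ (j, i))"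
  by (auto simp: cmat_star_def)

lemma cmat_star_mult:
  assumes "M \<in> carrier_mat m n" "M' \<in> carrier_mat n k"
  shows "cmat_star (M * M') = cmat_star M' * cmat_star M"
  using assms by (intro eq_matI) (auto simp: cmat_star_def scalar_prod_def mult.commute)

lemma index_mult_mat_sum:
  assumes "X \<in> carrier_mat N N" "Y \<in> carrier_mat N N" "i < N" "j < N"
  shows "(X * Y) $$ (i, j) = (\<Sum>l<N. X $$ (i, l) * Y $$ (l, j))"
  using assms by (auto simp: scalar_prod_def lessThan_atLeast0)

lemma peval_carrier: "P \<in> carrier_mat m n \<Longrightarrow> peval P x \<in> carrier_mat m n"
  by (auto simp: peval_def)

locale weight_setup =
  fixes N :: nat and a :: "nat \<Rightarrow> real" and w :: "nat \<Rightarrow> real \<Rightarrow> real" and S :: "real set"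
  assumes poly_int: "l < N \<Longrightarrow> poly_integrable S (w (Suc l))"
    and pos_f: "l < N \<Longrightarrow> pos_functional (moment_functional S (w (Suc l)))"
begin

sublocale matrix_weight N "A_entry a" "\<lambda>l. moment_functional S (w (Suc l))"
  by (intro matrix_weight.intro pos_f A_entry_parity)

lemma matT_carrier: "matT N a x \<in> carrier_mat N N"
  by (auto simp: matT_def matA_def)

lemma peval_matT:
  assumes "P \<in> carrier_mat N N" "i < N" "l < N"
  shows "(peval P x * matT N a x) $$ (i, l) = poly (Tmul (\<lambda>r. P $$ (i, r)) l) (of_real x)"
proof -
  have T: "matT N a x $$ (r, l) = (if r = l then 1 else 0) + of_real x * A_entry a r l" if "r < N" for r
    using that assms by (simp add: matT_def matA_def A_entry_def)
  have "(peval P x * matT N a x) $$ (i, l) = (\<Sum>r<N. poly (P $$ (i, r)) (of_real x) * matT N a x $$ (r, l))"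
    using assms matT_carrier[of x] by (simp add: peval_def scalar_prod_def lessThan_atLeast0)
  also have "\<dots> = (\<Sum>r<N. (if r = l then poly (P $$ (i, l)) (of_real x) else 0)
      + of_real x * (A_entry a r l * poly (P $$ (i, r)) (of_real x)))"
    by (intro sum.cong) (auto simp: T algebra_simps)
  also have "\<dots> = poly (Tmul (\<lambda>r. P $$ (i, r)) l) (of_real x)"
    using assms by (simp add: sum.distrib Tmul_def poly_sum sum_distrib_left)
  finally show ?thesis .
qed

text \<open>Regrouping as \<open>P T\<close> times the diagonal weight times the star of
  \<open>Q T\<close> reduces each entry to a sum of scalar integrands.\<close>

lemma ip_integrand_eq:
  assumes P: "P \<in> carrier_mat N N" and Q: "Q \<in> carrier_mat N N" and ij: "i < N" "j < N"
  shows "ip_integrand S (weightW N a w) P Q i j x =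
    (\<Sum>l<N. poly (Tmul (\<lambda>r. P $$ (i, r)) l * map_poly cnj (Tmul (\<lambda>r. Q $$ (j, r)) l)) (of_real x) * of_real (w (Suc l) x))"
proof -
  let ?X = "peval P x * matT N a x" and ?Y = "peval Q x * matT N a x" and ?D = "diag_weight N w x"
  have D: "?D \<in> carrier_mat N N" by (simp add: diag_weight_def)
  have c: "peval P x \<in> carrier_mat N N" "peval Q x \<in> carrier_mat N N"
    using P Q by (auto intro: peval_carrier)
  note T = matT_carrier[of x]
  have X: "?X \<in> carrier_mat N N" and Y: "?Y \<in> carrier_mat N N" using c T by auto
  have "peval P x * weightW N a w x * cmat_star (peval Q x) = ?X * ?D * cmat_star ?Y"
  proof -
    have "peval P x * weightW N a w x = ?X * ?D * cmat_star (matT N a x)"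
      unfolding weightW_def using c T D cmat_star_carrier[OF T]
      by (simp add: assoc_mult_mat[where n\<^sub>1=N and n\<^sub>2=N and n\<^sub>3=N and n\<^sub>4=N])
    then show ?thesis
      unfolding cmat_star_mult[OF c(2) T] using X D cmat_star_carrier[OF T] cmat_star_carrier[OF c(2)]
      by (simp add: assoc_mult_mat[where n\<^sub>1=N and n\<^sub>2=N and n\<^sub>3=N and n\<^sub>4=N])
  qed
  then have "ip_integrand S (weightW N a w) P Q i j x = (?X * ?D * cmat_star ?Y) $$ (i, j)"
    by (simp add: ip_integrand_def)
  also have "\<dots> = (\<Sum>l<N. (?X * ?D) $$ (i, l) * cmat_star ?Y $$ (l, j))"
    by (rule index_mult_mat_sum[OF mult_carrier_mat[OF X D] cmat_star_carrier[OF Y] ij])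
  also have "\<dots> = (\<Sum>l<N. ?X $$ (i, l) * of_real (w (Suc l) x) * cnj (?Y $$ (j, l)))"
  proof (intro sum.cong refl)
    fix l assume "l \<in> {..<N}"
    then have l: "l < N" by simp
    have "(?X * ?D) $$ (i, l) = (\<Sum>q<N. ?X $$ (i, q) * ?D $$ (q, l))"
      by (rule index_mult_mat_sum[OF X D ij(1) l])
    also have "\<dots> = (\<Sum>q<N. if q = l then ?X $$ (i, l) * of_real (w (Suc l) x) else 0)"
      using l by (intro sum.cong) (auto simp: diag_weight_def)
    finally have "(?X * ?D) $$ (i, l) = ?X $$ (i, l) * of_real (w (Suc l) x)" using l by simp
    moreover have "cmat_star ?Y $$ (l, j) = cnj (?Y $$ (j, l))"
      by (rule cmat_star_index[OF Y l ij(2)])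
    ultimately show "(?X * ?D) $$ (i, l) * cmat_star ?Y $$ (l, j) = ?X $$ (i, l) * of_real (w (Suc l) x) * cnj (?Y $$ (j, l))"
      by simp
  qed
  also have "\<dots> = (\<Sum>l<N. poly (Tmul (\<lambda>r. P $$ (i, r)) l * map_poly cnj (Tmul (\<lambda>r. Q $$ (j, r)) l)) (of_real x) * of_real (w (Suc l) x))"
  proof -
    have "poly (map_poly cnj q) (complex_of_real x) = cnj (poly q (of_real x))" for q
      using poly_cnj[of q "of_real x"] by simp
    then show ?thesis
      by (intro sum.cong refl) (simp add: peval_matT P Q ij)
  qed
  finally show ?thesis .
qed

lemma ip_integral:
  assumes "P \<in> carrier_mat N N" "Q \<in> carrier_mat N N" "i < N" "j < N"
  shows "ip_integrand S (weightW N a w) P Q i j integrable_on S"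
    and "integral S (ip_integrand S (weightW N a w) P Q i j) = H (\<lambda>r. P $$ (i, r)) (\<lambda>r. Q $$ (j, r))"
  unfolding ip_integrand_eq[OF assms, abs_def] H_def moment_functional_def
  by (intro integrable_sum poly_integrable_on poly_int integral_sum; simp)+

text \<open>Membership in the algebra says something about all monic orthogonal sequences, so one
  must be produced: row \<open>i\<close> of \<open>P n\<close> is \<open>x^n\<close> in entry
  \<open>i\<close> minus its projection to lower degrees.\<close>

lemma leading_coeff_propertyI:
  assumes incomp: "\<And>i j. i < N \<Longrightarrow> j < N \<Longrightarrow> i \<noteq> j \<Longrightarrow>
      incompatible (moment_functional S (w (Suc i))) (moment_functional S (w (Suc j)))"
    and lead: "\<And>m. \<exists>d k. \<forall>l<N. leading_from_eigenvalues (moment_functional S (w (Suc l))) m d k \<rho>"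
    and a_nz: "\<And>l. Suc l < N \<Longrightarrow> a (Suc l) \<noteq> 0"
  shows "leading_coeff_property N S (weightW N a w) \<rho>"
  unfolding leading_coeff_property_def
proof (intro allI impI, elim conjE)
  fix F m
  assume order: "op_order N F (2 * m)" and DW: "in_DW N S (weightW N a w) F (2 * m)"
  define h where "h n i = (SOME h. h \<in> rows_lt N n \<and> (\<forall>u\<in>rows_lt N n. H u (\<lambda>l. unit_row i (monom 1 n) l - h l) = 0))" for n i
  have h: "h n i \<in> rows_lt N n \<and> (\<forall>u\<in>rows_lt N n. H u (\<lambda>l. unit_row i (monom 1 n) l - h n i l) = 0)" if "i < N" for n i
    unfolding h_def by (rule someI_ex[OF exists_orthogonal_row[OF that, unfolded Bex_def]])
  define p where "p n i = (\<lambda>l. unit_row i (monom 1 n) l - h n i l)" for n i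
  have p_deg: "p n i \<in> rows_lt N (Suc n)" if "i < N" for n i
    unfolding p_def
    by (intro rows_lt_diff unit_row_in_rows_lt monom_in_deg_lt rows_lt_mono[OF conjunct1[OF h[OF that]]]) simp_all
  have p_monic: "coeff (p n i l) n = (if i = l then 1 else 0)" if "i < N" "l < N" for n i l
    using h[OF that(1), of n] that(2) by (auto simp: p_def unit_row_def rows_lt_def deg_lt_def)
  have p_orth: "H (p n i) u = 0" if "i < N" "u \<in> rows_lt N n" for n i u
    using h[OF that(1), of n] that(2) H_commute[of "p n i" u] by (simp add: p_def)
  define P where "P n = mat N N (\<lambda>(i, j). p n i j)" for n
  have P: "P n \<in> carrier_mat N N" for n by (simp add: P_def)
  have P_row: "H (\<lambda>r. P n $$ (i, r)) u = H (p n i) u" if "i < N" for n i u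
    using that by (intro H_cong) (auto simp: P_def)
  have "monic_orth_seq N S (weightW N a w) P"
    unfolding monic_orth_seq_def
  proof (intro allI conjI impI)
    fix n
    show "monic_of_degree N (P n) n"
      using p_deg[of _ n] p_monic[of _ _ n] unfolding monic_of_degree_def
      by (auto simp: P_def degree_le_iff_deg_lt rows_lt_def intro!: eq_matI)
    fix k i j assume k: "k < n" and ij: "i < N" "j < N"
    let ?Q = "monom 1 k \<cdot>\<^sub>m 1\<^sub>m N :: complex poly mat"
    have Q: "?Q \<in> carrier_mat N N" by simp
    show "ip_integrand S (weightW N a w) (P n) ?Q i j integrable_on S"
      by (rule ip_integral(1)[OF P Q ij])
    \<comment> \<open>Row \<open>j\<close> of \<open>x^k I\<close> has degree below
      \<open>n\<close>, so the orthogonality of the rows \<open>p n i\<close> applies to it.\<close>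
    have "(\<lambda>r. ?Q $$ (j, r)) \<in> rows_lt N n"
      using k ij by (auto simp: rows_lt_def intro: monom_in_deg_lt)
    then show "integral S (ip_integrand S (weightW N a w) (P n) ?Q i j) = 0"
      unfolding ip_integral(2)[OF P Q ij] P_row[OF ij(1)] by (rule p_orth[OF ij(1)])
  qed
  then have "\<forall>n. \<exists>\<Lambda>\<in>carrier_mat N N. diff_act N F (2 * m) (P n) = map_mat (\<lambda>c. [:c:]) \<Lambda> * P n"
    using DW unfolding in_DW_def by blast
  then obtain \<Lambda> where \<Lambda>: "\<And>n. \<Lambda> n \<in> carrier_mat N N"
    "\<And>n. diff_act N F (2 * m) (P n) = map_mat (\<lambda>c. [:c:]) (\<Lambda> n) * P n"
    by metis
  have eigen: "(\<Sum>l<N. diff_sum (Suc (2 * m)) (\<lambda>j. F j $$ (l, s)) (p n i l)) = (\<Sum>q<N. smult (\<Lambda> n $$ (i, q)) (p n q s))"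
    if "i < N" "s < N" for n i s
  proof -
    have "(\<Sum>l<N. diff_sum (Suc (2 * m)) (\<lambda>j. F j $$ (l, s)) (p n i l)) = diff_act N F (2 * m) (P n) $$ (i, s)"
      using that unfolding diff_act_def diff_sum_def
      by (simp add: P_def lessThan_Suc_atMost) (subst sum.swap, simp)
    also have "\<dots> = (\<Sum>q<N. smult (\<Lambda> n $$ (i, q)) (p n q s))"
      unfolding \<Lambda>(2) using \<Lambda>(1)[of n] that by (simp add: P_def scalar_prod_def lessThan_atLeast0)
    finally show ?thesis .
  qed
  interpret diagonal_operator N "A_entry a" "\<lambda>l. moment_functional S (w (Suc l))" "2 * m"
    "\<lambda>j r s. F j $$ (r, s)" p "\<lambda>n i q. \<Lambda> n $$ (i, q)"
    by unfold_locales (use p_deg p_monic p_orth eigen incomp in auto)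
  obtain d k where "\<And>l. l < N \<Longrightarrow> leading_from_eigenvalues (moment_functional S (w (Suc l))) m d k \<rho>"
    using lead[of m] by blast
  from leading_coefficients[OF refl this A_entry_neighbour[of a, OF a_nz]]
  obtain c where c: "\<forall>r<N. \<forall>s<N. F (2 * m) $$ (r, s) = (if r = s then smult c (\<rho> ^ m) else 0)" by blast
  have "F (2 * m) \<in> carrier_mat N N" using order by (simp add: op_order_def)
  then have "F (2 * m) = ([:c:] * \<rho> ^ m) \<cdot>\<^sub>m 1\<^sub>m N"
    using c by (intro eq_matI) auto
  then show "\<exists>c. F (2 * m) = ([:c:] * \<rho> ^ m) \<cdot>\<^sub>m 1\<^sub>m N" by blast
qed

end

theorem theorem3p10:
  fixes N :: nat and a :: "nat \<Rightarrow> real"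
    and b \<alpha> \<beta> :: "nat \<Rightarrow> real"
  assumes N2: "N \<ge> 2"
    and a_nz: "\<forall>j\<in>{1..N-1}. a j \<noteq> 0"
  shows
    "((\<forall>i\<in>{1..N}. \<forall>j\<in>{1..N}. i \<noteq> j \<longrightarrow> b i \<noteq> b j) \<longrightarrow>
       leading_coeff_property N UNIV (weightW N a (\<lambda>i. hermite_w (b i))) 1)
   \<and> ((\<forall>i\<in>{1..N}. \<alpha> i > -1) \<and>
       (\<forall>i\<in>{1..N}. \<forall>j\<in>{1..N}. i \<noteq> j \<longrightarrow> \<alpha> i - \<alpha> j \<notin> \<int>) \<longrightarrow>
       leading_coeff_property N {0<..} (weightW N a (\<lambda>i. laguerre_w (\<alpha> i))) [:0, 1:])
   \<and> ((\<forall>i\<in>{1..N}. \<alpha> i > -1 \<and> \<beta> i > -1) \<and>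
       (\<forall>i\<in>{1..N}. \<forall>j\<in>{1..N}. i \<noteq> j \<longrightarrow> \<alpha> i - \<alpha> j \<notin> \<int> \<or> \<beta> i - \<beta> j \<notin> \<int>) \<and>
       (\<forall>j\<in>{1..N}. \<alpha> 1 + \<beta> 1 = \<alpha> j + \<beta> j + 1 + (-1) ^ j) \<longrightarrow>
       leading_coeff_property N {-1<..<1} (weightW N a (\<lambda>i. jacobi_w (\<alpha> i) (\<beta> i))) [:1, 0, -1:])"
proof (intro conjI impI; (elim conjE)?)
  have a_Suc: "a (Suc l) \<noteq> 0" if "Suc l < N" for l
    using a_nz that by auto
  have deg_lt_linear: "[:c, d:] \<in> deg_lt (Suc (Suc 0))" for c d
    by (simp add: degree_le_iff_deg_lt[symmetric])
  {
    assume b: "\<forall>i\<in>{1..N}. \<forall>j\<in>{1..N}. i \<noteq> j \<longrightarrow> b i \<noteq> b j"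
    interpret weight_setup N a "\<lambda>i. hermite_w (b i)" UNIV
      using pearson_functional_hermite
      by unfold_locales (auto simp: poly_integrable_hermite pearson_functional_def pos_functional_def)
    show "leading_coeff_property N UNIV (weightW N a (\<lambda>i. hermite_w (b i))) 1"
    proof (rule leading_coeff_propertyI)
      show "incompatible (moment_functional UNIV (hermite_w (b (Suc i)))) (moment_functional UNIV (hermite_w (b (Suc j))))"
        if "i < N" "j < N" "i \<noteq> j" for i j
        using that b by (intro incompatible_hermite) auto
      show "\<exists>d k. \<forall>l<N. leading_from_eigenvalues (moment_functional UNIV (hermite_w (b (Suc l)))) m d k 1" for m
      proof (intro exI allI impI)
        fix l
        \<comment> \<open>The base of the power is the inverse of the coefficient -2 of
          \<open>x\<close> in the Hermite \<open>\<tau>\<close>; for Laguerre that coefficient is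
          -1.\<close>
        show "leading_from_eigenvalues (moment_functional UNIV (hermite_w (b (Suc l)))) m m ((- 1 / 2) ^ m) 1"
          by (rule pearson_functional.leading_from_eigenvalues_linear[OF pearson_functional_hermite])
             (auto simp: deg_lt_linear degree_le_iff_deg_lt[symmetric])
      qed
    qed (rule a_Suc)
  next
    assume \<alpha>: "\<forall>i\<in>{1..N}. \<alpha> i > -1"
      and nonint: "\<forall>i\<in>{1..N}. \<forall>j\<in>{1..N}. i \<noteq> j \<longrightarrow> \<alpha> i - \<alpha> j \<notin> \<int>"
    have \<alpha>': "\<alpha> (Suc l) > -1" if "l < N" for l using \<alpha> that by auto
    interpret weight_setup N a "\<lambda>i. laguerre_w (\<alpha> i)" "{0<..}"
      using pearson_functional_laguerre[OF \<alpha>']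
      by unfold_locales (auto simp: poly_integrable_laguerre \<alpha>' pearson_functional_def pos_functional_def)
    show "leading_coeff_property N {0<..} (weightW N a (\<lambda>i. laguerre_w (\<alpha> i))) [:0, 1:]"
    proof (rule leading_coeff_propertyI)
      show "incompatible (moment_functional {0<..} (laguerre_w (\<alpha> (Suc i)))) (moment_functional {0<..} (laguerre_w (\<alpha> (Suc j))))"
        if "i < N" "j < N" "i \<noteq> j" for i j
        using that nonint by (intro incompatible_laguerre \<alpha>') auto
      show "\<exists>d k. \<forall>l<N. leading_from_eigenvalues (moment_functional {0<..} (laguerre_w (\<alpha> (Suc l)))) m d k [:0, 1:]" for m
      proof (intro exI allI impI)
        fix l assume "l < N"
        show "leading_from_eigenvalues (moment_functional {0<..} (laguerre_w (\<alpha> (Suc l)))) m m ((- 1) ^ m) [:0, 1:]"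
          by (rule pearson_functional.leading_from_eigenvalues_linear[OF pearson_functional_laguerre[OF \<alpha>'[OF \<open>l < N\<close>]]])
             (auto simp: deg_lt_linear)
      qed
    qed (rule a_Suc)
  next
    assume gt: "\<forall>i\<in>{1..N}. \<alpha> i > -1 \<and> \<beta> i > -1"
      and nonint: "\<forall>i\<in>{1..N}. \<forall>j\<in>{1..N}. i \<noteq> j \<longrightarrow> \<alpha> i - \<alpha> j \<notin> \<int> \<or> \<beta> i - \<beta> j \<notin> \<int>"
    have gt': "\<alpha> (Suc l) > -1" "\<beta> (Suc l) > -1" if "l < N" for l using gt that by auto
    interpret weight_setup N a "\<lambda>i. jacobi_w (\<alpha> i) (\<beta> i)" "{-1<..<1}"
      using pearson_functional_jacobi[OF gt']
      by unfold_locales (auto simp: poly_integrable_jacobi gt' pearson_functional_def pos_functional_def)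
    show "leading_coeff_property N {-1<..<1} (weightW N a (\<lambda>i. jacobi_w (\<alpha> i) (\<beta> i))) [:1, 0, -1:]"
    proof (rule leading_coeff_propertyI)
      show "incompatible (moment_functional {-1<..<1} (jacobi_w (\<alpha> (Suc i)) (\<beta> (Suc i))))
          (moment_functional {-1<..<1} (jacobi_w (\<alpha> (Suc j)) (\<beta> (Suc j))))"
        if "i < N" "j < N" "i \<noteq> j" for i j
        using that nonint by (intro incompatible_jacobi gt') auto
      show "\<exists>d k. \<forall>l<N. leading_from_eigenvalues (moment_functional {-1<..<1} (jacobi_w (\<alpha> (Suc l)) (\<beta> (Suc l)))) m d k [:1, 0, -1:]" for m
      proof (intro exI allI impI)
        fix l assume "l < N"
        show "leading_from_eigenvalues (moment_functional {-1<..<1} (jacobi_w (\<alpha> (Suc l)) (\<beta> (Suc l)))) m (2 * m) ((- 1) ^ m) [:1, 0, -1:]"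
          by (rule pearson_functional.leading_from_eigenvalues_jacobi[OF pearson_functional_jacobi[OF gt'[OF \<open>l < N\<close>]]])
             (auto simp: deg_lt_linear)
      qed
    qed (rule a_Suc)
  }
qed

end
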